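(* Let $p>0$, and let $f$ be a log-concave (not necessarily symmetric) probability density on $\mathbb{R}^n$. Then $C_1(f)$ and $R_p(f)$ are symmetric convex bodies. Furthermore, we have $$C_1(f)=I(\hat f)=(n-1)\,I(R_{n-1}(f)),$$ $$R_p(f)=B_p(\hat f),$$ where $$\hat f(x)=\int_{\mathbb{R}^n}f(y)f(x+y)\,dy.$$
   Context: The set with radial function $\rho:\mathbb{S}^{n-1}\to[0,\infty)$ is $\{rv: v\in\mathbb{S}^{n-1},\ 0\le r\le\rho(v)\}$. A convex body is a compact convex set with nonempty interior; a set $K$ is symmetric if $K=-K$. For $v\in\mathbb{S}^{n-1}$, $v^\perp$ is the subspace orthogonal to $v$; integrals over $v^\perp$ and its translates are with respect to $(n-1)$-dimensional Lebesgue measure. For a real number $c$ and a set $L$, $cL=\{cx:x\in L\}$. A density $f$ is log-concave if $f(\lambda x+(1-\lambda)y)\ge f(x)^\lambda f(y)^{1-\lambda}$ for all $x,y\in\mathbb{R}^n$, $\lambda\in[0,1]$. The following bodies are defined by their radial functions, for $v\in\mathbb{S}^{n-1}$: - cross-section body $C_1(f)$: $\rho_{C_1(f)}(v)=\int_{\mathbb{R}^n}\left(\int_{x+v^\perp}f(y)\,dy\right)f(x)\,dx$; - $p$-th radial mean body $R_p(f)$: $\rho_{R_p(f)}(v)=\left(\int_{\mathbb{R}^n}f(x)\int_0^\infty r^{p-1}f(x+rv)\,dr\,dx\right)^{1/p}$; - intersection body $I(g)$ of a density $g$: $\rho_{I(g)}(v)=\int_{v^\perp}g(x)\,dx$; for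 a set $L$, $I(L)$ is given by $\rho_{I(L)}(v)=|L\cap v^\perp|$ ($(n-1)$-dimensional volume); - Ball's $p$-th mean body $B_p(g)$: $\rho_{B_p(g)}(v)=\left(\int_0^\infty r^{p-1}g(rv)\,dr\right)^{1/p}$. *)

theory Defs
  imports "HOL-Analysis.Analysis"
begin

definition orthonormal_basis_of :: "'a::euclidean_space set \<Rightarrow> 'a set \<Rightarrow> bool" where
  "orthonormal_basis_of S B \<longleftrightarrow>
     pairwise orthogonal B \<and> (\<forall>b\<in>B. norm b = 1) \<and> span B = S"

lemma ex_orthonormal_basis_of:
  assumes "subspace S"
  shows "\<exists>B. orthonormal_basis_of S B"
  using orthonormal_basis_subspace[OF assms] unfolding orthonormal_basis_of_def by metis

(* Lebesgue measure of dimension dim S on the flat x + S, as a measure on the ambient space.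
   It copies the definition of lborel, with an orthonormal basis of S in place of Basis; by
   rotation invariance the choice of that basis is immaterial.  The completion is essential: a
   log-concave function is Lebesgue but not always Borel measurable on a hyperplane.  If S = {0},
   this is the unit point mass at x. *)
definition flat_lebesgue :: "'a::euclidean_space \<Rightarrow> 'a set \<Rightarrow> 'a measure" where
  "flat_lebesgue x S =
     (let B = (SOME B. orthonormal_basis_of S B)
      in completion (distr (\<Pi>\<^sub>M b\<in>B. lborel) borel (\<lambda>c. x + (\<Sum>b\<in>B. c b *\<^sub>R b))))"

definition radial_set :: "('a::euclidean_space \<Rightarrow> real) \<Rightarrow> 'a set" where
  "radial_set \<rho> = {r *\<^sub>R v | r v. v \<in> sphere 0 1 \<and> 0 \<le> r \<and> r \<le> \<rho> v}"

definition symmetric_set :: "'a::real_vector set \<Rightarrow> bool" where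
  "symmetric_set K \<longleftrightarrow> K = uminus ` K"

definition convex_body :: "'a::euclidean_space set \<Rightarrow> bool" where
  "convex_body K \<longleftrightarrow> compact K \<and> convex K \<and> interior K \<noteq> {}"

definition probability_density :: "('a::euclidean_space \<Rightarrow> real) \<Rightarrow> bool" where
  "probability_density f \<longleftrightarrow> (\<forall>x. 0 \<le> f x) \<and> has_bochner_integral lebesgue f 1"

(* For nonnegative f the Isabelle convention 0 powr 0 = 0 is harmless here: for l = 0 and l = 1
   the inequality holds trivially, under this convention and under 0 powr 0 = 1 alike. *)
definition log_concave :: "('a::real_vector \<Rightarrow> real) \<Rightarrow> bool" where
  "log_concave f \<longleftrightarrow>
     (\<forall>x y. \<forall>l\<in>{0..1}. f (l *\<^sub>R x + (1 - l) *\<^sub>R y) \<ge> f x powr l * f y powr (1 - l))"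

definition cross_section_body :: "('a::euclidean_space \<Rightarrow> real) \<Rightarrow> 'a set" where
  "cross_section_body f =
     radial_set (\<lambda>v. LINT x|lebesgue. (LINT y|flat_lebesgue x ({v}\<^sup>\<bottom>). f y) * f x)"

definition radial_mean_body :: "real \<Rightarrow> ('a::euclidean_space \<Rightarrow> real) \<Rightarrow> 'a set" where
  "radial_mean_body p f =
     radial_set (\<lambda>v. (LINT x|lebesgue. f x *
       (LINT r:{0..}|lebesgue. r powr (p - 1) * f (x + r *\<^sub>R v))) powr (1 / p))"

definition intersection_body_fun :: "('a::euclidean_space \<Rightarrow> real) \<Rightarrow> 'a set" where
  "intersection_body_fun g = radial_set (\<lambda>v. LINT x|flat_lebesgue 0 ({v}\<^sup>\<bottom>). g x)"

definition intersection_body_set :: "'a::euclidean_space set \<Rightarrow> 'a set" where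
  "intersection_body_set L =
     radial_set (\<lambda>v. measure (flat_lebesgue 0 ({v}\<^sup>\<bottom>)) (L \<inter> {v}\<^sup>\<bottom>))"

definition ball_mean_body :: "real \<Rightarrow> ('a::euclidean_space \<Rightarrow> real) \<Rightarrow> 'a set" where
  "ball_mean_body p g =
     radial_set (\<lambda>v. (LINT r:{0..}|lebesgue. r powr (p - 1) * g (r *\<^sub>R v)) powr (1 / p))"

definition autocorrelation :: "('a::euclidean_space \<Rightarrow> real) \<Rightarrow> 'a \<Rightarrow> real" where
  "autocorrelation f x = (LINT y|lebesgue. f y * f (x + y))"

end

theory Submission
  imports Defs
begin

text \<open>Everything is expressed through the autocorrelation \<open>g\<close> of \<open>f\<close>. Tonelli turns the radial
  functions of \<open>C\<^sub>1(f)\<close> and \<open>R\<^sub>p(f)\<close> into hyperplane integrals and radial moments of \<open>g\<close>; since only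
  almost every translate matters, \<open>f\<close> may be replaced by its restriction to the interior of its
  support, which is a Borel function. By Prekopa-Leindler \<open>g\<close> is an even log-concave function, it is
  continuous, and it decays exponentially. Ball's inequality says that
  \<open>(\<integral> r\<^bsup>p - 1\<^esup> g(r x) dr)\<^bsup>- 1 / p\<^esup>\<close> is a norm, which settles \<open>R\<^sub>p(f)\<close>; applied with \<open>p = 1\<close> to
  two-dimensional marginals of \<open>g\<close> it gives Busemann's theorem for \<open>C\<^sub>1(f)\<close>. The identity with
  \<open>I(R\<^bsub>n - 1\<^esub>(f))\<close> is integration in polar coordinates inside each hyperplane.\<close>

section \<open>The Prekopa-Leindler inequality\<close>

text \<open>Prekopa-Leindler is proved only for midpoints, as
  \<open>f x * g y \<le> h m * h m\<close> with values in \<open>ennreal\<close>: this form survives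
  the induction over coordinates without powers or finiteness conditions. For a continuous function
  the midpoint inequality already yields every exponent, so nothing is lost for the autocorrelation.
  Two obstacles shape the rest. A log-concave density is arbitrary, up to convexity, on the boundary
  of its support: it may fail to be Borel there, and a particular hyperplane or line may run inside
  that boundary, so inner integrals are identified only for almost every base point. And
  \<open>flat_lebesgue\<close> uses an unspecified orthonormal basis, while Busemann's argument
  needs a basis adapted to a plane, which forces a proof that the basis does not matter. Each body
  is described through the reciprocal of its radial function, extended homogeneously. Being a
  symmetric convex body then means that this gauge is a norm, and an equality of bodies becomes an
  equality of gauges.\<close>

interpretation lborel_prod: product_sigma_finite "\<lambda>_. lborel::real measure" ..

text \<open>Substitution in one coordinate at a time. Translation invariance (\<open>s = 1\<close>),
  reflection invariance (\<open>s = - 1\<close>) and scaling of Lebesgue measure on subspaces all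
  come from this formula. The restriction to \<open>I\<close> keeps the argument in the extensional
  space of the product measure.\<close>

lemma nn_integral_PiM_affine:
  fixes \<phi> :: "('i \<Rightarrow> real) \<Rightarrow> ennreal" and a :: "'i \<Rightarrow> real" and s :: real
  assumes "finite I" "s \<noteq> 0" "\<phi> \<in> borel_measurable (\<Pi>\<^sub>M i\<in>I. lborel)"
  shows "(\<integral>\<^sup>+c. \<phi> c \<partial>(\<Pi>\<^sub>M i\<in>I. lborel)) =
     ennreal (\<bar>s\<bar> ^ card I) * (\<integral>\<^sup>+c. \<phi> (\<lambda>i\<in>I. a i + s * c i) \<partial>(\<Pi>\<^sub>M i\<in>I. lborel))"
  using assms(1,3)
proof (induction I arbitrary: \<phi>)
  case empty
  show ?case by (subst (1 2) lborel_prod.nn_integral_empty) (auto simp: restrict_def)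
next
  case (insert j I)
  note [measurable] = insert.prems
  let ?P = "\<lambda>I. \<Pi>\<^sub>M i\<in>I. (lborel :: real measure)"
  have meas: "(\<lambda>c. \<lambda>i\<in>insert j I. a i + s * c i) \<in> ?P (insert j I) \<rightarrow>\<^sub>M ?P (insert j I)"
    by measurable
  have m2: "(\<lambda>x. \<integral>\<^sup>+y. \<phi> (x(j := y)) \<partial>lborel) \<in> borel_measurable (?P I)"
    by measurable
  have eq: "(\<lambda>i\<in>insert j I. a i + s * (x(j := y)) i) = (\<lambda>i\<in>I. a i + s * x i)(j := a j + s * y)"
    for x :: "'i \<Rightarrow> real" and y
    using insert.hyps by (auto simp: fun_eq_iff)
  have "(\<integral>\<^sup>+c. \<phi> c \<partial>?P (insert j I)) = (\<integral>\<^sup>+x. \<integral>\<^sup>+y. \<phi> (x(j := y)) \<partial>lborel \<partial>?P I)"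
    by (rule lborel_prod.product_nn_integral_insert[OF insert.hyps(1,2)]) (rule insert.prems)
  also have "\<dots> = ennreal (\<bar>s\<bar> ^ card I) *
      (\<integral>\<^sup>+x. \<integral>\<^sup>+y. \<phi> ((\<lambda>i\<in>I. a i + s * x i)(j := y)) \<partial>lborel \<partial>?P I)"
    by (rule insert.IH[OF m2])
  also have "(\<integral>\<^sup>+x. \<integral>\<^sup>+y. \<phi> ((\<lambda>i\<in>I. a i + s * x i)(j := y)) \<partial>lborel \<partial>?P I) =
      (\<integral>\<^sup>+x. ennreal \<bar>s\<bar> * (\<integral>\<^sup>+y. \<phi> (\<lambda>i\<in>insert j I. a i + s * (x(j := y)) i) \<partial>lborel) \<partial>?P I)"
  proof (rule nn_integral_cong)
    fix x assume "x \<in> space (?P I)"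
    have x': "(\<lambda>i\<in>I. a i + s * x i) \<in> space (?P I)"
      by (simp add: space_PiM)
    have "(\<lambda>y. (\<lambda>i\<in>I. a i + s * x i)(j := y)) \<in> borel \<rightarrow>\<^sub>M ?P (insert j I)"
      using measurable_component_update[OF x' insert.hyps(2)] by simp
    then have "(\<lambda>y. \<phi> ((\<lambda>i\<in>I. a i + s * x i)(j := y))) \<in> borel_measurable borel"
      by measurable
    from nn_integral_real_affine[OF this \<open>s \<noteq> 0\<close>, of "a j"]
    show "(\<integral>\<^sup>+y. \<phi> ((\<lambda>i\<in>I. a i + s * x i)(j := y)) \<partial>lborel) =
      ennreal \<bar>s\<bar> * (\<integral>\<^sup>+y. \<phi> (\<lambda>i\<in>insert j I. a i + s * (x(j := y)) i) \<partial>lborel)"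
      unfolding eq .
  qed
  also have "\<dots> = ennreal \<bar>s\<bar> *
      (\<integral>\<^sup>+x. \<integral>\<^sup>+y. \<phi> (\<lambda>i\<in>insert j I. a i + s * (x(j := y)) i) \<partial>lborel \<partial>?P I)"
    unfolding eq by (rule nn_integral_cmult) measurable
  also have "(\<integral>\<^sup>+x. \<integral>\<^sup>+y. \<phi> (\<lambda>i\<in>insert j I. a i + s * (x(j := y)) i) \<partial>lborel \<partial>?P I) =
      (\<integral>\<^sup>+c. \<phi> (\<lambda>i\<in>insert j I. a i + s * c i) \<partial>?P (insert j I))"
    by (rule lborel_prod.product_nn_integral_insert[OF insert.hyps(1,2), symmetric]) measurable
  also have "ennreal (\<bar>s\<bar> ^ card I) * (ennreal \<bar>s\<bar> *
      (\<integral>\<^sup>+c. \<phi> (\<lambda>i\<in>insert j I. a i + s * c i) \<partial>?P (insert j I))) =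
      ennreal (\<bar>s\<bar> ^ card (insert j I)) * (\<integral>\<^sup>+c. \<phi> (\<lambda>i\<in>insert j I. a i + s * c i) \<partial>?P (insert j I))"
  proof -
    have "ennreal (\<bar>s\<bar> ^ card (insert j I)) = ennreal (\<bar>s\<bar> ^ card I) * ennreal \<bar>s\<bar>"
      using insert.hyps by (simp add: ennreal_mult' mult.commute)
    then show ?thesis by (simp only: mult.assoc)
  qed
  finally show ?case .
qed

text \<open>The lower piece of \<open>A\<close> moved by \<open>b\<close> ends at
  \<open>a + b\<close>, and the upper piece of \<open>B\<close> moved by \<open>a\<close> starts
  strictly after \<open>a + b\<close>. Both translates lie in \<open>C\<close> and are disjoint, so
  their measures add.\<close>

lemma emeasure_lborel_sumset_ge:
  fixes A B C :: "real set"
  assumes [measurable]: "A \<in> sets borel" "B \<in> sets borel" "C \<in> sets borel"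
    and "a \<in> A" "b \<in> B"
    and sum: "\<And>x y. x \<in> A \<Longrightarrow> y \<in> B \<Longrightarrow> x + y \<in> C"
  shows "emeasure lborel (A \<inter> {..a}) + emeasure lborel (B \<inter> {b<..}) \<le> emeasure lborel C"
proof -
  have tr: "emeasure lborel ((\<lambda>x. d + x) -` X) = emeasure lborel X" if "X \<in> sets borel" for d :: real and X
    using that by (subst lborel_distr_plus[of d, symmetric], subst emeasure_distr) auto
  let ?A' = "(\<lambda>x. - b + x) -` (A \<inter> {..a})" and ?B' = "(\<lambda>x. - a + x) -` (B \<inter> {b<..})"
  have m: "?A' \<in> sets borel" "?B' \<in> sets borel"
    by (auto intro!: borel_measurable_vimage measurable_sets_borel[where M=borel])
  have "emeasure lborel (A \<inter> {..a}) + emeasure lborel (B \<inter> {b<..}) = emeasure lborel ?A' + emeasure lborel ?B'"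
    by (simp only: tr assms sets.Int borel_closed borel_open closed_atMost open_greaterThan)
  also have "\<dots> = emeasure lborel (?A' \<union> ?B')"
    using m by (intro plus_emeasure) auto
  also have "\<dots> \<le> emeasure lborel C"
  proof (rule emeasure_mono)
    show "?A' \<union> ?B' \<subseteq> C"
      using sum[OF _ \<open>b \<in> B\<close>] sum[OF \<open>a \<in> A\<close>] by (force simp: algebra_simps)
  qed simp
  finally show ?thesis .
qed

text \<open>With \<open>a\<close> near the supremum of \<open>A\<close> and \<open>b\<close> near
  the infimum of \<open>B\<close>, the two pieces of the previous lemma miss arbitrarily little;
  unbounded sets are exhausted by intervals. \<open>C\<close> is any Borel set containing the sums
  because the sumset itself need not be Borel.\<close>

lemma brunn_minkowski_real:
  fixes A B C :: "real set"
  assumes [measurable]: "A \<in> sets borel" "B \<in> sets borel" "C \<in> sets borel"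
    and "A \<noteq> {}" "B \<noteq> {}"
    and sum: "\<And>x y. x \<in> A \<Longrightarrow> y \<in> B \<Longrightarrow> x + y \<in> C"
  shows "emeasure lborel A + emeasure lborel B \<le> emeasure lborel C"
proof -
  have bounded_case: "emeasure lborel A + emeasure lborel B \<le> emeasure lborel C"
    if A[measurable]: "A \<in> sets borel" "A \<noteq> {}" "bounded A"
      and B[measurable]: "B \<in> sets borel" "B \<noteq> {}" "bounded B"
      and sum: "\<And>x y. x \<in> A \<Longrightarrow> y \<in> B \<Longrightarrow> x + y \<in> C" for A B :: "real set"
  proof (rule ennreal_le_epsilon)
    fix e :: real assume "0 < e"
    have bdd: "bdd_above A" "bdd_below B"
      using A B by (auto simp: bounded_imp_bdd_above bounded_imp_bdd_below)
    obtain a where a: "a \<in> A" "Sup A - e / 2 < a"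
      using less_cSup_iff[OF A(2) bdd(1), of "Sup A - e / 2"] \<open>0 < e\<close> by auto
    obtain b where b: "b \<in> B" "b < Inf B + e / 2"
      using cInf_less_iff[OF B(2) bdd(2), of "Inf B + e / 2"] \<open>0 < e\<close> by auto
    have "emeasure lborel A \<le> emeasure lborel ((A \<inter> {..a}) \<union> {a..Sup A})"
      by (rule emeasure_mono) (use cSup_upper[OF _ bdd(1)] in auto)
    also have "\<dots> \<le> emeasure lborel (A \<inter> {..a}) + emeasure lborel {a..Sup A}"
      by (rule emeasure_subadditive) auto
    also have "emeasure lborel {a..Sup A} \<le> ennreal (e / 2)"
      using a cSup_upper[OF a(1) bdd(1)] by (auto simp: ennreal_leI)
    finally have 1: "emeasure lborel A \<le> emeasure lborel (A \<inter> {..a}) + ennreal (e / 2)"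
      by (simp add: add_left_mono)
    have "emeasure lborel B \<le> emeasure lborel ((B \<inter> {b<..}) \<union> {Inf B..b})"
      by (rule emeasure_mono) (use cInf_lower[OF _ bdd(2)] in auto)
    also have "\<dots> \<le> emeasure lborel (B \<inter> {b<..}) + emeasure lborel {Inf B..b}"
      by (rule emeasure_subadditive) auto
    also have "emeasure lborel {Inf B..b} \<le> ennreal (e / 2)"
      using b cInf_lower[OF b(1) bdd(2)] by (auto simp: ennreal_leI)
    finally have 2: "emeasure lborel B \<le> emeasure lborel (B \<inter> {b<..}) + ennreal (e / 2)"
      by (simp add: add_left_mono)
    have "emeasure lborel A + emeasure lborel B \<le>
        (emeasure lborel (A \<inter> {..a}) + ennreal (e / 2)) + (emeasure lborel (B \<inter> {b<..}) + ennreal (e / 2))"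
      by (rule add_mono[OF 1 2])
    also have "\<dots> = (emeasure lborel (A \<inter> {..a}) + emeasure lborel (B \<inter> {b<..})) + ennreal e"
      using \<open>0 < e\<close> by (simp add: ac_simps ennreal_plus[symmetric] del: ennreal_plus)
    also have "\<dots> \<le> emeasure lborel C + ennreal e"
      by (intro add_right_mono emeasure_lborel_sumset_ge a b sum) auto
    finally show "emeasure lborel A + emeasure lborel B \<le> emeasure lborel C + ennreal e" .
  qed
  let ?A = "\<lambda>k::nat. A \<inter> {- real k..real k}" and ?B = "\<lambda>k::nat. B \<inter> {- real k..real k}"
  have lim: "(\<lambda>k. emeasure lborel (X \<inter> {- real k..real k})) \<longlonglongrightarrow> emeasure lborel X"
    if [measurable]: "X \<in> sets borel" for X
  proof -
    have "(\<lambda>k. emeasure lborel (X \<inter> {- real k..real k})) \<longlonglongrightarrow> emeasure lborel (\<Union>k. X \<inter> {- real k..real k})"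
      by (rule Lim_emeasure_incseq) (auto simp: incseq_def)
    also have "(\<Union>k. X \<inter> {- real k..real k}) = X"
    proof -
      have "\<exists>k. x \<in> {- real k..real k}" for x
      proof -
        obtain k where "\<bar>x\<bar> \<le> real k" using real_arch_simple by blast
        then show ?thesis by (intro exI[of _ k]) (auto simp: abs_le_iff)
      qed
      then show ?thesis by blast
    qed
    finally show ?thesis .
  qed
  obtain a b where ab: "a \<in> A" "b \<in> B" using assms by auto
  show ?thesis
  proof (rule tendsto_upperbound)
    show "(\<lambda>k. emeasure lborel (?A k) + emeasure lborel (?B k)) \<longlonglongrightarrow> emeasure lborel A + emeasure lborel B"
      by (intro tendsto_add lim) auto
    obtain K :: nat where K: "\<bar>a\<bar> + \<bar>b\<bar> \<le> real K" using real_arch_simple by blast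
    show "\<forall>\<^sub>F k in sequentially. emeasure lborel (?A k) + emeasure lborel (?B k) \<le> emeasure lborel C"
      using eventually_ge_at_top[of K]
    proof eventually_elim
      case (elim k)
      then have "\<bar>a\<bar> + \<bar>b\<bar> \<le> real k" using K by linarith
      then have "a \<in> ?A k" "b \<in> ?B k" using ab by auto
      then have "?A k \<noteq> {}" "?B k \<noteq> {}" by blast+
      then show ?case
        by (intro bounded_case) (auto intro: sum bounded_subset[of "{- real k..real k}"])
    qed
  qed simp
qed

text \<open>Layer-cake formula cut off at height 1. Only heights in the open unit interval will be
  compared, since there the superlevel sets of normalized functions are nonempty.\<close>

lemma nn_integral_superlevel_sets:
  fixes F :: "real \<Rightarrow> real"
  assumes [measurable]: "F \<in> borel_measurable borel"
  shows "(\<integral>\<^sup>+\<tau>. indicator {0<..<1} \<tau> * emeasure lborel {x. \<tau> < F x} \<partial>lborel) = (\<integral>\<^sup>+x. ennreal (min 1 (F x)) \<partial>lborel)"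
proof -
  have "(\<integral>\<^sup>+\<tau>. indicator {0<..<1} \<tau> * emeasure lborel {x. \<tau> < F x} \<partial>lborel) =
     (\<integral>\<^sup>+\<tau>. \<integral>\<^sup>+x. indicator {0<..<1} \<tau> * indicator {x. \<tau> < F x} x \<partial>lborel \<partial>lborel)"
    by (intro nn_integral_cong) (simp add: nn_integral_cmult)
  also have "\<dots> = (\<integral>\<^sup>+\<tau>. \<integral>\<^sup>+x. indicator {z. 0 < fst z \<and> fst z < 1 \<and> fst z < F (snd z)} (\<tau>, x) \<partial>lborel \<partial>lborel)"
    by (intro nn_integral_cong) (auto split: split_indicator)
  also have "\<dots> = (\<integral>\<^sup>+x. \<integral>\<^sup>+\<tau>. indicator {z. 0 < fst z \<and> fst z < 1 \<and> fst z < F (snd z)} (\<tau>, x) \<partial>lborel \<partial>lborel)"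
    by (rule lborel_pair.Fubini'[symmetric]) (simp add: case_prod_beta')
  also have "\<dots> = (\<integral>\<^sup>+x. ennreal (min 1 (F x)) \<partial>lborel)"
  proof (rule nn_integral_cong)
    fix x
    have "(\<integral>\<^sup>+\<tau>. indicator {z. 0 < fst z \<and> fst z < 1 \<and> fst z < F (snd z)} (\<tau>, x) \<partial>lborel)
       = (\<integral>\<^sup>+\<tau>. indicator {0<..<min 1 (F x)} \<tau> \<partial>lborel)"
      by (intro nn_integral_cong) (auto split: split_indicator)
    also have "\<dots> = ennreal (min 1 (F x))"
      by (cases "0 \<le> F x") (auto simp: ennreal_neg)
    finally show "(\<integral>\<^sup>+\<tau>. indicator {z. 0 < fst z \<and> fst z < 1 \<and> fst z < F (snd z)} (\<tau>, x) \<partial>lborel) = ennreal (min 1 (F x))" .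
  qed
  finally show ?thesis .
qed

text \<open>When both suprema equal 1, the superlevel sets at every height below 1 are nonempty
  together, so Brunn-Minkowski on the line applies height by height. The resulting bound on the sum
  of the integrals is stronger than a bound on their product.\<close>

lemma prekopa_leindler_normalized:
  fixes f g h :: "real \<Rightarrow> real"
  assumes [measurable]: "f \<in> borel_measurable borel" "g \<in> borel_measurable borel" "h \<in> borel_measurable borel"
    and le1: "\<And>x. f x \<le> 1" "\<And>x. g x \<le> 1"
    and sup1: "\<And>\<tau>. \<tau> < 1 \<Longrightarrow> \<exists>x. \<tau> < f x" "\<And>\<tau>. \<tau> < 1 \<Longrightarrow> \<exists>x. \<tau> < g x"
    and mid: "\<And>x y. min (f x) (g y) \<le> h ((x + y) / 2)"
  shows "(\<integral>\<^sup>+x. f x \<partial>lborel) + (\<integral>\<^sup>+x. g x \<partial>lborel) \<le> 2 * (\<integral>\<^sup>+x. h x \<partial>lborel)"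
proof -
  let ?L = "\<lambda>F::real\<Rightarrow>real. \<lambda>\<tau>. indicator {0<..<1} \<tau> * emeasure lborel {x. \<tau> < F x}"
  have meas: "?L F \<in> borel_measurable lborel" if [measurable]: "F \<in> borel_measurable borel" for F
    by measurable
  have "(\<integral>\<^sup>+x. f x \<partial>lborel) + (\<integral>\<^sup>+x. g x \<partial>lborel) = (\<integral>\<^sup>+x. min 1 (f x) \<partial>lborel) + (\<integral>\<^sup>+x. min 1 (g x) \<partial>lborel)"
    by (simp add: min_absorb2 le1)
  also have "\<dots> = (\<integral>\<^sup>+\<tau>. ?L f \<tau> \<partial>lborel) + (\<integral>\<^sup>+\<tau>. ?L g \<tau> \<partial>lborel)"
    by (simp add: nn_integral_superlevel_sets)
  also have "\<dots> = (\<integral>\<^sup>+\<tau>. ?L f \<tau> + ?L g \<tau> \<partial>lborel)"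
    by (rule nn_integral_add[symmetric]) measurable
  \<comment> \<open>Dilating \<open>h\<close> by 2 turns midpoints into sums; the factor 2 in the
    conclusion is the Jacobian of this dilation.\<close>
  also have "\<dots> \<le> (\<integral>\<^sup>+\<tau>. ?L (\<lambda>z. h (z / 2)) \<tau> \<partial>lborel)"
  proof (rule nn_integral_mono)
    fix \<tau> :: real
    have "emeasure lborel {x. \<tau> < f x} + emeasure lborel {x. \<tau> < g x} \<le> emeasure lborel {x. \<tau> < h (x / 2)}"
      if "\<tau> < 1"
    proof (rule brunn_minkowski_real)
      show "{x. \<tau> < f x} \<noteq> {}" "{x. \<tau> < g x} \<noteq> {}" using sup1 that by auto
      show "x + y \<in> {x. \<tau> < h (x / 2)}" if "x \<in> {x. \<tau> < f x}" "y \<in> {x. \<tau> < g x}" for x y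
        using that mid[of x y] by auto
    qed measurable
    then show "?L f \<tau> + ?L g \<tau> \<le> ?L (\<lambda>z. h (z / 2)) \<tau>"
      by (auto split: split_indicator)
  qed
  also have "\<dots> = (\<integral>\<^sup>+x. min 1 (h (x / 2)) \<partial>lborel)"
    by (rule nn_integral_superlevel_sets) measurable
  also have "\<dots> \<le> (\<integral>\<^sup>+x. h (x / 2) \<partial>lborel)"
    by (intro nn_integral_mono ennreal_leI) auto
  also have "\<dots> = 2 * (\<integral>\<^sup>+x. h x \<partial>lborel)"
    by (subst nn_integral_real_affine[of _ 2 0]) auto
  finally show ?thesis .
qed

text \<open>The arithmetic-geometric mean step that passes from the sum of two integrals to their
  product.\<close>

lemma ennreal_four_mult_le_square: "4 * (x * y) \<le> (x + y) * (x + y :: ennreal)"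
proof (cases "x = top \<or> y = top")
  case True
  then show ?thesis by (auto simp: ennreal_mult_top)
next
  case False
  then obtain a b where "x = ennreal a" "y = ennreal b" "0 \<le> a" "0 \<le> b"
    by (metis ennreal_cases)
  moreover have "4 * (a * b) \<le> (a + b) * (a + b)"
    using zero_le_power2[of "a - b"] by (simp add: power2_eq_square algebra_simps)
  moreover have "ennreal 4 * (ennreal a * ennreal b) = ennreal (4 * (a * b))"
    using \<open>0 \<le> a\<close> \<open>0 \<le> b\<close> by (simp only: ennreal_mult[symmetric] mult_nonneg_nonneg zero_le_numeral)
  ultimately show ?thesis
    by (simp add: ennreal_mult[symmetric] ennreal_plus[symmetric] ennreal_leI del: ennreal_plus)
qed

text \<open>Dividing \<open>f\<close> and \<open>g\<close> by their suprema \<open>a\<close> and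
  \<open>b\<close>, and \<open>h\<close> by \<open>sqrt (a * b)\<close>, preserves the hypothesis;
  the normalized case applies because a minimum is at most the geometric mean. The bound
  \<open>M\<close> makes the suprema finite.\<close>

lemma prekopa_leindler_bounded:
  fixes f g h :: "real \<Rightarrow> ennreal" and M :: real
  assumes [measurable]: "f \<in> borel_measurable borel" "g \<in> borel_measurable borel" "h \<in> borel_measurable borel"
    and bnd: "\<And>x. f x \<le> ennreal M" "\<And>x. g x \<le> ennreal M"
    and mid: "\<And>x y. f x * g y \<le> h ((x + y) / 2) * h ((x + y) / 2)"
  shows "(\<integral>\<^sup>+x. f x \<partial>lborel) * (\<integral>\<^sup>+x. g x \<partial>lborel) \<le> (\<integral>\<^sup>+x. h x \<partial>lborel) * (\<integral>\<^sup>+x. h x \<partial>lborel)"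
proof (cases "(SUP x. f x) = 0 \<or> (SUP x. g x) = 0")
  case True
  then have "(\<forall>x. f x = 0) \<or> (\<forall>x. g x = 0)"
    by (metis SUP_upper UNIV_I le_zero_eq)
  then show ?thesis by (auto simp: fun_eq_iff[symmetric])
next
  case False
  define a b where "a = enn2real (SUP x. f x)" and "b = enn2real (SUP x. g x)"
  have "(SUP x. f x) \<le> ennreal M" "(SUP x. g x) \<le> ennreal M"
    by (auto intro: SUP_least bnd)
  then have fin: "(SUP x. f x) < top" "(SUP x. g x) < top"
    by (auto intro: le_less_trans simp: ennreal_less_top)
  have ab: "ennreal a = (SUP x. f x)" "ennreal b = (SUP x. g x)"
    using fin by (simp_all add: a_def b_def)
  have pos: "a > 0" "b > 0"
    using False fin by (auto simp: a_def b_def enn2real_positive_iff less_top zero_less_iff_neq_zero)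
  \<comment> \<open>\<open>h\<close> may be infinite somewhere. Capping it at \<open>M\<close> keeps
    the hypothesis because \<open>f x * g y\<close> never exceeds \<open>M * M\<close>.\<close>
  define h0 where "h0 = (\<lambda>x. min (h x) (ennreal M))"
  define f' g' h' where "f' = (\<lambda>x. enn2real (f x) / a)" and "g' = (\<lambda>x. enn2real (g x) / b)"
    and "h' = (\<lambda>x. enn2real (h0 x) / sqrt (a * b))"
  have [measurable]: "f' \<in> borel_measurable borel" "g' \<in> borel_measurable borel" "h' \<in> borel_measurable borel"
    "h0 \<in> borel_measurable borel"
    unfolding f'_def g'_def h'_def h0_def by measurable
  have ftop: "f x < top" "g x < top" "h0 x < top" for x
    using bnd[of x] by (auto simp: h0_def min_less_iff_disj intro: le_less_trans)
  have feq: "f x = ennreal (a * f' x)" "g x = ennreal (b * g' x)" "h0 x = ennreal (sqrt (a * b) * h' x)" for x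
    using ftop[of x] pos by (simp_all add: f'_def g'_def h'_def)
  have nonneg: "f' x \<ge> 0" "g' x \<ge> 0" "h' x \<ge> 0" for x
    using pos by (auto simp: f'_def g'_def h'_def)
  have mid0: "f x * g y \<le> h0 ((x + y) / 2) * h0 ((x + y) / 2)" for x y
  proof -
    have "f x * g y \<le> ennreal M * ennreal M" by (intro mult_mono bnd) auto
    then show ?thesis using mid[of x y] by (auto simp: h0_def min_def)
  qed
  have "(\<integral>\<^sup>+x. f' x \<partial>lborel) + (\<integral>\<^sup>+x. g' x \<partial>lborel) \<le> 2 * (\<integral>\<^sup>+x. h' x \<partial>lborel)"
  proof (rule prekopa_leindler_normalized)
    have "enn2real (f x) \<le> a" for x
      unfolding a_def by (rule enn2real_mono) (auto intro: SUP_upper fin)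
    then show "f' x \<le> 1" for x using pos by (simp add: f'_def)
    have "enn2real (g x) \<le> b" for x
      unfolding b_def by (rule enn2real_mono) (auto intro: SUP_upper fin)
    then show "g' x \<le> 1" for x using pos by (simp add: g'_def)
    show "\<exists>x. \<tau> < f' x" if "\<tau> < 1" for \<tau>
    proof (rule ccontr)
      assume "\<nexists>x. \<tau> < f' x"
      then have "f x \<le> ennreal (a * \<tau>)" for x
        unfolding feq using pos by (intro ennreal_leI mult_left_mono) (auto simp: not_less)
      then have "ennreal a \<le> ennreal (a * \<tau>)" unfolding ab by (intro SUP_least) auto
      moreover have "\<tau> \<ge> 0" using nonneg(1)[of 0] \<open>\<nexists>x. \<tau> < f' x\<close> by (meson not_less order_trans)
      ultimately show False using pos that by simp
    qed
    show "\<exists>x. \<tau> < g' x" if "\<tau> < 1" for \<tau>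
    proof (rule ccontr)
      assume "\<nexists>x. \<tau> < g' x"
      then have "g x \<le> ennreal (b * \<tau>)" for x
        unfolding feq using pos by (intro ennreal_leI mult_left_mono) (auto simp: not_less)
      then have "ennreal b \<le> ennreal (b * \<tau>)" unfolding ab by (intro SUP_least) auto
      moreover have "\<tau> \<ge> 0" using nonneg(2)[of 0] \<open>\<nexists>x. \<tau> < g' x\<close> by (meson not_less order_trans)
      ultimately show False using pos that by simp
    qed
    show "min (f' x) (g' y) \<le> h' ((x + y) / 2)" for x y
    proof -
      have "ennreal ((a * f' x) * (b * g' y)) \<le> ennreal ((sqrt (a * b) * h' ((x + y) / 2)) * (sqrt (a * b) * h' ((x + y) / 2)))"
        using mid0[of x y] pos nonneg unfolding feq by (simp add: ennreal_mult[symmetric])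
      then have "(a * f' x) * (b * g' y) \<le> (sqrt (a * b) * h' ((x + y) / 2)) * (sqrt (a * b) * h' ((x + y) / 2))"
        by (subst (asm) ennreal_le_iff) (use pos nonneg in auto)
      also have "\<dots> = (sqrt (a * b) * sqrt (a * b)) * (h' ((x + y) / 2))\<^sup>2"
        by (simp add: power2_eq_square)
      also have "sqrt (a * b) * sqrt (a * b) = a * b" using pos by simp
      finally have "(a * b) * (f' x * g' y) \<le> (a * b) * (h' ((x + y) / 2))\<^sup>2" by (simp add: ac_simps)
      then have "f' x * g' y \<le> (h' ((x + y) / 2))\<^sup>2" using pos by simp
      moreover have "(min (f' x) (g' y))\<^sup>2 \<le> f' x * g' y"
        unfolding power2_eq_square by (intro mult_mono) (auto simp: nonneg)
      ultimately have "(min (f' x) (g' y))\<^sup>2 \<le> (h' ((x + y) / 2))\<^sup>2" by simp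
      then show ?thesis by (rule power2_le_imp_le) (rule nonneg)
    qed
  qed measurable
  then have "4 * ((\<integral>\<^sup>+x. f' x \<partial>lborel) * (\<integral>\<^sup>+x. g' x \<partial>lborel)) \<le> (2 * (\<integral>\<^sup>+x. h' x \<partial>lborel)) * (2 * (\<integral>\<^sup>+x. h' x \<partial>lborel))"
    by (intro order_trans[OF ennreal_four_mult_le_square] mult_mono) auto
  also have "\<dots> = (2 * 2) * ((\<integral>\<^sup>+x. h' x \<partial>lborel) * (\<integral>\<^sup>+x. h' x \<partial>lborel))"
    by (simp only: ac_simps)
  finally have key: "(\<integral>\<^sup>+x. f' x \<partial>lborel) * (\<integral>\<^sup>+x. g' x \<partial>lborel) \<le> (\<integral>\<^sup>+x. h' x \<partial>lborel) * (\<integral>\<^sup>+x. h' x \<partial>lborel)"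
    by (simp add: ennreal_mult_le_mult_iff)
  have sq: "ennreal a * ennreal b = ennreal (sqrt (a * b)) * ennreal (sqrt (a * b))"
    using pos by (simp add: ennreal_mult[symmetric])
  have "(\<integral>\<^sup>+x. f x \<partial>lborel) * (\<integral>\<^sup>+x. g x \<partial>lborel) =
      (ennreal a * ennreal b) * ((\<integral>\<^sup>+x. f' x \<partial>lborel) * (\<integral>\<^sup>+x. g' x \<partial>lborel))"
    using pos nonneg by (simp add: feq ennreal_mult nn_integral_cmult) (simp only: ac_simps)
  also have "\<dots> \<le> (ennreal a * ennreal b) * ((\<integral>\<^sup>+x. h' x \<partial>lborel) * (\<integral>\<^sup>+x. h' x \<partial>lborel))"
    by (intro mult_left_mono key) simp
  also have "\<dots> = (\<integral>\<^sup>+x. h0 x \<partial>lborel) * (\<integral>\<^sup>+x. h0 x \<partial>lborel)"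
    unfolding sq using pos nonneg by (simp add: feq ennreal_mult nn_integral_cmult) (simp only: ac_simps)
  also have "\<dots> \<le> (\<integral>\<^sup>+x. h x \<partial>lborel) * (\<integral>\<^sup>+x. h x \<partial>lborel)"
    by (intro mult_mono nn_integral_mono) (auto simp: h0_def)
  finally show ?thesis .
qed

lemma nn_integral_SUP_truncate:
  fixes f :: "'a \<Rightarrow> ennreal"
  assumes [measurable]: "f \<in> borel_measurable M"
  shows "(\<integral>\<^sup>+x. f x \<partial>M) = (SUP k. \<integral>\<^sup>+x. min (f x) (of_nat k) \<partial>M)"
proof -
  have "(SUP k. min y (of_nat k)) = y" for y :: ennreal
  proof (rule antisym)
    show "(SUP k. min y (of_nat k)) \<le> y" by (auto intro: SUP_least)
    show "y \<le> (SUP k. min y (of_nat k))"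
    proof (rule dense_le)
      fix z assume "z < y"
      then have "z < top" by (metis top_greatest order.strict_trans2)
      then obtain r where "z = ennreal r" by (cases z) auto
      moreover obtain k where "r \<le> real k" using real_arch_simple by blast
      ultimately have "z \<le> of_nat k" by (simp add: ennreal_leI ennreal_of_nat_eq_real_of_nat)
      then show "z \<le> (SUP k. min y (of_nat k))"
        using \<open>z < y\<close> by (intro SUP_upper2[of k]) auto
    qed
  qed
  then have "(\<integral>\<^sup>+x. f x \<partial>M) = (\<integral>\<^sup>+x. (SUP k. min (f x) (of_nat k)) \<partial>M)" by simp
  also have "\<dots> = (SUP k. \<integral>\<^sup>+x. min (f x) (of_nat k) \<partial>M)"
    by (rule nn_integral_monotone_convergence_SUP) (auto simp: incseq_def le_fun_def min.coboundedI2)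
  finally show ?thesis .
qed

text \<open>Lowering \<open>f\<close> and \<open>g\<close> keeps the hypothesis, so truncation and
  monotone convergence reduce this to the bounded case.\<close>

lemma prekopa_leindler_real:
  fixes f g h :: "real \<Rightarrow> ennreal"
  assumes [measurable]: "f \<in> borel_measurable borel" "g \<in> borel_measurable borel" "h \<in> borel_measurable borel"
    and mid: "\<And>x y. f x * g y \<le> h ((x + y) / 2) * h ((x + y) / 2)"
  shows "(\<integral>\<^sup>+x. f x \<partial>lborel) * (\<integral>\<^sup>+x. g x \<partial>lborel) \<le> (\<integral>\<^sup>+x. h x \<partial>lborel) * (\<integral>\<^sup>+x. h x \<partial>lborel)"
proof -
  have trunc: "(\<integral>\<^sup>+x. min (f x) (of_nat k) \<partial>lborel) * (\<integral>\<^sup>+x. min (g x) (of_nat l) \<partial>lborel)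
      \<le> (\<integral>\<^sup>+x. h x \<partial>lborel) * (\<integral>\<^sup>+x. h x \<partial>lborel)" for k l :: nat
  proof (rule prekopa_leindler_bounded)
    show "min (f x) (of_nat k) \<le> ennreal (real (max k l))" for x
      by (intro min.coboundedI2) (simp add: ennreal_of_nat_eq_real_of_nat)
    show "min (g x) (of_nat l) \<le> ennreal (real (max k l))" for x
      by (intro min.coboundedI2) (simp add: ennreal_of_nat_eq_real_of_nat)
    show "min (f x) (of_nat k) * min (g y) (of_nat l) \<le> h ((x + y) / 2) * h ((x + y) / 2)" for x y
      by (rule order_trans[OF _ mid]) (auto intro: mult_mono)
  qed measurable
  show ?thesis
    unfolding nn_integral_SUP_truncate[of f lborel, simplified] nn_integral_SUP_truncate[of g lborel, simplified]
    by (subst SUP_mult_right_ennreal, subst SUP_mult_left_ennreal) (auto intro!: SUP_least trunc)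
qed

text \<open>Tensorization: once a coordinate is sliced off, the inequality on the line says
  precisely that the partial integrals satisfy the same hypothesis in the remaining
  coordinates.\<close>

lemma prekopa_leindler_PiM:
  fixes f g h :: "('i \<Rightarrow> real) \<Rightarrow> ennreal"
  assumes "finite I"
    and "f \<in> borel_measurable (\<Pi>\<^sub>M i\<in>I. lborel)" "g \<in> borel_measurable (\<Pi>\<^sub>M i\<in>I. lborel)"
      "h \<in> borel_measurable (\<Pi>\<^sub>M i\<in>I. lborel)"
    and "\<And>x y. x \<in> extensional I \<Longrightarrow> y \<in> extensional I \<Longrightarrow>
      f x * g y \<le> h (\<lambda>i\<in>I. (x i + y i) / 2) * h (\<lambda>i\<in>I. (x i + y i) / 2)"
  shows "(\<integral>\<^sup>+x. f x \<partial>(\<Pi>\<^sub>M i\<in>I. lborel)) * (\<integral>\<^sup>+x. g x \<partial>(\<Pi>\<^sub>M i\<in>I. lborel))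
    \<le> (\<integral>\<^sup>+x. h x \<partial>(\<Pi>\<^sub>M i\<in>I. lborel)) * (\<integral>\<^sup>+x. h x \<partial>(\<Pi>\<^sub>M i\<in>I. lborel))"
  using assms
proof (induction I arbitrary: f g h)
  case empty
  have "f (\<lambda>_. undefined) * g (\<lambda>_. undefined) \<le> h (\<lambda>_. undefined) * h (\<lambda>_. undefined)"
    using empty.prems(4)[of "\<lambda>_. undefined" "\<lambda>_. undefined"] by simp
  then show ?case by (subst (1 2 3 4) lborel_prod.nn_integral_empty) auto
next
  case (insert j I)
  note [measurable] = insert.prems(1-3)
  let ?P = "\<lambda>I. \<Pi>\<^sub>M i\<in>I. (lborel :: real measure)"
  have ins: "(\<integral>\<^sup>+c. \<phi> c \<partial>?P (insert j I)) = (\<integral>\<^sup>+x. \<integral>\<^sup>+y. \<phi> (x(j := y)) \<partial>lborel \<partial>?P I)"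
    if "\<phi> \<in> borel_measurable (?P (insert j I))" for \<phi> :: "_ \<Rightarrow> ennreal"
    by (rule lborel_prod.product_nn_integral_insert[OF insert.hyps(1,2) that])
  have slice: "(\<lambda>y. \<phi> (x(j := y))) \<in> borel_measurable borel"
    if [measurable]: "\<phi> \<in> borel_measurable (?P (insert j I))" and "x \<in> extensional I" for \<phi> :: "_ \<Rightarrow> ennreal" and x
  proof -
    have "x \<in> space (?P I)" using that by (simp add: space_PiM PiE_UNIV_domain PiE_def)
    from measurable_component_update[OF this insert.hyps(2)]
    have "(\<lambda>y. x(j := y)) \<in> borel \<rightarrow>\<^sub>M ?P (insert j I)" by simp
    then show ?thesis by measurable
  qed
  show ?case
    unfolding insert.prems(1-3)[THEN ins]
  proof (rule insert.IH)
    fix x y :: "'i \<Rightarrow> real" assume xy: "x \<in> extensional I" "y \<in> extensional I"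
    let ?z = "\<lambda>i\<in>I. (x i + y i) / 2"
    show "(\<integral>\<^sup>+s. f (x(j := s)) \<partial>lborel) * (\<integral>\<^sup>+t. g (y(j := t)) \<partial>lborel)
      \<le> (\<integral>\<^sup>+t. h (?z(j := t)) \<partial>lborel) * (\<integral>\<^sup>+t. h (?z(j := t)) \<partial>lborel)"
    proof (rule prekopa_leindler_real)
      fix s t :: real
      have "(\<lambda>i\<in>insert j I. ((x(j := s)) i + (y(j := t)) i) / 2) = ?z(j := (s + t) / 2)"
        using insert.hyps by (auto simp: fun_eq_iff)
      moreover have "x(j := s) \<in> extensional (insert j I)" "y(j := t) \<in> extensional (insert j I)"
        using xy by (auto simp: extensional_def)
      ultimately show "f (x(j := s)) * g (y(j := t)) \<le> h (?z(j := (s + t) / 2)) * h (?z(j := (s + t) / 2))"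
        using insert.prems(4)[of "x(j := s)" "y(j := t)"] by metis
    qed (auto intro!: slice insert.prems xy)
  qed measurable
qed

section \<open>Lebesgue measure in orthonormal coordinates\<close>

definition orthonormal :: "'a::euclidean_space set \<Rightarrow> bool" where
  "orthonormal B \<longleftrightarrow> pairwise orthogonal B \<and> (\<forall>b\<in>B. norm b = 1)"

text \<open>The pushforward from \<open>flat_lebesgue\<close>, based at 0 and left uncompleted so
  that Tonelli and Borel substitutions apply. Base point and completion return in
  \<open>flat_lebesgue_hyperplane\<close>. For empty \<open>B\<close> it is the unit mass at
  0.\<close>

definition coord_measure :: "'a::euclidean_space set \<Rightarrow> 'a measure" where
  "coord_measure B = distr (\<Pi>\<^sub>M b\<in>B. lborel) borel (\<lambda>c. \<Sum>b\<in>B. c b *\<^sub>R b)"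

lemma sets_coord_measure [simp, measurable_cong]: "sets (coord_measure B) = sets borel"
  by (simp add: coord_measure_def)

lemma space_coord_measure [simp]: "space (coord_measure B) = UNIV"
  by (simp add: coord_measure_def)

lemma orthonormal_finite: "orthonormal B \<Longrightarrow> finite B"
  by (simp add: orthonormal_def pairwise_orthogonal_imp_finite)

lemma orthonormal_independent: "orthonormal B \<Longrightarrow> independent B"
  by (intro pairwise_orthogonal_independent) (auto simp: orthonormal_def)

lemma orthonormal_inner:
  "orthonormal B \<Longrightarrow> b \<in> B \<Longrightarrow> b' \<in> B \<Longrightarrow> b \<bullet> b' = (if b = b' then 1 else 0)"
  by (auto simp: orthonormal_def pairwise_def orthogonal_def norm_eq_1)

lemma inner_sum_orthonormal:
  assumes "orthonormal B" "b \<in> B"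
  shows "(\<Sum>b'\<in>B. c b' *\<^sub>R b') \<bullet> b = c b"
proof -
  have "(\<Sum>b'\<in>B. c b' *\<^sub>R b') \<bullet> b = (\<Sum>b'\<in>B. if b' = b then c b else 0)"
    unfolding inner_sum_left using assms by (intro sum.cong) (auto simp: orthonormal_inner)
  also have "\<dots> = c b" using assms(2) orthonormal_finite[OF assms(1)] by simp
  finally show ?thesis .
qed

lemma inner_self_sum_orthonormal:
  assumes "orthonormal B"
  shows "(\<Sum>b\<in>B. c b *\<^sub>R b) \<bullet> (\<Sum>b\<in>B. c b *\<^sub>R b) = (\<Sum>b\<in>B. (c b)\<^sup>2)"
  by (subst inner_sum_right) (use assms in \<open>simp add: inner_sum_orthonormal power2_eq_square\<close>)

lemma span_orthonormal_expansion:
  assumes "orthonormal B" "x \<in> span B"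
  shows "(\<Sum>b\<in>B. (x \<bullet> b) *\<^sub>R b) = x"
proof -
  obtain c where x: "x = (\<Sum>b\<in>B. c b *\<^sub>R b)"
    using assms(2) span_finite[OF orthonormal_finite[OF assms(1)]] by auto
  show ?thesis unfolding x using assms(1) by (simp add: inner_sum_orthonormal)
qed

lemma measurable_coord_sum [measurable]:
  fixes B :: "'a::euclidean_space set"
  shows
  "(\<lambda>c. \<Sum>b\<in>B. c b *\<^sub>R b) \<in> (\<Pi>\<^sub>M b\<in>B. lborel) \<rightarrow>\<^sub>M borel"
  by (intro borel_measurable_sum) measurable

lemma nn_integral_coord_measure:
  assumes "\<phi> \<in> borel_measurable borel"
  shows "(\<integral>\<^sup>+x. \<phi> x \<partial>coord_measure B) = (\<integral>\<^sup>+c. \<phi> (\<Sum>b\<in>B. c b *\<^sub>R b) \<partial>(\<Pi>\<^sub>M b\<in>B. lborel))"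
  unfolding coord_measure_def by (rule nn_integral_distr) (use assms in measurable)

lemma coord_measure_Basis: "coord_measure Basis = lborel"
  unfolding coord_measure_def by (rule lborel_eq[symmetric])

lemma nn_integral_coord_measure_affine:
  assumes B: "orthonormal B" and "a \<in> span B" "s \<noteq> 0"
    and [measurable]: "\<phi> \<in> borel_measurable borel"
  shows "(\<integral>\<^sup>+x. \<phi> x \<partial>coord_measure B) = ennreal (\<bar>s\<bar> ^ card B) * (\<integral>\<^sup>+x. \<phi> (a + s *\<^sub>R x) \<partial>coord_measure B)"
proof -
  have "(\<Sum>b\<in>B. (\<lambda>b\<in>B. a \<bullet> b + s * c b) b *\<^sub>R b) = a + s *\<^sub>R (\<Sum>b\<in>B. c b *\<^sub>R b)" for c
  proof -
    have "(\<Sum>b\<in>B. (\<lambda>b\<in>B. a \<bullet> b + s * c b) b *\<^sub>R b) = (\<Sum>b\<in>B. (a \<bullet> b) *\<^sub>R b) + (\<Sum>b\<in>B. s *\<^sub>R c b *\<^sub>R b)"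
      unfolding sum.distrib[symmetric] by (intro sum.cong) (auto simp: algebra_simps)
    then show ?thesis using assms by (simp add: span_orthonormal_expansion scaleR_sum_right)
  qed
  then show ?thesis
    by (subst (1 2) nn_integral_coord_measure; measurable?)
       (subst nn_integral_PiM_affine[OF orthonormal_finite[OF B] \<open>s \<noteq> 0\<close>, where a="\<lambda>b. a \<bullet> b"]; simp)
qed

lemma AE_coord_measure_span: "AE x in coord_measure B. x \<in> span B"
  unfolding coord_measure_def
  by (subst AE_distr_iff) (auto intro!: AE_I2 span_sum span_scale intro: span_base simp: borel_closed closed_subspace)

text \<open>Product functions supply all the test functions: boxes for sigma-finiteness and
  positivity, Gaussians for independence of the basis, exponentials for integrability.\<close>

lemma nn_integral_coord_measure_prod:
  fixes F :: "real \<Rightarrow> ennreal"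
  assumes B: "orthonormal B" and [measurable]: "F \<in> borel_measurable borel"
  shows "(\<integral>\<^sup>+x. (\<Prod>b\<in>B. F (x \<bullet> b)) \<partial>coord_measure B) = (\<integral>\<^sup>+t. F t \<partial>lborel) ^ card B"
proof -
  have "(\<integral>\<^sup>+x. (\<Prod>b\<in>B. F (x \<bullet> b)) \<partial>coord_measure B) = (\<integral>\<^sup>+c. (\<Prod>b\<in>B. F (c b)) \<partial>(\<Pi>\<^sub>M b\<in>B. lborel))"
    by (subst nn_integral_coord_measure) (auto simp: inner_sum_orthonormal B intro!: nn_integral_cong prod.cong)
  also have "\<dots> = (\<Prod>b\<in>B. \<integral>\<^sup>+t. F t \<partial>lborel)"
    by (rule lborel_prod.product_nn_integral_prod) (use orthonormal_finite[OF B] in auto)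
  finally show ?thesis by simp
qed

lemma nn_integral_exp_abs_finite:
  assumes "c > 0"
  shows "(\<integral>\<^sup>+t. ennreal (exp (- c * \<bar>t\<bar>)) \<partial>lborel) < \<infinity>"
proof -
  let ?f = "\<lambda>t::real. ennreal (exp (- c * t)) * indicator {0..} t"
  have lim: "((\<lambda>t. - (exp (- c * t) / c)) \<longlongrightarrow> 0) at_top"
  proof -
    have "filterlim (\<lambda>t. - c * t) at_bot at_top"
      using assms by (intro filterlim_tendsto_neg_mult_at_bot[OF tendsto_const] filterlim_ident) auto
    then have "((\<lambda>t. exp (- c * t)) \<longlongrightarrow> 0) at_top"
      by (rule filterlim_compose[OF exp_at_bot])
    from tendsto_minus[OF tendsto_divide[OF this tendsto_const, of c]] show ?thesis using assms by simp
  qed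
  have half: "(\<integral>\<^sup>+t. ?f t \<partial>lborel) = ennreal (1 / c)"
    by (subst nn_integral_FTC_atLeast[OF _ _ _ lim])
       (use assms in \<open>auto intro!: derivative_eq_intros\<close>)
  \<comment> \<open>The even integrand is folded onto the half line; the reflection is written
    \<open>0 + - 1 * t\<close> to match the affine substitution rule.\<close>
  have "(\<integral>\<^sup>+t. ennreal (exp (- c * \<bar>t\<bar>)) \<partial>lborel) \<le> (\<integral>\<^sup>+t. ?f t + ?f (0 + - 1 * t) \<partial>lborel)"
    by (intro nn_integral_mono) (auto split: split_indicator)
  also have "\<dots> = (\<integral>\<^sup>+t. ?f t \<partial>lborel) + (\<integral>\<^sup>+t. ?f (0 + - 1 * t) \<partial>lborel)"
    by (rule nn_integral_add) measurable
  also have "(\<integral>\<^sup>+t. ?f (0 + - 1 * t) \<partial>lborel) = (\<integral>\<^sup>+t. ?f t \<partial>lborel)"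
    by (subst nn_integral_real_affine[of ?f "- 1" 0]) auto
  finally show ?thesis unfolding half by (auto intro: le_less_trans)
qed

lemma nn_integral_exp_neg_square:
  "(\<integral>\<^sup>+t. ennreal (exp (- t\<^sup>2)) \<partial>lborel) \<noteq> 0" "(\<integral>\<^sup>+t. ennreal (exp (- t\<^sup>2)) \<partial>lborel) < \<infinity>"
proof -
  show "(\<integral>\<^sup>+t. ennreal (exp (- t\<^sup>2)) \<partial>lborel) \<noteq> 0"
    by (subst nn_integral_0_iff_AE) (auto simp: AE_iff_null null_sets_def)
  have "(\<integral>\<^sup>+t. ennreal (exp (- t\<^sup>2)) \<partial>lborel) \<le> (\<integral>\<^sup>+t. ennreal (exp 1) * ennreal (exp (- 1 * \<bar>t\<bar>)) \<partial>lborel)"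
  proof (rule nn_integral_mono)
    fix t :: real
    have "\<bar>t\<bar> \<le> 1 + t\<^sup>2"
      using zero_le_power2[of "\<bar>t\<bar> - 1"] zero_le_power2[of t] by (simp add: power2_eq_square algebra_simps)
    then have "exp (- t\<^sup>2) \<le> exp (1 + - 1 * \<bar>t\<bar>)" by simp
    then show "ennreal (exp (- t\<^sup>2)) \<le> ennreal (exp 1) * ennreal (exp (- 1 * \<bar>t\<bar>))"
      by (simp only: exp_add ennreal_mult'[symmetric] exp_ge_zero ennreal_leI)
  qed
  also have "\<dots> = ennreal (exp 1) * (\<integral>\<^sup>+t. ennreal (exp (- 1 * \<bar>t\<bar>)) \<partial>lborel)"
    by (rule nn_integral_cmult) measurable
  also have "\<dots> < \<infinity>"
    using nn_integral_exp_abs_finite[of 1] by (simp add: ennreal_mult_less_top)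
  finally show "(\<integral>\<^sup>+t. ennreal (exp (- t\<^sup>2)) \<partial>lborel) < \<infinity>" .
qed

lemma sigma_finite_coord_measure:
  assumes B: "orthonormal B"
  shows "sigma_finite_measure (coord_measure B)"
proof
  let ?A = "\<lambda>k::nat. {x. \<forall>b\<in>B. x \<bullet> b \<in> {- real k..real k}}"
  have sets: "?A k \<in> sets borel" for k
    using orthonormal_finite[OF B] by measurable
  have "emeasure (coord_measure B) (?A k) < \<infinity>" for k
  proof -
    have "emeasure (coord_measure B) (?A k) = (\<integral>\<^sup>+x. indicator (?A k) x \<partial>coord_measure B)"
      using sets by simp
    also have "\<dots> = (\<integral>\<^sup>+x. (\<Prod>b\<in>B. indicator {- real k..real k} (x \<bullet> b)) \<partial>coord_measure B)"
      using orthonormal_finite[OF B]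
      by (intro nn_integral_cong) (auto simp: indicator_def)
    also have "\<dots> = (ennreal (2 * real k)) ^ card B"
      by (subst nn_integral_coord_measure_prod[OF B]) auto
    finally show ?thesis by (simp add: power_less_top_ennreal)
  qed
  moreover have "(\<Union>k. ?A k) = UNIV"
  proof -
    have "\<exists>k. x \<in> ?A k" for x
    proof -
      obtain k where k: "norm x \<le> real k" using real_arch_simple by blast
      have "\<bar>x \<bullet> b\<bar> \<le> real k" if "b \<in> B" for b
        using Cauchy_Schwarz_ineq2[of x b] that B k by (auto simp: orthonormal_def)
      then show ?thesis by (intro exI[of _ k]) (auto simp: abs_le_iff minus_le_iff)
    qed
    then show ?thesis by auto
  qed
  ultimately show "\<exists>A. countable A \<and> A \<subseteq> sets (coord_measure B) \<and> \<Union> A = space (coord_measure B) \<and>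
      (\<forall>a\<in>A. emeasure (coord_measure B) a \<noteq> \<infinity>)"
    using sets by (intro exI[of _ "range ?A"]) (auto simp: less_top)
qed

text \<open>Uniqueness of Haar measure on \<^term>\<open>span B\<close>: by Tonelli and translation invariance
  \<open>\<integral>\<phi> d\<mu> \<cdot> \<integral>\<psi> d\<nu> = \<integral>\<phi> d\<nu> \<cdot> \<integral>\<psi> d\<mu>\<close>, and a rotation invariant \<open>\<psi>\<close>
  has the same integral for both bases.\<close>
lemma coord_measure_eq:
  fixes B C :: "'a::euclidean_space set"
  assumes B: "orthonormal B" and C: "orthonormal C" and span: "span B = span C"
  shows "coord_measure B = coord_measure C"
proof (rule measure_eqI)
  fix A assume "A \<in> sets (coord_measure B)"
  then have [measurable]: "A \<in> sets borel" by simp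
  interpret B: sigma_finite_measure "coord_measure B" by (rule sigma_finite_coord_measure[OF B])
  interpret C: sigma_finite_measure "coord_measure C" by (rule sigma_finite_coord_measure[OF C])
  interpret BC: pair_sigma_finite "coord_measure B" "coord_measure C" ..
  let ?\<mu> = "coord_measure B" and ?\<nu> = "coord_measure C"
  \<comment> \<open>The Gaussian depends only on the norm and yet factors in every orthonormal
    basis, so its integral is a function of the dimension alone.\<close>
  define \<psi> :: "'a \<Rightarrow> ennreal" where "\<psi> = (\<lambda>x. ennreal (exp (- (x \<bullet> x))))"
  have [measurable]: "\<psi> \<in> borel_measurable borel" unfolding \<psi>_def by measurable
  let ?G = "\<integral>\<^sup>+t. ennreal (exp (- t\<^sup>2)) \<partial>lborel"
  have gauss: "(\<integral>\<^sup>+x. \<psi> x \<partial>coord_measure D) = ?G ^ card D" if D: "orthonormal D" for D :: "'a set"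
  proof -
    have "(\<integral>\<^sup>+x. \<psi> x \<partial>coord_measure D) = (\<integral>\<^sup>+x. (\<Prod>b\<in>D. ennreal (exp (- (x \<bullet> b)\<^sup>2))) \<partial>coord_measure D)"
    proof (rule nn_integral_cong_AE, use AE_coord_measure_span[of D] in eventually_elim)
      case (elim x)
      have "x \<bullet> x = (\<Sum>b\<in>D. (x \<bullet> b)\<^sup>2)"
        using inner_self_sum_orthonormal[OF D, of "\<lambda>b. x \<bullet> b"] span_orthonormal_expansion[OF D elim] by simp
      then show ?case
        unfolding \<psi>_def using orthonormal_finite[OF D]
        by (simp add: sum_negf[symmetric] exp_sum prod_ennreal)
    qed
    also have "\<dots> = ?G ^ card D" by (rule nn_integral_coord_measure_prod[OF D]) measurable
    finally show ?thesis .
  qed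
  have card: "card B = card C"
    using span dim_span_eq_card_independent[OF orthonormal_independent[OF B]]
      dim_span_eq_card_independent[OF orthonormal_independent[OF C]] by simp
  have trB: "(\<integral>\<^sup>+x. \<phi> (a + x) \<partial>?\<mu>) = (\<integral>\<^sup>+x. \<phi> x \<partial>?\<mu>)" if "a \<in> span B" "\<phi> \<in> borel_measurable borel" for a and \<phi> :: "'a \<Rightarrow> ennreal"
    using nn_integral_coord_measure_affine[OF B that(1) _ that(2), of 1] by simp
  have trC: "(\<integral>\<^sup>+x. \<phi> (a + x) \<partial>?\<nu>) = (\<integral>\<^sup>+x. \<phi> x \<partial>?\<nu>)" if "a \<in> span B" "\<phi> \<in> borel_measurable borel" for a and \<phi> :: "'a \<Rightarrow> ennreal"
    using nn_integral_coord_measure_affine[OF C _ _ that(2), of a 1] that(1) span by simp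
  have reflB: "(\<integral>\<^sup>+x. \<phi> (a - x) \<partial>?\<mu>) = (\<integral>\<^sup>+x. \<phi> x \<partial>?\<mu>)" if "a \<in> span B" "\<phi> \<in> borel_measurable borel" for a and \<phi> :: "'a \<Rightarrow> ennreal"
    using nn_integral_coord_measure_affine[OF B that(1) _ that(2), of "- 1"] by simp
  define \<phi> :: "'a \<Rightarrow> ennreal" where "\<phi> = indicator A"
  have [measurable]: "\<phi> \<in> borel_measurable borel" unfolding \<phi>_def by measurable
  have "(\<integral>\<^sup>+x. \<phi> x \<partial>?\<mu>) * (\<integral>\<^sup>+y. \<psi> y \<partial>?\<nu>) = (\<integral>\<^sup>+y. \<psi> y * (\<integral>\<^sup>+x. \<phi> x \<partial>?\<mu>) \<partial>?\<nu>)"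
    by (subst nn_integral_multc) (auto simp: mult.commute)
  also have "\<dots> = (\<integral>\<^sup>+y. \<psi> y * (\<integral>\<^sup>+x. \<phi> (y + x) \<partial>?\<mu>) \<partial>?\<nu>)"
    by (rule nn_integral_cong_AE, use AE_coord_measure_span[of C] in eventually_elim) (simp add: trB span)
  also have "\<dots> = (\<integral>\<^sup>+y. \<integral>\<^sup>+x. \<psi> y * \<phi> (y + x) \<partial>?\<mu> \<partial>?\<nu>)"
    by (intro nn_integral_cong nn_integral_cmult[symmetric]) measurable
  also have "\<dots> = (\<integral>\<^sup>+x. \<integral>\<^sup>+y. \<psi> y * \<phi> (y + x) \<partial>?\<nu> \<partial>?\<mu>)"
    by (rule BC.Fubini') measurable
  also have "\<dots> = (\<integral>\<^sup>+x. \<integral>\<^sup>+y. \<psi> (y - x) * \<phi> y \<partial>?\<nu> \<partial>?\<mu>)"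
  proof (rule nn_integral_cong_AE, use AE_coord_measure_span[of B] in eventually_elim)
    case (elim x)
    show ?case using trC[of "- x" "\<lambda>y. \<psi> y * \<phi> (y + x)"] elim by (simp add: span_neg)
  qed
  also have "\<dots> = (\<integral>\<^sup>+y. \<integral>\<^sup>+x. \<psi> (y - x) * \<phi> y \<partial>?\<mu> \<partial>?\<nu>)"
    by (rule BC.Fubini'[symmetric]) measurable
  also have "\<dots> = (\<integral>\<^sup>+y. (\<integral>\<^sup>+x. \<psi> (y - x) \<partial>?\<mu>) * \<phi> y \<partial>?\<nu>)"
    by (intro nn_integral_cong nn_integral_multc) measurable
  also have "\<dots> = (\<integral>\<^sup>+y. (\<integral>\<^sup>+x. \<psi> x \<partial>?\<mu>) * \<phi> y \<partial>?\<nu>)"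
    by (rule nn_integral_cong_AE, use AE_coord_measure_span[of C] in eventually_elim) (simp add: reflB span)
  also have "\<dots> = (\<integral>\<^sup>+x. \<psi> x \<partial>?\<mu>) * (\<integral>\<^sup>+y. \<phi> y \<partial>?\<nu>)"
    by (rule nn_integral_cmult) measurable
  finally have "?G ^ card C * (\<integral>\<^sup>+x. \<phi> x \<partial>?\<mu>) = ?G ^ card C * (\<integral>\<^sup>+y. \<phi> y \<partial>?\<nu>)"
    by (simp add: gauss B C card mult.commute)
  moreover have "?G ^ card C \<noteq> 0" using nn_integral_exp_neg_square(1) by simp
  moreover have "?G ^ card C < top" using nn_integral_exp_neg_square(2) by (simp add: power_less_top_ennreal)
  ultimately have "(\<integral>\<^sup>+x. \<phi> x \<partial>?\<mu>) = (\<integral>\<^sup>+y. \<phi> y \<partial>?\<nu>)"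
    by (auto simp: ennreal_mult_cancel_left)
  then show "emeasure ?\<mu> A = emeasure ?\<nu> A" by (simp add: \<phi>_def)
qed simp

text \<open>Tonelli with one direction singled out; this later slices a hyperplane into translates
  of the orthogonal complement of a plane.\<close>

lemma nn_integral_coord_measure_insert:
  assumes B: "orthonormal (insert u B)" "u \<notin> B" and [measurable]: "\<phi> \<in> borel_measurable borel"
  shows "(\<integral>\<^sup>+x. \<phi> x \<partial>coord_measure (insert u B)) = (\<integral>\<^sup>+t. \<integral>\<^sup>+x. \<phi> (t *\<^sub>R u + x) \<partial>coord_measure B \<partial>lborel)"
proof -
  have fin: "finite B" using orthonormal_finite[OF B(1)] by simp
  have sum: "(\<Sum>b\<in>insert u B. (x(u := y)) b *\<^sub>R b) = y *\<^sub>R u + (\<Sum>b\<in>B. x b *\<^sub>R b)" for x y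
    using fin B(2) by (simp add: sum.insert) (intro sum.cong, auto)
  have "(\<integral>\<^sup>+x. \<phi> x \<partial>coord_measure (insert u B)) = (\<integral>\<^sup>+c. \<phi> (\<Sum>b\<in>insert u B. c b *\<^sub>R b) \<partial>(\<Pi>\<^sub>M b\<in>insert u B. lborel))"
    by (rule nn_integral_coord_measure) measurable
  also have "\<dots> = (\<integral>\<^sup>+y. \<integral>\<^sup>+x. \<phi> (\<Sum>b\<in>insert u B. (x(u := y)) b *\<^sub>R b) \<partial>(\<Pi>\<^sub>M b\<in>B. lborel) \<partial>lborel)"
    by (rule lborel_prod.product_nn_integral_insert_rev[OF fin B(2)]) measurable
  also have "\<dots> = (\<integral>\<^sup>+t. \<integral>\<^sup>+x. \<phi> (t *\<^sub>R u + x) \<partial>coord_measure B \<partial>lborel)"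
    unfolding sum by (intro nn_integral_cong nn_integral_coord_measure[symmetric]) measurable
  finally show ?thesis .
qed

lemma prekopa_leindler_coord_measure:
  fixes f g h :: "'a::euclidean_space \<Rightarrow> ennreal"
  assumes B: "orthonormal B"
    and [measurable]: "f \<in> borel_measurable borel" "g \<in> borel_measurable borel" "h \<in> borel_measurable borel"
    and mid: "\<And>x y. f x * g y \<le> h ((1/2) *\<^sub>R (x + y)) * h ((1/2) *\<^sub>R (x + y))"
  shows "(\<integral>\<^sup>+x. f x \<partial>coord_measure B) * (\<integral>\<^sup>+x. g x \<partial>coord_measure B)
     \<le> (\<integral>\<^sup>+x. h x \<partial>coord_measure B) * (\<integral>\<^sup>+x. h x \<partial>coord_measure B)"
proof (subst (1 2 3 4) nn_integral_coord_measure; measurable?)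
  show "(\<integral>\<^sup>+c. f (\<Sum>b\<in>B. c b *\<^sub>R b) \<partial>(\<Pi>\<^sub>M b\<in>B. lborel)) * (\<integral>\<^sup>+c. g (\<Sum>b\<in>B. c b *\<^sub>R b) \<partial>(\<Pi>\<^sub>M b\<in>B. lborel))
     \<le> (\<integral>\<^sup>+c. h (\<Sum>b\<in>B. c b *\<^sub>R b) \<partial>(\<Pi>\<^sub>M b\<in>B. lborel)) * (\<integral>\<^sup>+c. h (\<Sum>b\<in>B. c b *\<^sub>R b) \<partial>(\<Pi>\<^sub>M b\<in>B. lborel))"
  proof (rule prekopa_leindler_PiM[OF orthonormal_finite[OF B]])
    fix x y :: "'a \<Rightarrow> real"
    have "(\<Sum>b\<in>B. (\<lambda>i\<in>B. (x i + y i) / 2) b *\<^sub>R b) = (1/2) *\<^sub>R ((\<Sum>b\<in>B. x b *\<^sub>R b) + (\<Sum>b\<in>B. y b *\<^sub>R b))"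
      unfolding sum.distrib[symmetric] scaleR_sum_right by (intro sum.cong) (auto simp: algebra_simps add_divide_distrib)
    then show "f (\<Sum>b\<in>B. x b *\<^sub>R b) * g (\<Sum>b\<in>B. y b *\<^sub>R b) \<le> h (\<Sum>b\<in>B. (\<lambda>i\<in>B. (x i + y i) / 2) b *\<^sub>R b) * h (\<Sum>b\<in>B. (\<lambda>i\<in>B. (x i + y i) / 2) b *\<^sub>R b)"
      using mid by simp
  qed measurable
qed

section \<open>Autocorrelations of log-concave densities\<close>

text \<open>Closedness provides, on the line through the two points, the nearest parameters of
  \<open>S\<close> below and above \<open>u\<close>. Their midpoint also belongs and lies on one
  side of \<open>u\<close>, yet it cannot be nearer than both; hence the two parameters coincide
  with \<open>u\<close>.\<close>

lemma closed_midpoint_convex: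
  fixes S :: "'a::real_normed_vector set"
  assumes "closed S" and mid: "\<And>x y. x \<in> S \<Longrightarrow> y \<in> S \<Longrightarrow> (1/2) *\<^sub>R (x + y) \<in> S"
  shows "convex S"
  unfolding convex_alt
proof (intro ballI allI impI)
  fix x y and u :: real assume xy: "x \<in> S" "y \<in> S" and u: "0 \<le> u \<and> u \<le> 1"
  define A where "A = {t. (1 - t) *\<^sub>R x + t *\<^sub>R y \<in> S}"
  have "A = (\<lambda>t. (1 - t) *\<^sub>R x + t *\<^sub>R y) -` S" by (auto simp: A_def)
  then have cl: "closed A"
    by (auto intro!: closed_vimage assms continuous_intros)
  have midA: "(s + t) / 2 \<in> A" if "s \<in> A" "t \<in> A" for s t
  proof -
    have "(1/2) *\<^sub>R (((1 - s) *\<^sub>R x + s *\<^sub>R y) + ((1 - t) *\<^sub>R x + t *\<^sub>R y)) \<in> S"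
      using that mid by (auto simp: A_def)
    moreover have "(1/2) *\<^sub>R (((1 - s) *\<^sub>R x + s *\<^sub>R y) + ((1 - t) *\<^sub>R x + t *\<^sub>R y)) =
        (1 - (s + t) / 2) *\<^sub>R x + ((s + t) / 2) *\<^sub>R y"
      by (simp add: algebra_simps add_divide_distrib) (simp flip: scaleR_add_left)
    ultimately show ?thesis by (simp add: A_def)
  qed
  let ?L = "A \<inter> {..u}" and ?R = "A \<inter> {u..}"
  have "0 \<in> ?L" "1 \<in> ?R" using xy u by (auto simp: A_def)
  then have ne: "?L \<noteq> {}" "?R \<noteq> {}" by blast+
  have bdd: "bdd_above ?L" "bdd_below ?R" by auto
  have a: "Sup ?L \<in> ?L" by (rule closed_contains_Sup[OF ne(1) bdd(1)]) (intro closed_Int cl closed_atMost)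
  have b: "Inf ?R \<in> ?R" by (rule closed_contains_Inf[OF ne(2) bdd(2)]) (intro closed_Int cl closed_atLeast)
  let ?m = "(Sup ?L + Inf ?R) / 2"
  have m: "?m \<in> A" using a b midA by auto
  have "u \<in> A"
  proof (cases "?m \<le> u")
    case True
    then have "?m \<le> Sup ?L" using m by (intro cSup_upper bdd) auto
    then have "Sup ?L = Inf ?R" using a b by auto
    moreover have "Sup ?L \<le> u" "u \<le> Inf ?R" using a b by auto
    ultimately show ?thesis using a by (metis Int_iff antisym)
  next
    case False
    then have "Inf ?R \<le> ?m" using m by (intro cInf_lower bdd) auto
    then have "Sup ?L = Inf ?R" using a b by auto
    moreover have "Sup ?L \<le> u" "u \<le> Inf ?R" using a b by auto
    ultimately show ?thesis using a by (metis Int_iff antisym)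
  qed
  then show "(1 - u) *\<^sub>R x + u *\<^sub>R y \<in> S" by (simp add: A_def)
qed

text \<open>The region under \<open>ln g\<close>, written with \<open>exp\<close> so that zeros of
  \<open>g\<close> need no convention, is closed by continuity and midpoint convex by hypothesis,
  hence convex.\<close>

lemma continuous_midpoint_log_concave:
  fixes g :: "'a::real_normed_vector \<Rightarrow> real"
  assumes cont: "continuous_on UNIV g" and nonneg: "\<And>x. 0 \<le> g x"
    and mid: "\<And>x y. g x * g y \<le> (g ((1/2) *\<^sub>R (x + y)))\<^sup>2"
  shows "log_concave g"
proof -
  let ?S = "{z :: 'a \<times> real. exp (snd z) \<le> g (fst z)}"
  have "convex ?S"
  proof (rule closed_midpoint_convex)
    show "closed ?S"
      by (intro closed_Collect_le continuous_intros continuous_on_compose2[OF cont]) auto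
    fix z w :: "'a \<times> real" assume zw: "z \<in> ?S" "w \<in> ?S"
    have "(exp ((snd z + snd w) / 2))\<^sup>2 = exp (snd z) * exp (snd w)"
      by (simp add: exp_add[symmetric] power2_eq_square)
    also have "\<dots> \<le> g (fst z) * g (fst w)" using zw nonneg by (intro mult_mono) auto
    also have "\<dots> \<le> (g ((1/2) *\<^sub>R (fst z + fst w)))\<^sup>2" by (rule mid)
    finally have "exp ((snd z + snd w) / 2) \<le> g ((1/2) *\<^sub>R (fst z + fst w))"
      by (rule power2_le_imp_le) (rule nonneg)
    then show "(1/2) *\<^sub>R (z + w) \<in> ?S" by simp
  qed
  show ?thesis
    unfolding log_concave_def
  proof (intro allI ballI)
    fix x y and l :: real assume l: "l \<in> {0..1}"
    show "g x powr l * g y powr (1 - l) \<le> g (l *\<^sub>R x + (1 - l) *\<^sub>R y)"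
    proof (cases "g x = 0 \<or> g y = 0")
      case True
      then show ?thesis using nonneg by auto
    next
      case False
      then have pos: "g x > 0" "g y > 0" using nonneg by (auto simp: less_le)
      then have "(x, ln (g x)) \<in> ?S" "(y, ln (g y)) \<in> ?S" by auto
      then have "l *\<^sub>R (x, ln (g x)) + (1 - l) *\<^sub>R (y, ln (g y)) \<in> ?S"
        using l by (intro convexD[OF \<open>convex ?S\<close>]) auto
      then have "exp (l * ln (g x) + (1 - l) * ln (g y)) \<le> g (l *\<^sub>R x + (1 - l) *\<^sub>R y)" by simp
      then show ?thesis using pos by (simp add: powr_def exp_add)
    qed
  qed
qed

lemma log_concave_midpoint:
  assumes "log_concave f" "\<And>x. 0 \<le> f x"
  shows "f x * f y \<le> (f ((1/2) *\<^sub>R (x + y)))\<^sup>2"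
proof -
  have "f x powr (1/2) * f y powr (1/2) \<le> f ((1/2) *\<^sub>R (x + y))"
    using assms(1)[unfolded log_concave_def, rule_format, of "1/2" x y] by (simp add: scaleR_add_right)
  then have "(sqrt (f x) * sqrt (f y))\<^sup>2 \<le> (f ((1/2) *\<^sub>R (x + y)))\<^sup>2"
    using assms(2) by (intro power_mono) (auto simp: powr_half_sqrt)
  then show ?thesis using assms(2) by (simp add: power_mult_distrib)
qed

lemma convex_log_concave_support:
  assumes "log_concave f" "\<And>x. 0 \<le> f x"
  shows "convex {x. 0 < f x}"
  unfolding convex_alt
proof (intro ballI allI impI, unfold mem_Collect_eq)
  fix x y and u :: real assume "0 < f x" "0 < f y" "0 \<le> u \<and> u \<le> 1"
  then have "0 < f y powr u * f x powr (1 - u)" by simp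
  also have "\<dots> \<le> f (u *\<^sub>R y + (1 - u) *\<^sub>R x)"
    using assms(1)[unfolded log_concave_def, rule_format, of u y x] \<open>0 \<le> u \<and> u \<le> 1\<close> by simp
  finally show "0 < f ((1 - u) *\<^sub>R x + u *\<^sub>R y)" by (simp add: add.commute)
qed

text \<open>On \<open>U\<close> the function \<open>- ln f\<close> is finite and convex, and a
  convex function on an open set is continuous.\<close>

lemma continuous_on_log_concave:
  fixes f :: "'a::euclidean_space \<Rightarrow> real"
  assumes f: "log_concave f" and U: "open U" "convex U" "\<And>x. x \<in> U \<Longrightarrow> 0 < f x"
  shows "continuous_on U f"
proof -
  have "convex_on U (\<lambda>x. - ln (f x))"
  proof (rule convex_onI)
    fix t :: real and x y assume t: "0 < t" "t < 1" and xy: "x \<in> U" "y \<in> U"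
    have "f y powr t * f x powr (1 - t) \<le> f (t *\<^sub>R y + (1 - t) *\<^sub>R x)"
      using f[unfolded log_concave_def, rule_format, of t y x] t by simp
    then have "ln (f y powr t * f x powr (1 - t)) \<le> ln (f (t *\<^sub>R y + (1 - t) *\<^sub>R x))"
      using U(3) xy by (subst ln_le_cancel_iff) (auto intro: order.strict_trans2[rotated] simp: less_imp_neq[symmetric])
    then show "- ln (f ((1 - t) *\<^sub>R x + t *\<^sub>R y)) \<le> (1 - t) * (- ln (f x)) + t * (- ln (f y))"
      using U(3)[OF xy(1)] U(3)[OF xy(2)] by (simp add: ln_mult ln_powr add.commute)
  qed (use U in simp)
  then have "continuous_on U (\<lambda>x. - ln (f x))" by (rule convex_on_continuous[OF U(1)])
  from continuous_on_exp[OF continuous_on_minus[OF this]] have "continuous_on U (\<lambda>x. exp (ln (f x)))" by simp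
  then show ?thesis by (rule continuous_on_eq) (use U(3) in auto)
qed

section \<open>A Borel representative of the density\<close>

text \<open>Normal form of the density. Of log-concavity only the midpoint inequality is recorded,
  which is what Prekopa-Leindler consumes. Continuity on an open convex support makes
  \<open>f0\<close> Borel and confines its discontinuities to a null frontier.\<close>

locale log_concave_density =
  fixes f0 :: "'a::euclidean_space \<Rightarrow> real" and U :: "'a set"
  assumes U: "open U" "convex U" and pos: "\<And>x. x \<in> U \<Longrightarrow> 0 < f0 x" and zero: "\<And>x. x \<notin> U \<Longrightarrow> f0 x = 0"
    and cont: "continuous_on U f0" and mid: "\<And>x y. f0 x * f0 y \<le> (f0 ((1/2) *\<^sub>R (x + y)))\<^sup>2"
    and mass: "(\<integral>\<^sup>+x. f0 x \<partial>lborel) = 1"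

lemma null_sets_frontier_convex:
  fixes S :: "'a::euclidean_space set"
  assumes "convex S"
  shows "frontier S \<in> null_sets lborel"
  using negligible_convex_frontier[OF assms]
  by (simp add: negligible_iff_null_sets null_sets_completion_iff)

text \<open>Off the frontier of the support a point is either interior or a zero of
  \<open>f\<close>. The support is convex, so its frontier is null and setting \<open>f\<close> to 0
  there does not change its mass.\<close>

lemma log_concave_density_representative:
  fixes f :: "'a::euclidean_space \<Rightarrow> real"
  assumes "probability_density f" "log_concave f"
  obtains f0 U N where "log_concave_density f0 U" "N \<in> null_sets lborel" "\<And>x. x \<notin> N \<Longrightarrow> f x = f0 x"
proof
  let ?S = "{x. 0 < f x}"
  let ?U = "interior ?S"
  define f0 where "f0 = (\<lambda>x. if x \<in> ?U then f x else 0)"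
  have nonneg: "0 \<le> f x" for x using assms by (auto simp: probability_density_def)
  have S: "convex ?S" by (rule convex_log_concave_support[OF assms(2) nonneg])
  have U: "open ?U" "convex ?U" "\<And>x. x \<in> ?U \<Longrightarrow> 0 < f x"
    using S interior_subset by auto
  show N: "frontier ?S \<in> null_sets lborel" by (rule null_sets_frontier_convex[OF S])
  show eq: "f x = f0 x" if "x \<notin> frontier ?S" for x
    using that nonneg[of x] closure_subset[of ?S] by (auto simp: f0_def frontier_def less_le)
  have cont: "continuous_on ?U f0"
    by (rule continuous_on_eq[OF continuous_on_log_concave[OF assms(2) U]]) (auto simp: f0_def)
  have f0: "f0 \<in> borel_measurable borel"
    unfolding f0_def using continuous_on_log_concave[OF assms(2) U]
    by (intro borel_measurable_continuous_on_if continuous_on_const) auto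
  have f0_nonneg: "0 \<le> f0 x" for x by (simp add: f0_def nonneg)
  show "log_concave_density f0 ?U"
  proof
    show "f0 x * f0 y \<le> (f0 ((1/2) *\<^sub>R (x + y)))\<^sup>2" for x y
    proof (cases "x \<in> ?U \<and> y \<in> ?U")
      case True
      then have "(1/2) *\<^sub>R x + (1/2) *\<^sub>R y \<in> ?U" by (intro convexD[OF U(2)]) auto
      then show ?thesis
        using True log_concave_midpoint[OF assms(2) nonneg, of x y] by (simp add: f0_def scaleR_add_right)
    qed (auto simp: f0_def)
    have "(\<integral>\<^sup>+x. f0 x \<partial>lborel) = (\<integral>\<^sup>+x. f x \<partial>lborel)"
      by (rule nn_integral_cong_AE, use AE_not_in[OF N] in eventually_elim) (simp add: eq)
    also have "\<dots> = (\<integral>\<^sup>+x. f x \<partial>lebesgue)" by (rule nn_integral_completion[symmetric])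
    also have "\<dots> = 1"
      using assms(1) by (subst nn_integral_eq_integral) (auto simp: probability_density_def has_bochner_integral_iff)
    finally show "(\<integral>\<^sup>+x. f0 x \<partial>lborel) = 1" .
  qed (use U cont in \<open>auto simp: f0_def\<close>)
qed

lemma measurable_completion_AE_eq:
  fixes f f0 :: "'a \<Rightarrow> real"
  assumes [measurable]: "f0 \<in> borel_measurable M" and ae: "AE x in M. f x = f0 x"
  shows "f \<in> borel_measurable (completion M)"
proof (rule measurableI)
  interpret completion: complete_measure "completion M" ..
  fix A :: "real set" assume [measurable]: "A \<in> sets borel"
  show "f -` A \<inter> space (completion M) \<in> sets (completion M)"
  proof (rule completion.in_sets_AE)
    show "AE x in completion M. x \<in> f0 -` A \<inter> space M \<longleftrightarrow> x \<in> f -` A \<inter> space (completion M)"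
      by (rule AE_completion, use ae in eventually_elim) auto
    show "f0 -` A \<inter> space M \<in> sets (completion M)" by (rule sets_completionI_sets) measurable
  qed simp
qed simp

text \<open>\<open>f\<close> itself may fail to be Borel, but the completion measures it as soon as
  it agrees almost everywhere with a Borel function. This moves the integrals of the statement to
  uncompleted measures, where Tonelli is available.\<close>

lemma integral_completion_AE_eq:
  fixes f f0 :: "'a \<Rightarrow> real"
  assumes [measurable]: "f0 \<in> borel_measurable M" and ae: "AE x in M. f x = f0 x"
  shows "integral\<^sup>L (completion M) f = integral\<^sup>L M f0"
proof -
  have "integral\<^sup>L (completion M) f = integral\<^sup>L (completion M) f0"
    by (intro integral_cong_AE measurable_completion_AE_eq[OF assms] measurable_completion assms AE_completion)
  then show ?thesis by (simp add: integral_completion)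
qed

lemma orthonormal_Basis: "orthonormal Basis"
  by (auto simp: orthonormal_def pairwise_def orthogonal_def inner_Basis)

lemma nn_integral_lborel_shift:
  fixes \<phi> :: "'a::euclidean_space \<Rightarrow> ennreal"
  assumes "\<phi> \<in> borel_measurable borel"
  shows "(\<integral>\<^sup>+x. \<phi> (a + x) \<partial>lborel) = (\<integral>\<^sup>+x. \<phi> x \<partial>lborel)"
  using nn_integral_coord_measure_affine[OF orthonormal_Basis, of a 1 \<phi>] assms
  by (simp add: coord_measure_Basis)

lemma AE_lborel_shift_not_in_null_set:
  fixes a :: "'a::euclidean_space"
  assumes "N \<in> null_sets lborel"
  shows "AE y in lborel. a + y \<notin> N"
proof -
  have [measurable]: "N \<in> sets borel" using assms by auto
  have "(\<integral>\<^sup>+y. indicator N (a + y) \<partial>lborel) = (\<integral>\<^sup>+y. indicator N y \<partial>lborel)"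
    by (rule nn_integral_lborel_shift) measurable
  also have "\<dots> = 0" using assms by (simp add: null_sets_def)
  finally have "AE y in lborel. indicator N (a + y) = (0::ennreal)"
    by (subst (asm) nn_integral_0_iff_AE) auto
  then show ?thesis by eventually_elim (auto simp: indicator_def split: if_splits)
qed

text \<open>Every fixed translate of \<open>N\<close> is null, so the double integral vanishes and
  Tonelli exchanges the order. A particular hyperplane or line may lie inside \<open>N\<close>;
  hence only almost every base point \<open>x\<close> is controlled.\<close>

lemma AE_AE_shift_not_in_null_set:
  fixes T :: "'b \<Rightarrow> 'a::euclidean_space"
  assumes N: "N \<in> null_sets lborel" and "sigma_finite_measure M" and [measurable]: "T \<in> M \<rightarrow>\<^sub>M borel"
  shows "AE x in lborel. AE w in M. x + T w \<notin> N"
proof -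
  interpret M: sigma_finite_measure M by fact
  interpret P: pair_sigma_finite lborel M ..
  have [measurable]: "N \<in> sets borel" using N by auto
  have "(\<integral>\<^sup>+x. \<integral>\<^sup>+w. indicator N (x + T w) \<partial>M \<partial>lborel) = (\<integral>\<^sup>+w. \<integral>\<^sup>+x. indicator N (x + T w) \<partial>lborel \<partial>M)"
    by (rule P.Fubini'[symmetric]) measurable
  also have "\<dots> = (\<integral>\<^sup>+w. \<integral>\<^sup>+x. indicator N x \<partial>lborel \<partial>M)"
    using nn_integral_lborel_shift[of "indicator N"] by (simp only: add.commute[of _ "T _"]) simp
  also have "\<dots> = 0" using N by (simp add: null_sets_def)
  finally have "AE x in lborel. (\<integral>\<^sup>+w. indicator N (x + T w) \<partial>M) = 0"
    by (subst (asm) nn_integral_0_iff_AE) auto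
  then show ?thesis
  proof eventually_elim
    case (elim x)
    then have "AE w in M. indicator N (x + T w) = (0::ennreal)"
      by (subst (asm) nn_integral_0_iff_AE) auto
    then show ?case by eventually_elim (auto simp: indicator_def split: if_splits)
  qed
qed

section \<open>The autocorrelation of the representative\<close>

context log_concave_density
begin

lemma nonneg: "0 \<le> f0 x"
  using pos zero by (cases "x \<in> U") (auto intro: less_imp_le)

lemma borel [measurable]: "f0 \<in> borel_measurable borel"
proof -
  have "(\<lambda>x. indicator U x *\<^sub>R f0 x) = f0" using zero by (auto simp: fun_eq_iff indicator_def)
  then show ?thesis
    using borel_measurable_continuous_on_indicator[OF _ cont] U by auto
qed

lemma isCont_f0:
  assumes "x \<notin> frontier U"
  shows "isCont f0 x"
proof (cases "x \<in> U")
  case True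
  then show ?thesis using cont U by (auto simp: continuous_on_eq_continuous_at)
next
  case False
  then have "x \<in> - closure U" using assms U by (auto simp: frontier_def interior_open)
  then have "eventually (\<lambda>y. y \<in> - closure U) (nhds x)"
    by (intro eventually_nhds_in_open) auto
  then have "eventually (\<lambda>y. f0 y = 0) (nhds x)"
    by eventually_elim (use closure_subset[of U] zero in auto)
  then show ?thesis using isCont_cong[of f0 "\<lambda>_. 0" x] by simp
qed

text \<open>A large value at \<open>z\<close>, combined with the lower bound \<open>t\<close> near a
  point \<open>a\<close> of \<open>U\<close>, forces \<open>f0\<close> to be at least
  \<open>sqrt (t * f0 z)\<close> on a ball of fixed radius about the midpoint of \<open>a\<close>
  and \<open>z\<close>. Total mass 1 limits this.\<close>

lemma bounded: obtains M where "0 < M" "\<And>x. f0 x \<le> M"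
proof -
  have "U \<noteq> {}"
  proof
    assume "U = {}"
    then have "f0 = (\<lambda>_. 0)" using zero by auto
    then show False using mass by simp
  qed
  then obtain a where a: "a \<in> U" by auto
  define t where "t = f0 a / 2"
  have t: "0 < t" using pos[OF a] by (simp add: t_def)
  have "isCont f0 a" using a cont U by (auto simp: continuous_on_eq_continuous_at)
  then have "eventually (\<lambda>y. t < f0 y) (nhds a)"
    unfolding isCont_def tendsto_at_iff_tendsto_nhds
    by (rule order_tendstoD) (use pos[OF a] in \<open>simp add: t_def\<close>)
  then obtain e where e: "e > 0" "\<And>y. dist y a < e \<Longrightarrow> t < f0 y"
    by (auto simp: eventually_nhds_metric)
  define V where "V = unit_ball_vol (real DIM('a)) * (e / 2) ^ DIM('a)"
  have V: "V > 0" using e(1) by (simp add: V_def)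
  have "f0 z \<le> 1 / V\<^sup>2 / t" for z
  proof -
    define s where "s = sqrt (t * f0 z)"
    let ?B = "ball ((1/2) *\<^sub>R (a + z)) (e / 2)"
    have le: "s \<le> f0 x" if "x \<in> ?B" for x
    proof -
      \<comment> \<open>Each \<open>x\<close> in the ball is the midpoint of \<open>z\<close> and
        \<open>2 *\<^sub>R x - z\<close>, and the latter lies within \<open>e\<close> of
        \<open>a\<close>.\<close>
      have "2 *\<^sub>R x - z - a = 2 *\<^sub>R (x - (1/2) *\<^sub>R (a + z))" by (simp add: algebra_simps)
      then have "dist (2 *\<^sub>R x - z) a = 2 * dist x ((1/2) *\<^sub>R (a + z))"
        by (simp add: dist_norm)
      then have "dist (2 *\<^sub>R x - z) a < e" using that by (simp add: dist_commute)
      then have "t * f0 z \<le> f0 (2 *\<^sub>R x - z) * f0 z"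
        using less_imp_le[OF e(2)] nonneg[of z] by (intro mult_right_mono) auto
      also have "\<dots> \<le> (f0 ((1/2) *\<^sub>R (2 *\<^sub>R x - z + z)))\<^sup>2" by (rule mid)
      finally have "t * f0 z \<le> (f0 x)\<^sup>2" by simp
      then show ?thesis unfolding s_def by (intro real_le_lsqrt nonneg)
    qed
    have s: "0 \<le> s" using t nonneg by (simp add: s_def)
    have "ennreal (s * V) = (\<integral>\<^sup>+x. ennreal s * indicator ?B x \<partial>lborel)"
      using e(1) s by (simp add: nn_integral_cmult_indicator emeasure_ball V_def ennreal_mult)
    also have "\<dots> \<le> (\<integral>\<^sup>+x. f0 x \<partial>lborel)"
      by (intro nn_integral_mono) (auto simp: indicator_def le ennreal_leI)
    finally have "s * V \<le> 1" unfolding mass using s V by simp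
    then have "(s * V)\<^sup>2 \<le> 1" using s V by (simp add: power_le_one)
    then have "t * f0 z * V\<^sup>2 \<le> 1" using t nonneg by (simp add: power_mult_distrib s_def)
    then show ?thesis using t V by (simp add: field_simps)
  qed
  moreover have "0 < 1 / V\<^sup>2 / t" using t V by simp
  ultimately show thesis by (rule that[rotated])
qed

lemma integrable_f0: "integrable lborel f0"
  using mass by (intro integrableI_nonneg) (auto simp: nonneg)

lemma integrable_autocorrelation: "integrable lborel (\<lambda>y. f0 y * f0 (x + y))"
proof -
  obtain M where M: "0 < M" "\<And>x. f0 x \<le> M" using bounded by blast
  have "integrable lborel (\<lambda>y. M * f0 y)" using integrable_f0 by simp
  then show ?thesis
  proof (rule Bochner_Integration.integrable_bound)
    show "AE y in lborel. norm (f0 y * f0 (x + y)) \<le> norm (M * f0 y)"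
      using M(1) mult_right_mono[OF M(2) nonneg, of "x + _"]
      by (intro AE_I2) (simp add: abs_mult nonneg mult.commute[of "f0 _" "f0 (x + _)"])
  qed measurable
qed

lemma autocorrelation_lborel: "autocorrelation f0 x = (LINT y|lborel. f0 y * f0 (x + y))"
  unfolding autocorrelation_def by (rule integral_completion) measurable

lemma autocorrelation_nn_integral: "ennreal (autocorrelation f0 x) = (\<integral>\<^sup>+y. ennreal (f0 y) * ennreal (f0 (x + y)) \<partial>lborel)"
  unfolding autocorrelation_lborel
  by (subst nn_integral_eq_integral[symmetric, OF integrable_autocorrelation]) (auto simp: nonneg ennreal_mult)

lemma autocorrelation_nonneg: "0 \<le> autocorrelation f0 x"
  unfolding autocorrelation_lborel by (intro integral_nonneg_AE) (simp add: nonneg)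

lemma autocorrelation_even: "autocorrelation f0 (- x) = autocorrelation f0 x"
proof -
  have "ennreal (autocorrelation f0 (- x)) = (\<integral>\<^sup>+y. ennreal (f0 y) * ennreal (f0 (- x + y)) \<partial>lborel)"
    by (rule autocorrelation_nn_integral)
  also have "\<dots> = (\<integral>\<^sup>+y. ennreal (f0 (x + y)) * ennreal (f0 (- x + (x + y))) \<partial>lborel)"
    by (rule nn_integral_lborel_shift[symmetric]) measurable
  also have "\<dots> = ennreal (autocorrelation f0 x)"
    by (simp add: autocorrelation_nn_integral mult.commute)
  finally show ?thesis by (simp add: autocorrelation_nonneg)
qed

text \<open>The integrand \<open>f0 u * f0 (x + u)\<close> satisfies the midpoint inequality jointly
  in \<open>x\<close> and \<open>u\<close>; Prekopa-Leindler integrates \<open>u\<close>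
  out.\<close>

lemma autocorrelation_midpoint:
  "autocorrelation f0 x * autocorrelation f0 y \<le> (autocorrelation f0 ((1/2) *\<^sub>R (x + y)))\<^sup>2"
proof -
  have "ennreal (autocorrelation f0 x) * ennreal (autocorrelation f0 y)
    \<le> ennreal (autocorrelation f0 ((1/2) *\<^sub>R (x + y))) * ennreal (autocorrelation f0 ((1/2) *\<^sub>R (x + y)))"
    unfolding autocorrelation_nn_integral coord_measure_Basis[symmetric]
  proof (rule prekopa_leindler_coord_measure[OF orthonormal_Basis])
    fix u v :: 'a
    let ?m = "(1/2) *\<^sub>R (u + v)" and ?n = "(1/2) *\<^sub>R (x + y)"
    have "f0 u * f0 (x + u) * (f0 v * f0 (y + v)) = (f0 u * f0 v) * (f0 (x + u) * f0 (y + v))" by simp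
    also have "\<dots> \<le> (f0 ?m)\<^sup>2 * (f0 ((1/2) *\<^sub>R ((x + u) + (y + v))))\<^sup>2"
      by (intro mult_mono mid) (auto simp: nonneg)
    also have "(1/2) *\<^sub>R ((x + u) + (y + v)) = ?n + ?m" by (simp add: algebra_simps)
    finally have "f0 u * f0 (x + u) * (f0 v * f0 (y + v)) \<le> f0 ?m * f0 (?n + ?m) * (f0 ?m * f0 (?n + ?m))"
      by (simp add: power2_eq_square ac_simps)
    then show "ennreal (f0 u) * ennreal (f0 (x + u)) * (ennreal (f0 v) * ennreal (f0 (y + v)))
      \<le> ennreal (f0 ?m) * ennreal (f0 (?n + ?m)) * (ennreal (f0 ?m) * ennreal (f0 (?n + ?m)))"
      by (simp add: ennreal_mult[symmetric] nonneg ennreal_leI)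
  qed measurable
  then show ?thesis
    by (simp add: ennreal_mult[symmetric] autocorrelation_nonneg power2_eq_square)
qed

text \<open>Dominated convergence. For almost every \<open>y\<close> the point \<open>x + y\<close>
  avoids the null frontier of \<open>U\<close>, off which \<open>f0\<close> is continuous, and a
  bound on \<open>f0\<close> supplies the integrable majorant.\<close>

lemma autocorrelation_continuous: "continuous_on UNIV (autocorrelation f0)"
  unfolding continuous_on_sequentially
proof (intro allI ballI impI, elim conjE)
  fix u :: "nat \<Rightarrow> 'a" and x assume u: "u \<longlonglongrightarrow> x"
  obtain M where M: "0 < M" "\<And>x. f0 x \<le> M" using bounded by blast
  have "(\<lambda>k. LINT y|lborel. f0 y * f0 (u k + y)) \<longlonglongrightarrow> (LINT y|lborel. f0 y * f0 (x + y))"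
  proof (rule integral_dominated_convergence[where w="\<lambda>y. M * f0 y"])
    show "integrable lborel (\<lambda>y. M * f0 y)" using integrable_f0 by simp
    show "AE y in lborel. norm (f0 y * f0 (u k + y)) \<le> M * f0 y" for k
      using mult_right_mono[OF M(2) nonneg, of "u k + _"]
      by (intro AE_I2) (simp add: abs_mult nonneg mult.commute[of "f0 _" "f0 (u k + _)"])
    show "AE y in lborel. (\<lambda>k. f0 y * f0 (u k + y)) \<longlonglongrightarrow> f0 y * f0 (x + y)"
      using AE_lborel_shift_not_in_null_set[OF null_sets_frontier_convex[OF U(2)], of x]
    proof eventually_elim
      case (elim y)
      have "(\<lambda>k. u k + y) \<longlonglongrightarrow> x + y" by (intro tendsto_intros u)
      then show ?case by (intro tendsto_mult tendsto_const isCont_tendsto_compose[OF isCont_f0[OF elim]])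
    qed
  qed measurable
  then show "(autocorrelation f0 \<circ> u) \<longlonglongrightarrow> autocorrelation f0 x"
    by (simp add: autocorrelation_lborel o_def)
qed

lemma autocorrelation_zero_pos: "0 < autocorrelation f0 0"
proof (rule ccontr)
  assume "\<not> ?thesis"
  then have "ennreal (autocorrelation f0 0) = 0" by (simp add: ennreal_neg)
  then have "AE y in lborel. ennreal (f0 y) * ennreal (f0 (0 + y)) = 0"
    unfolding autocorrelation_nn_integral by (subst (asm) nn_integral_0_iff_AE) auto
  then have "AE y in lborel. ennreal (f0 y) = 0" by eventually_elim auto
  then have "(\<integral>\<^sup>+x. f0 x \<partial>lborel) = 0" by (subst nn_integral_0_iff_AE) auto
  then show False using mass by simp
qed

lemma autocorrelation_borel [measurable]: "autocorrelation f0 \<in> borel_measurable borel"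
  by (rule borel_measurable_continuous_onI[OF autocorrelation_continuous])

text \<open>One Tonelli for three purposes: a hyperplane with weight 1 leads to the cross-section
  body, a half line with weight \<open>r powr (p - 1)\<close> to the radial mean body, and the whole
  space to the total mass of the autocorrelation.\<close>

lemma nn_integral_autocorrelation:
  assumes "sigma_finite_measure M" and [measurable]: "T \<in> M \<rightarrow>\<^sub>M borel" "w \<in> borel_measurable M"
  shows "(\<integral>\<^sup>+x. ennreal (f0 x) * (\<integral>\<^sup>+s. w s * ennreal (f0 (x + T s)) \<partial>M) \<partial>lborel) =
    (\<integral>\<^sup>+s. w s * ennreal (autocorrelation f0 (T s)) \<partial>M)"
proof -
  interpret M: sigma_finite_measure M by fact
  interpret P: pair_sigma_finite lborel M ..
  have "(\<integral>\<^sup>+x. ennreal (f0 x) * (\<integral>\<^sup>+s. w s * ennreal (f0 (x + T s)) \<partial>M) \<partial>lborel) =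
    (\<integral>\<^sup>+x. \<integral>\<^sup>+s. w s * (ennreal (f0 x) * ennreal (f0 (T s + x))) \<partial>M \<partial>lborel)"
    by (intro nn_integral_cong, subst nn_integral_cmult[symmetric]) (auto simp: ac_simps)
  also have "\<dots> = (\<integral>\<^sup>+s. \<integral>\<^sup>+x. w s * (ennreal (f0 x) * ennreal (f0 (T s + x))) \<partial>lborel \<partial>M)"
    by (rule P.Fubini'[symmetric]) measurable
  also have "\<dots> = (\<integral>\<^sup>+s. w s * ennreal (autocorrelation f0 (T s)) \<partial>M)"
    unfolding autocorrelation_nn_integral by (intro nn_integral_cong nn_integral_cmult) measurable
  finally show ?thesis .
qed

lemma nn_integral_autocorrelation_lborel: "(\<integral>\<^sup>+x. autocorrelation f0 x \<partial>lborel) = 1"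
proof -
  have "(\<integral>\<^sup>+x. autocorrelation f0 x \<partial>lborel) = (\<integral>\<^sup>+x. ennreal (f0 x) * (\<integral>\<^sup>+s. f0 (x + s) \<partial>lborel) \<partial>lborel)"
    using nn_integral_autocorrelation[OF sigma_finite_lborel, of "\<lambda>x. x" "\<lambda>_. 1"] by simp
  also have "\<dots> = (\<integral>\<^sup>+x. ennreal (f0 x) * 1 \<partial>lborel)"
    by (intro nn_integral_cong arg_cong2[where f=times] refl)
       (subst nn_integral_lborel_shift[of "\<lambda>x. ennreal (f0 x)"]; simp add: mass)
  finally show ?thesis by (simp add: mass)
qed

end

section \<open>Even log-concave functions and their decay\<close>

text \<open>Shared by the autocorrelation and its marginals. Integrability is left to a second
  locale: a marginal is constant along the directions integrated out, so it is not integrable over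
  the whole space when there is such a direction.\<close>

locale even_log_concave =
  fixes g :: "'a::euclidean_space \<Rightarrow> real"
  assumes g_cont: "continuous_on UNIV g" and g_nonneg: "0 \<le> g x" and g_even: "g (- x) = g x"
    and g_log_concave: "log_concave g" and g_zero: "0 < g 0"

lemma (in log_concave_density) even_log_concave_autocorrelation: "even_log_concave (autocorrelation f0)"
  by standard (intro autocorrelation_continuous autocorrelation_nonneg autocorrelation_even autocorrelation_zero_pos
      continuous_midpoint_log_concave autocorrelation_midpoint)+

context even_log_concave
begin

lemma g_borel [measurable]: "g \<in> borel_measurable borel"
  by (rule borel_measurable_continuous_onI[OF g_cont])

lemma g_le_zero: "g x \<le> g 0"
proof -
  have "g x * g (- x) \<le> (g ((1/2) *\<^sub>R (x + - x)))\<^sup>2" by (rule log_concave_midpoint[OF g_log_concave g_nonneg])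
  then have "(g x)\<^sup>2 \<le> (g 0)\<^sup>2" by (simp add: g_even power2_eq_square)
  then show ?thesis by (rule power2_le_imp_le) (rule g_nonneg)
qed

lemma g_ball: obtains d where "0 < d" "\<And>x. norm x < d \<Longrightarrow> g 0 / 2 < g x"
proof -
  have "isCont g 0" using g_cont by (simp add: continuous_on_eq_continuous_at)
  then have "eventually (\<lambda>y. g 0 / 2 < g y) (nhds 0)"
    unfolding isCont_def tendsto_at_iff_tendsto_nhds by (rule order_tendstoD) (use g_zero in simp)
  then show thesis using that by (auto simp: eventually_nhds_metric)
qed

text \<open>A symmetric convex superlevel set that contains a point \<open>z\<close> and a ball of radius \<open>d\<close>
  contains about \<open>norm z / (2 * d)\<close> disjoint balls of radius \<open>d / 2\<close> along the segment to
  \<open>z\<close>, so finite mass bounds it.\<close>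
lemma g_superlevel_bounded:
  assumes fin: "(\<integral>\<^sup>+x. g x \<partial>lborel) < \<infinity>"
  obtains R where "0 < R" "\<And>x. R \<le> norm x \<Longrightarrow> g x < g 0 / 2"
proof -
  obtain d where d: "0 < d" "\<And>x. norm x < d \<Longrightarrow> g 0 / 2 < g x" using g_ball by blast
  define c where "c = g 0 / 2"
  have c: "0 < c" using g_zero by (simp add: c_def)
  define V where "V = unit_ball_vol (real DIM('a)) * (d / 2) ^ DIM('a)"
  have V: "V > 0" using d(1) by (simp add: V_def)
  define I where "I = enn2real (\<integral>\<^sup>+x. g x \<partial>lborel)"
  have I: "(\<integral>\<^sup>+x. g x \<partial>lborel) = ennreal I" using fin by (simp add: I_def)
  \<comment> \<open>\<open>K\<close> disjoint balls of volume \<open>V\<close> on which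
    \<open>g\<close> is at least \<open>c\<close> would carry more than the total mass
    \<open>I\<close>.\<close>
  obtain K :: nat where K: "I / (c * V) < real K" using reals_Archimedean2 by blast
  \<comment> \<open>The term \<open>2 * d * real K\<close> keeps the first \<open>K\<close> centres
    in the half of the segment nearer to the origin, where \<open>t \<le> 1/2\<close>; the summand 1
    makes \<open>norm z\<close> positive.\<close>
  have "g z < g 0 / 2" if z: "2 * d * real K + 1 \<le> norm z" for z
  proof (rule ccontr)
    assume "\<not> ?thesis"
    then have gz: "c \<le> g z" by (simp add: c_def)
    have z0: "norm z > 0" using z d(1) by (smt (verit) mult_nonneg_nonneg of_nat_0_le_iff)
    define p where "p = (\<lambda>k::nat. (d * real k / norm z) *\<^sub>R z)"
    have sub: "c \<le> g x" if k: "k < K" and x: "x \<in> ball (p k) (d / 2)" for k x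
    proof -
      define t where "t = d * real k / norm z"
      have "d * real k \<le> d * real K" using k d(1) by (intro mult_left_mono) auto
      then have "d * real k * 2 \<le> norm z" using z by (simp add: mult.assoc mult.left_commute)
      then have t: "0 \<le> t" "t \<le> 1/2"
        using z z0 d(1) by (auto simp: t_def divide_le_eq)
      \<comment> \<open>The point that makes \<open>x\<close> a convex combination of
        \<open>z\<close> and \<open>w\<close>; since \<open>1 - t\<close> is at least one half,
        \<open>w\<close> stays in the ball of radius \<open>d\<close> about 0.\<close>
      define w where "w = (1 / (1 - t)) *\<^sub>R (x - t *\<^sub>R z)"
      have "norm (x - t *\<^sub>R z) < d / 2" using x by (simp add: p_def t_def dist_norm norm_minus_commute)
      moreover have "norm w = norm (x - t *\<^sub>R z) / (1 - t)" using t by (simp add: w_def)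
      moreover have "norm (x - t *\<^sub>R z) / (1 - t) \<le> norm (x - t *\<^sub>R z) / (1/2)"
        using t by (intro divide_left_mono) auto
      ultimately have "norm w < d" by simp
      then have gw: "c \<le> g w" using d(2)[of w] by (simp add: c_def)
      have xe: "x = t *\<^sub>R z + (1 - t) *\<^sub>R w" using t by (simp add: w_def)
      have "c = c powr t * c powr (1 - t)" using c by (simp flip: powr_add)
      also have "\<dots> \<le> g z powr t * g w powr (1 - t)"
        using gz gw c t by (intro mult_mono powr_mono2) auto
      also have "\<dots> \<le> g x"
        unfolding xe using g_log_concave t unfolding log_concave_def by auto
      finally show ?thesis .
    qed
    have disj: "disjoint_family_on (\<lambda>k. ball (p k) (d / 2)) {..<K}"
      unfolding disjoint_family_on_def
    proof (intro ballI impI)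
      fix i j :: nat assume "i \<noteq> j"
      have "p i - p j = (d * (real i - real j) / norm z) *\<^sub>R z"
        by (simp add: p_def algebra_simps diff_divide_distrib)
      then have "dist (p i) (p j) = d * \<bar>real i - real j\<bar>"
        using z0 d(1) by (simp add: dist_norm abs_mult)
      also have "\<dots> \<ge> d * 1" using \<open>i \<noteq> j\<close> d(1) by (intro mult_left_mono) auto
      finally have "d \<le> dist (p i) (p j)" by simp
      then show "ball (p i) (d / 2) \<inter> ball (p j) (d / 2) = {}"
        by (intro disjoint_ballI) simp
    qed
    have "ennreal (c * (real K * V)) = ennreal c * (\<Sum>k<K. emeasure lborel (ball (p k) (d / 2)))"
      using c V d(1) by (simp add: emeasure_ball V_def[symmetric] ennreal_mult ennreal_of_nat_eq_real_of_nat)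
    also have "(\<Sum>k<K. emeasure lborel (ball (p k) (d / 2))) = emeasure lborel (\<Union>k<K. ball (p k) (d / 2))"
      by (rule sum_emeasure) (use disj in auto)
    also have "ennreal c * \<dots> = (\<integral>\<^sup>+x. ennreal c * indicator (\<Union>k<K. ball (p k) (d / 2)) x \<partial>lborel)"
      by (subst nn_integral_cmult_indicator) auto
    also have "\<dots> \<le> (\<integral>\<^sup>+x. g x \<partial>lborel)"
      using sub by (intro nn_integral_mono) (auto simp: indicator_def intro!: ennreal_leI)
    finally have "c * (real K * V) \<le> I" unfolding I using c V by (subst (asm) ennreal_le_iff) (auto simp: I_def)
    then show False using K c V by (simp add: field_simps)
  qed
  moreover have "0 < 2 * d * real K + 1" using d(1) by (simp add: add_nonneg_pos)
  ultimately show thesis by (rule that[rotated])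
qed

text \<open>On each ray log-concavity propagates the halving at radius \<open>R\<close>: beyond it
  \<open>ln g\<close> falls at least at rate \<open>ln 2 / R\<close>. The factor 2 in the constant
  covers the ball of radius \<open>R\<close>, where \<open>2 * exp (- c * norm x)\<close> is at
  least 1.\<close>

lemma g_exponential_decay:
  assumes fin: "(\<integral>\<^sup>+x. g x \<partial>lborel) < \<infinity>"
  obtains C c where "0 < C" "0 < c" "\<And>x. g x \<le> C * exp (- c * norm x)"
proof -
  obtain R where R: "0 < R" "\<And>x. R \<le> norm x \<Longrightarrow> g x < g 0 / 2" using g_superlevel_bounded[OF fin] by blast
  define c where "c = ln 2 / R"
  have c: "0 < c" using R(1) by (simp add: c_def)
  have "g x \<le> (2 * g 0) * exp (- c * norm x)" for x
  proof (cases "R < norm x \<and> g x \<noteq> 0")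
    case True
    then have nx: "norm x > 0" and gx: "g x > 0" using R(1) g_nonneg[of x] by auto
    define t where "t = R / norm x"
    have t: "0 < t" "t < 1" using True R(1) nx by (auto simp: t_def)
    have "norm (t *\<^sub>R x) = R" using nx R(1) by (simp add: t_def)
    then have "g (t *\<^sub>R x) < g 0 / 2" by (intro R(2)) simp
    moreover have "g x powr t * g 0 powr (1 - t) \<le> g (t *\<^sub>R x)"
      using g_log_concave[unfolded log_concave_def, rule_format, of t x 0] t by simp
    ultimately have "g x powr t * g 0 powr (1 - t) < g 0 / 2" by simp
    then have "ln (g x powr t * g 0 powr (1 - t)) < ln (g 0 / 2)"
      using gx g_zero by (subst ln_less_cancel_iff) auto
    then have "t * (ln (g x) - ln (g 0)) < - ln 2"
      using gx g_zero by (simp add: ln_mult ln_powr ln_div algebra_simps)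
    then have "ln (g x) - ln (g 0) < - ln 2 / t" using t by (simp add: field_simps)
    also have "- ln 2 / t = - c * norm x" by (simp add: t_def c_def)
    finally have "ln (g x) < ln (g 0 * exp (- c * norm x))" using g_zero by (simp add: ln_mult)
    then have "g x < g 0 * exp (- c * norm x)"
      using gx g_zero by (subst (asm) ln_less_cancel_iff) auto
    also have "\<dots> \<le> 2 * g 0 * exp (- c * norm x)" using g_zero by simp
    finally show ?thesis by simp
  next
    case False
    show ?thesis
    proof (cases "g x = 0")
      case True
      then show ?thesis using g_zero by simp
    next
      case g0: False
      then have "c * norm x \<le> c * R" using False c by (intro mult_left_mono) auto
      then have "exp (- (c * R)) \<le> exp (- c * norm x)" by simp
      moreover have "exp (- (c * R)) = 1 / 2" using R(1) by (simp add: c_def exp_minus)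
      ultimately have "1 \<le> 2 * exp (- c * norm x)" by simp
      then have "g 0 * 1 \<le> g 0 * (2 * exp (- c * norm x))" using g_zero by (intro mult_left_mono) auto
      then have "g 0 \<le> 2 * g 0 * exp (- c * norm x)" by simp
      then show ?thesis using g_le_zero[of x] by simp
    qed
  qed
  moreover have "0 < 2 * g 0" using g_zero by simp
  ultimately show thesis using c that by blast
qed

end

section \<open>Ball's inequality\<close>

text \<open>The density may blow up at 0, as \<open>r powr (p - 1)\<close> does for
  \<open>p < 1\<close>. Differentiability is therefore claimed only for positive \<open>r\<close>,
  and 0 enters through continuity. The final conclusion expresses convergence to the full mass
  without a limit.\<close>

lemma primitive_half_line:
  fixes \<psi> :: "real \<Rightarrow> real"
  assumes cont: "continuous_on {0<..} \<psi>" and nonneg: "\<And>r. 0 < r \<Longrightarrow> 0 \<le> \<psi> r"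
    and mass: "(\<integral>\<^sup>+r. ennreal (indicator {0<..} r * \<psi> r) \<partial>lborel) = ennreal m" and m: "0 \<le> m"
  obtains \<Phi> where "\<And>r. 0 < r \<Longrightarrow> (\<Phi> has_real_derivative \<psi> r) (at r)" "continuous_on {0..} \<Phi>" "\<Phi> 0 = 0"
    "\<And>r. 0 \<le> r \<Longrightarrow> 0 \<le> \<Phi> r \<and> \<Phi> r \<le> m" "\<And>a. a < m \<Longrightarrow> \<exists>r>0. a < \<Phi> r"
proof -
  define \<psi>0 where "\<psi>0 = (\<lambda>r. indicator {0<..} r * \<psi> r)"
  have [measurable]: "\<psi>0 \<in> borel_measurable borel"
    unfolding \<psi>0_def using borel_measurable_continuous_on_indicator[OF _ cont] by simp
  have nn: "0 \<le> \<psi>0 r" for r by (auto simp: \<psi>0_def indicator_def nonneg)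
  have int_UNIV: "\<psi>0 integrable_on UNIV"
  proof (rule nn_integral_integrable_on)
    show "(\<integral>\<^sup>+r. ennreal (\<psi>0 r) \<partial>lborel) < \<infinity>" unfolding \<psi>0_def mass by simp
  qed (auto simp: nn)
  have int: "\<psi>0 integrable_on {a..b}" for a b
    using integrable_on_subcbox[OF int_UNIV, of a b] by simp
  define \<Phi> where "\<Phi> = (\<lambda>r. integral {0..r} \<psi>0)"
  have total: "(\<integral>\<^sup>+r. ennreal (\<psi>0 r) * indicator {0..b} r \<partial>lborel) = ennreal (\<Phi> b)" for b
    unfolding \<Phi>_def by (rule nn_integral_has_integral_lebesgue') (auto simp: nn intro: integrable_integral int)
  have \<Phi>_nonneg: "0 \<le> \<Phi> b" for b
    unfolding \<Phi>_def by (intro integral_nonneg int nn)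
  have \<Phi>_le: "\<Phi> b \<le> m" for b
  proof -
    have "ennreal (\<Phi> b) \<le> (\<integral>\<^sup>+r. ennreal (\<psi>0 r) \<partial>lborel)"
      unfolding total[symmetric] by (intro nn_integral_mono) (auto simp: indicator_def)
    then have "ennreal (\<Phi> b) \<le> ennreal m" by (simp only: \<psi>0_def mass)
    then show ?thesis using m by simp
  qed
  show thesis
  proof
    fix r :: real assume r: "0 < r"
    have "continuous (at r) \<psi>"
      using cont r by (auto simp: continuous_on_eq_continuous_at)
    moreover have "eventually (\<lambda>x. \<psi>0 x = \<psi> x) (nhds r)"
      using eventually_nhds_in_open[of "{0<..}" r] r by (auto simp: \<psi>0_def elim!: eventually_mono)
    ultimately have c: "continuous (at r) \<psi>0" using isCont_cong by blast
    have "((\<lambda>u. integral {0..u} \<psi>0) has_vector_derivative \<psi>0 r) (at r within ({0..r + 1} - {}))"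
      by (rule integral_has_vector_derivative_continuous_at[OF int])
         (use r c in \<open>auto intro: continuous_at_imp_continuous_at_within\<close>)
    then have "(\<Phi> has_real_derivative \<psi>0 r) (at r within {0..r + 1})"
      by (simp add: \<Phi>_def has_real_derivative_iff_has_vector_derivative)
    moreover have "at r within {0..r + 1} = at r"
      using r by (intro at_within_interior) (auto simp: interior_atLeastAtMost_real)
    ultimately show "(\<Phi> has_real_derivative \<psi> r) (at r)" using r by (simp add: \<psi>0_def)
  next
    show "continuous_on {0..} \<Phi>"
      unfolding continuous_on_eq_continuous_within
    proof
      fix r :: real assume "r \<in> {0..}"
      have "continuous_on {0..r + 1} \<Phi>"
        unfolding \<Phi>_def by (rule indefinite_integral_continuous_1[OF int])
      then have "continuous (at r within {0..r + 1}) \<Phi>"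
        using \<open>r \<in> {0..}\<close> by (auto simp: continuous_on_eq_continuous_within)
      moreover have "at r within {0..r + 1} = at r within {0..}"
        by (rule at_within_nhd[of _ "{..<r + 1}"]) auto
      ultimately show "continuous (at r within {0..}) \<Phi>" by (simp add: continuous_within)
    qed
  next
    show "\<Phi> 0 = 0" by (simp add: \<Phi>_def)
  next
    show "0 \<le> \<Phi> r \<and> \<Phi> r \<le> m" for r by (simp add: \<Phi>_nonneg \<Phi>_le)
  next
    fix a assume a: "a < m"
    show "\<exists>r>0. a < \<Phi> r"
    proof (rule ccontr)
      assume "\<not> ?thesis"
      then have le: "\<Phi> r \<le> a" if "0 < r" for r using that \<open>\<not> (\<exists>r>0. a < \<Phi> r)\<close> by (meson not_less)
      have a0: "0 \<le> a" using le[of 1] \<Phi>_nonneg[of 1] by simp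
      have "(\<integral>\<^sup>+r. ennreal (\<psi>0 r) \<partial>lborel) = (\<integral>\<^sup>+r. (SUP k::nat. ennreal (\<psi>0 r) * indicator {0..real k} r) \<partial>lborel)"
      proof (rule nn_integral_cong)
        fix r :: real
        obtain k where k: "r \<le> real k" using real_arch_simple by blast
        have "ennreal (\<psi>0 r) \<le> (SUP k::nat. ennreal (\<psi>0 r) * indicator {0..real k} r)"
          by (rule SUP_upper2[of k]) (use k in \<open>auto simp: \<psi>0_def indicator_def\<close>)
        moreover have "(SUP k::nat. ennreal (\<psi>0 r) * indicator {0..real k} r) \<le> ennreal (\<psi>0 r)"
          by (rule SUP_least) (auto simp: indicator_def)
        ultimately show "ennreal (\<psi>0 r) = (SUP k::nat. ennreal (\<psi>0 r) * indicator {0..real k} r)" by (rule antisym)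
      qed
      also have "\<dots> = (SUP k::nat. \<integral>\<^sup>+r. ennreal (\<psi>0 r) * indicator {0..real k} r \<partial>lborel)"
        by (rule nn_integral_monotone_convergence_SUP) (auto simp: incseq_def le_fun_def indicator_def)
      also have "\<dots> \<le> ennreal a"
      proof (rule SUP_least)
        fix k :: nat
        have "\<Phi> (real k) \<le> a" using le[of "real k"] a0 by (cases "k = 0") (auto simp: \<Phi>_def)
        then show "(\<integral>\<^sup>+r. ennreal (\<psi>0 r) * indicator {0..real k} r \<partial>lborel) \<le> ennreal a"
          unfolding total by (rule ennreal_leI)
      qed
      finally have "ennreal m \<le> ennreal a" by (simp only: \<psi>0_def mass)
      then show False using a a0 by simp
    qed
  qed
qed

text \<open>The inverse of the distribution function. By \<open>down\<close> the density is positive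
  exactly on an initial stretch of the half line, where its primitive increases strictly; beyond it
  the primitive is constant. So each \<open>q\<close> in the open unit interval is attained at a
  point of positive density, and the inverse is differentiable there.\<close>

lemma quantile_function:
  fixes \<psi> :: "real \<Rightarrow> real"
  assumes cont: "continuous_on {0<..} \<psi>" and nonneg: "\<And>r. 0 < r \<Longrightarrow> 0 \<le> \<psi> r"
    and down: "\<And>r s. 0 < s \<Longrightarrow> s \<le> r \<Longrightarrow> 0 < \<psi> r \<Longrightarrow> 0 < \<psi> s"
    and mass: "(\<integral>\<^sup>+r. ennreal (indicator {0<..} r * \<psi> r) \<partial>lborel) = 1"
  obtains Q where "\<And>q. 0 < q \<Longrightarrow> q < 1 \<Longrightarrow>
    0 < Q q \<and> 0 < \<psi> (Q q) \<and> (Q has_real_derivative 1 / \<psi> (Q q)) (at q)"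
proof -
  obtain \<Phi> where der: "\<And>r. 0 < r \<Longrightarrow> (\<Phi> has_real_derivative \<psi> r) (at r)"
    and c\<Phi>: "continuous_on {0..} \<Phi>" and \<Phi>0: "\<Phi> 0 = 0"
    and bnd: "\<And>r. 0 \<le> r \<Longrightarrow> 0 \<le> \<Phi> r \<and> \<Phi> r \<le> 1" and sup: "\<And>a. a < 1 \<Longrightarrow> \<exists>r>0. a < \<Phi> r"
    using primitive_half_line[OF cont nonneg, of 1] mass by auto
  define P where "P = {r. 0 < r \<and> 0 < \<psi> r}"
  have "P = {0<..} \<inter> \<psi> -` {0<..}" by (auto simp: P_def)
  then have "open P" using continuous_open_preimage[OF cont, of "{0<..}"] by auto
  \<comment> \<open>Outside \<open>P\<close> the density would vanish from \<open>r\<close> on, so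
    the primitive could never rise above \<open>\<Phi> r < 1\<close>.\<close>
  have in_P: "r \<in> P" if r1: "0 < r" "\<Phi> r < 1" for r
  proof (rule ccontr)
    assume "r \<notin> P"
    then have z: "\<psi> s = 0" if "r \<le> s" for s
      using down[of r s] nonneg[of s] \<open>0 < r\<close> that by (force simp: P_def less_le)
    obtain k where k: "0 < k" "\<Phi> r < \<Phi> k" using sup[OF r1(2)] by auto
    show False
    proof (cases "r \<le> k")
      case True
      have "continuous_on {r..k} \<Phi>" using c\<Phi> r1 by (auto elim!: continuous_on_subset)
      moreover have "(\<Phi> has_real_derivative 0) (at x)" if "r < x" for x
        using der[of x] z[of x] r1 that by simp
      ultimately have "\<Phi> k = \<Phi> r"
        using DERIV_isconst2[of r k \<Phi> k] True k by (cases "r = k") auto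
      then show False using k by simp
    next
      case False
      have "\<Phi> k \<le> \<Phi> r"
      proof (rule DERIV_nonneg_imp_nondecreasing[of k r \<Phi>])
        show "k \<le> r" using False by simp
        fix x assume "k \<le> x"
        then show "\<exists>y. (\<Phi> has_real_derivative y) (at x) \<and> 0 \<le> y"
          using k der[of x] nonneg[of x] by (intro exI[of _ "\<psi> x"]) auto
      qed
      then show False using k by simp
    qed
  qed
  have strict: "\<Phi> r < \<Phi> s" if "r < s" "r \<in> P" "s \<in> P" for r s
  proof (rule DERIV_pos_imp_increasing[OF that(1)])
    fix x assume "r \<le> x" "x \<le> s"
    then show "\<exists>y. (\<Phi> has_real_derivative y) (at x) \<and> 0 < y"
      using that der[of x] down[of x s] by (auto simp: P_def)
  qed
  have inj: "r = s" if "\<Phi> r = \<Phi> s" "r \<in> P" "s \<in> P" for r s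
    using strict[of r s] strict[of s r] that by (cases r s rule: linorder_cases) auto
  define Q where "Q = (\<lambda>q. SOME r. r \<in> P \<and> \<Phi> r = q)"
  have Q\<Phi>: "Q (\<Phi> r) = r" if "r \<in> P" for r
    unfolding Q_def by (rule some_equality) (use that inj in auto)
  have ex: "\<exists>r\<in>P. \<Phi> r = q" if q: "0 < q" "q < 1" for q
  proof -
    obtain k where k: "0 < k" "q < \<Phi> k" using sup[OF q(2)] by auto
    obtain r where r: "0 \<le> r" "r \<le> k" "\<Phi> r = q"
      using IVT'[of \<Phi> 0 q k] k q \<Phi>0 continuous_on_subset[OF c\<Phi>, of "{0..k}"] by auto
    then have "0 < r" using q \<Phi>0 by (cases "r = 0") auto
    then show ?thesis using in_P[of r] r q by auto
  qed
  have Qq: "Q q \<in> P" "\<Phi> (Q q) = q" if "0 < q" "q < 1" for q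
    using ex[OF that] Q\<Phi> by auto
  show thesis
  proof (rule that[of Q])
    fix q :: real assume q: "0 < q" "q < 1"
    have "isCont Q (\<Phi> (Q q))"
    proof -
      obtain e where e: "0 < e" "cball (Q q) e \<subseteq> P"
        using open_contains_cball[THEN iffD1, OF \<open>open P\<close>, rule_format, OF Qq(1)[OF q]] by auto
      then have near: "z \<in> P" if "\<bar>z - Q q\<bar> \<le> e" for z using that by (auto simp: dist_real_def abs_minus_commute)
      have cont_P: "isCont \<Phi> z" if "z \<in> P" for z
        using der[of z, THEN DERIV_isCont] that by (simp add: P_def)
      show ?thesis
        by (rule isCont_inverse_function[where f=\<Phi> and x="Q q", OF e(1)]) (simp_all add: Q\<Phi> near cont_P)
    qed
    then have "isCont Q q" using Qq(2)[OF q] by simp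
    have "(Q has_real_derivative inverse (\<psi> (Q q))) (at q)"
      by (rule DERIV_inverse_function[where f=\<Phi> and a=0 and b=1])
         (use Qq(1)[OF q] Qq(2) q \<open>isCont Q q\<close> in \<open>auto simp: P_def intro!: der\<close>)
    then show "0 < Q q \<and> 0 < \<psi> (Q q) \<and> (Q has_real_derivative 1 / \<psi> (Q q)) (at q)"
      using Qq(1)[OF q] by (simp add: P_def inverse_eq_divide)
  qed
qed

section \<open>The transport inequality\<close>

lemma weighted_am_gm_ln:
  fixes a b \<theta> :: real
  assumes "0 < a" "0 < b" "0 < \<theta>" "\<theta> < 1"
  shows "exp (\<theta> * ln a + (1 - \<theta>) * ln b) \<le> \<theta> * a + (1 - \<theta>) * b"
  using convex_onD[OF exp_convex, of \<theta> "ln b" "ln a"] assms by (simp add: algebra_simps)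

text \<open>Weighted AM-GM with weights \<theta> and 1 - \<theta>, applied twice: to the sum on the
  left and to the final factor on the right. Because
  \<open>t = \<theta> * r = (1 - \<theta>) * s\<close>, the powers of \<open>r\<close>,
  \<open>s\<close>, \<open>A\<close> and \<open>B\<close> cancel and both estimates meet at the same
  value.\<close>

lemma ball_pointwise_inequality:
  fixes p r s A B \<alpha> \<beta> :: real
  assumes pos: "0 < p" "0 < r" "0 < s" "0 < A" "0 < B" "0 < \<alpha>" "0 < \<beta>"
  defines "\<theta> \<equiv> s / (r + s)" and "t \<equiv> r * s / (r + s)"
  shows "(\<alpha> powr (- 1 / p) + \<beta> powr (- 1 / p)) powr (- p) \<le>
    t powr (p - 1) * (A powr \<theta> * B powr (1 - \<theta>)) *
      (\<theta>\<^sup>2 / (r powr (p - 1) * A / \<alpha>) + (1 - \<theta>)\<^sup>2 / (s powr (p - 1) * B / \<beta>))"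
proof -
  let ?\<psi> = "r powr (p - 1) * A / \<alpha>" and ?\<chi> = "s powr (p - 1) * B / \<beta>"
  have \<theta>: "0 < \<theta>" "\<theta> < 1" using pos by (auto simp: \<theta>_def)
  have t: "t = \<theta> * r" "t = (1 - \<theta>) * s" using pos by (auto simp: \<theta>_def t_def field_simps)
  have tpos: "0 < t" using pos by (simp add: t_def)
  have lnt: "ln t = ln \<theta> + ln r" "ln t = ln (1 - \<theta>) + ln s"
    using ln_mult[of \<theta> r] ln_mult[of "1 - \<theta>" s] \<theta> pos by (simp_all add: t[symmetric])
  let ?a = "\<alpha> powr (- 1 / p)" and ?b = "\<beta> powr (- 1 / p)"
  \<comment> \<open>The logarithm of the common value at which the two AM-GM estimates meet; it no
    longer contains \<open>r\<close>, \<open>s\<close>, \<open>A\<close>, \<open>B\<close> except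
    through \<theta>.\<close>
  let ?E = "\<theta> * (ln \<alpha> + p * ln \<theta>) + (1 - \<theta>) * (ln \<beta> + p * ln (1 - \<theta>))"
  have "exp (\<theta> * ln (?a / \<theta>) + (1 - \<theta>) * ln (?b / (1 - \<theta>))) \<le> \<theta> * (?a / \<theta>) + (1 - \<theta>) * (?b / (1 - \<theta>))"
    by (rule weighted_am_gm_ln) (use \<theta> pos in auto)
  also have "\<dots> = ?a + ?b" using \<theta> by simp
  also have "\<theta> * ln (?a / \<theta>) + (1 - \<theta>) * ln (?b / (1 - \<theta>)) = - ?E / p"
    using \<theta> pos by (simp add: ln_div ln_powr field_simps)
  finally have "(?a + ?b) powr (- p) \<le> exp (- ?E / p) powr (- p)"
    using pos by (intro powr_mono2') auto
  also have "\<dots> = exp ?E" using pos by (simp add: powr_def)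
  finally have 1: "(?a + ?b) powr (- p) \<le> exp ?E" .
  have "exp (\<theta> * ln (\<theta> / ?\<psi>) + (1 - \<theta>) * ln ((1 - \<theta>) / ?\<chi>)) \<le> \<theta> * (\<theta> / ?\<psi>) + (1 - \<theta>) * ((1 - \<theta>) / ?\<chi>)"
    by (rule weighted_am_gm_ln) (use \<theta> pos in auto)
  also have "\<dots> = \<theta>\<^sup>2 / ?\<psi> + (1 - \<theta>)\<^sup>2 / ?\<chi>" by (simp add: power2_eq_square mult.assoc)
  finally have 2: "exp (\<theta> * ln (\<theta> / ?\<psi>) + (1 - \<theta>) * ln ((1 - \<theta>) / ?\<chi>)) \<le> \<theta>\<^sup>2 / ?\<psi> + (1 - \<theta>)\<^sup>2 / ?\<chi>" .
  have ln\<psi>: "ln (\<theta> / ?\<psi>) = ln \<theta> - (p - 1) * ln r - ln A + ln \<alpha>"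
    using \<theta> pos by (simp add: ln_div ln_mult ln_powr)
  have ln\<chi>: "ln ((1 - \<theta>) / ?\<chi>) = ln (1 - \<theta>) - (p - 1) * ln s - ln B + ln \<beta>"
    using \<theta> pos by (simp add: ln_div ln_mult ln_powr)
  \<comment> \<open>Splitting \<open>ln t\<close> with weights \<theta> and 1 - \<theta>, and
    reading it once through \<open>r\<close> and once through \<open>s\<close>, produces the terms
    that cancel those powers in the two densities.\<close>
  have "(p - 1) * ln t = \<theta> * ((p - 1) * ln t) + (1 - \<theta>) * ((p - 1) * ln t)" by (simp add: algebra_simps)
  also have "\<dots> = \<theta> * ((p - 1) * (ln \<theta> + ln r)) + (1 - \<theta>) * ((p - 1) * (ln (1 - \<theta>) + ln s))"
    using lnt by simp
  finally have "?E = (p - 1) * ln t + (\<theta> * ln A + (1 - \<theta>) * ln B) + (\<theta> * ln (\<theta> / ?\<psi>) + (1 - \<theta>) * ln ((1 - \<theta>) / ?\<chi>))"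
    unfolding ln\<psi> ln\<chi> by (simp add: algebra_simps)
  then have "exp ?E = t powr (p - 1) * (A powr \<theta> * B powr (1 - \<theta>)) * exp (\<theta> * ln (\<theta> / ?\<psi>) + (1 - \<theta>) * ln ((1 - \<theta>) / ?\<chi>))"
    using tpos pos by (simp only: exp_add) (simp add: powr_def)
  also have "\<dots> \<le> t powr (p - 1) * (A powr \<theta> * B powr (1 - \<theta>)) * (\<theta>\<^sup>2 / ?\<psi> + (1 - \<theta>)\<^sup>2 / ?\<chi>)"
    by (intro mult_left_mono 2) auto
  finally show ?thesis using 1 by simp
qed

text \<open>Ball's inequality by transport: parametrise both half lines by the quantiles \<open>r = Q q\<close>,
  \<open>s = R q\<close> of the two moment measures; the harmonic combination \<open>t = r s / (r + s)\<close> then moves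
  at a speed that makes the moment of \<open>H\<close> grow at rate at least the claimed bound in \<open>q\<close>.\<close>
lemma ball_moment_inequality:
  fixes F G H :: "real \<Rightarrow> real"
  assumes p: "0 < p"
    and cont: "continuous_on {0<..} F" "continuous_on {0<..} G" "continuous_on {0<..} H"
    and nonneg: "\<And>r. 0 \<le> F r" "\<And>r. 0 \<le> G r" "\<And>r. 0 \<le> H r"
    and down: "\<And>r s. 0 < s \<Longrightarrow> s \<le> r \<Longrightarrow> 0 < F r \<Longrightarrow> 0 < F s" "\<And>r s. 0 < s \<Longrightarrow> s \<le> r \<Longrightarrow> 0 < G r \<Longrightarrow> 0 < G s"
    and mF: "(\<integral>\<^sup>+r. ennreal (indicator {0<..} r * (r powr (p - 1) * F r)) \<partial>lborel) = ennreal \<alpha>" "0 < \<alpha>"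
    and mG: "(\<integral>\<^sup>+r. ennreal (indicator {0<..} r * (r powr (p - 1) * G r)) \<partial>lborel) = ennreal \<beta>" "0 < \<beta>"
    and mH: "(\<integral>\<^sup>+r. ennreal (indicator {0<..} r * (r powr (p - 1) * H r)) \<partial>lborel) = ennreal \<delta>" "0 \<le> \<delta>"
    and FGH: "\<And>r s. 0 < r \<Longrightarrow> 0 < s \<Longrightarrow> F r powr (s / (r + s)) * G s powr (1 - s / (r + s)) \<le> H (r * s / (r + s))"
  shows "(\<alpha> powr (- 1 / p) + \<beta> powr (- 1 / p)) powr (- p) \<le> \<delta>"
proof -
  have quantile: "\<exists>Q. \<forall>q. 0 < q \<longrightarrow> q < 1 \<longrightarrow> 0 < Q q \<and> 0 < K (Q q) \<and>
      (Q has_real_derivative 1 / (Q q powr (p - 1) * K (Q q) / \<kappa>)) (at q)"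
    if K: "continuous_on {0<..} K" "\<And>r. 0 \<le> K r" "\<And>r s. 0 < s \<Longrightarrow> s \<le> r \<Longrightarrow> 0 < K r \<Longrightarrow> 0 < K s"
      "(\<integral>\<^sup>+r. ennreal (indicator {0<..} r * (r powr (p - 1) * K r)) \<partial>lborel) = ennreal \<kappa>" "0 < \<kappa>" for K :: "real \<Rightarrow> real" and \<kappa>
  proof -
    \<comment> \<open>Division by \<kappa> makes the moment measure a probability measure, so that
      the quantiles of \<open>F\<close> and \<open>G\<close> share one parameter
      \<open>q\<close>.\<close>
    let ?\<psi> = "\<lambda>r. r powr (p - 1) * K r / \<kappa>"
    have m: "(\<lambda>r. indicator {0<..} r * (r powr (p - 1) * K r)) \<in> borel_measurable borel"
    proof -
      have "continuous_on {0<..} (\<lambda>r. r powr (p - 1) * K r)" using K(1) by (auto intro!: continuous_intros)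
      from borel_measurable_continuous_on_indicator[OF _ this] show ?thesis by simp
    qed
    have eq: "ennreal (indicator {0<..} r * ?\<psi> r) = ennreal (1 / \<kappa>) * ennreal (indicator {0<..} r * (r powr (p - 1) * K r))" for r
      using \<open>0 < \<kappa>\<close> K(2) by (subst ennreal_mult[symmetric]) (auto simp: indicator_def)
    have "(\<integral>\<^sup>+r. ennreal (indicator {0<..} r * ?\<psi> r) \<partial>lborel) = 1"
      unfolding eq using m \<open>0 < \<kappa>\<close> by (subst nn_integral_cmult) (auto simp: K(4) ennreal_mult[symmetric])
    moreover have "continuous_on {0<..} ?\<psi>" using K(1,5) by (auto intro!: continuous_intros)
    ultimately obtain Q where "\<And>q. 0 < q \<Longrightarrow> q < 1 \<Longrightarrow> 0 < Q q \<and> 0 < ?\<psi> (Q q) \<and> (Q has_real_derivative 1 / ?\<psi> (Q q)) (at q)"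
      using quantile_function[of ?\<psi>] K(2,3) \<open>0 < \<kappa>\<close> by (auto simp: zero_less_mult_iff zero_less_divide_iff)
    then show ?thesis using \<open>0 < \<kappa>\<close> by (intro exI[of _ Q]) (auto simp: zero_less_mult_iff zero_less_divide_iff)
  qed
  obtain Q where Q: "\<And>q. 0 < q \<Longrightarrow> q < 1 \<Longrightarrow> 0 < Q q \<and> 0 < F (Q q) \<and>
      (Q has_real_derivative 1 / (Q q powr (p - 1) * F (Q q) / \<alpha>)) (at q)"
    using quantile[OF cont(1) nonneg(1) _ mF] down(1) by blast
  obtain R where R: "\<And>q. 0 < q \<Longrightarrow> q < 1 \<Longrightarrow> 0 < R q \<and> 0 < G (R q) \<and>
      (R has_real_derivative 1 / (R q powr (p - 1) * G (R q) / \<beta>)) (at q)"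
    using quantile[OF cont(2) nonneg(2) _ mG] down(2) by blast
  have cH: "continuous_on {0<..} (\<lambda>r. r powr (p - 1) * H r)" using cont(3) by (auto intro!: continuous_intros)
  obtain \<Omega> where der\<Omega>: "\<And>r. 0 < r \<Longrightarrow> (\<Omega> has_real_derivative r powr (p - 1) * H r) (at r)"
    and bnd\<Omega>: "\<And>r. 0 \<le> r \<Longrightarrow> 0 \<le> \<Omega> r \<and> \<Omega> r \<le> \<delta>"
    using primitive_half_line[OF cH _ mH] nonneg(3) by (metis mult_nonneg_nonneg powr_ge_zero)
  let ?\<gamma> = "(\<alpha> powr (- 1 / p) + \<beta> powr (- 1 / p)) powr (- p)"
  let ?t = "\<lambda>q. Q q * R q / (Q q + R q)"
  have grow: "\<exists>d. ((\<lambda>q. \<Omega> (?t q) - ?\<gamma> * q) has_real_derivative d) (at q) \<and> 0 \<le> d" if q: "0 < q" "q < 1" for q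
  proof -
    let ?r = "Q q" and ?s = "R q"
    let ?\<psi> = "?r powr (p - 1) * F ?r / \<alpha>" and ?\<chi> = "?s powr (p - 1) * G ?s / \<beta>"
    let ?\<theta> = "?s / (?r + ?s)"
    have pos: "0 < ?r" "0 < ?s" "0 < F ?r" "0 < G ?s" using Q[OF q] R[OF q] by auto
    have tpos: "0 < ?t q" using pos by simp
    let ?D = "?\<theta>\<^sup>2 / ?\<psi> + (1 - ?\<theta>)\<^sup>2 / ?\<chi>"
    \<comment> \<open>For the harmonic combination
      \<open>dt = \<theta>\<^sup>2 dr + (1 - \<theta>)\<^sup>2 ds\<close>; with the quantile speeds
      inserted this is the last factor of \<open>ball_pointwise_inequality\<close>.\<close>
    have "(?t has_real_derivative ((1 / ?\<psi> * ?s + 1 / ?\<chi> * ?r) * (?r + ?s) - (?r * ?s) * (1 / ?\<psi> + 1 / ?\<chi>)) / ((?r + ?s) * (?r + ?s))) (at q)"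
      using Q[OF q] R[OF q] by (intro DERIV_divide DERIV_mult DERIV_add) auto
    also have "((1 / ?\<psi> * ?s + 1 / ?\<chi> * ?r) * (?r + ?s) - (?r * ?s) * (1 / ?\<psi> + 1 / ?\<chi>)) / ((?r + ?s) * (?r + ?s)) = ?D"
    proof -
      have "1 - ?\<theta> = ?r / (?r + ?s)" using pos by (simp add: field_simps)
      moreover have "((1 / u * s + 1 / w * r) * (r + s) - (r * s) * (1 / u + 1 / w)) / ((r + s) * (r + s)) = (s / (r + s))\<^sup>2 / u + (r / (r + s))\<^sup>2 / w"
        for u w r s :: real
      proof -
        have "((a * s + b * r) * (r + s) - (r * s) * (a + b)) / ((r + s) * (r + s)) = (s / (r + s))\<^sup>2 * a + (r / (r + s))\<^sup>2 * b" for a b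
          by (simp add: power2_eq_square add_divide_distrib[symmetric] algebra_simps)
        from this[of "1 / u" "1 / w"] show ?thesis by (simp only: times_divide_eq_right mult_1_right)
      qed
      ultimately show ?thesis by (simp only:)
    qed
    finally have dt: "(?t has_real_derivative ?D) (at q)" .
    have d: "((\<lambda>q. \<Omega> (?t q) - ?\<gamma> * q) has_real_derivative (?t q powr (p - 1) * H (?t q)) * ?D - ?\<gamma>) (at q)"
      by (rule derivative_eq_intros DERIV_chain2[OF der\<Omega>[OF tpos] dt] refl | simp)+
    have "?\<gamma> \<le> ?t q powr (p - 1) * (F ?r powr ?\<theta> * G ?s powr (1 - ?\<theta>)) * ?D"
      by (rule ball_pointwise_inequality) (use pos p mF mG in auto)
    also have "\<dots> \<le> ?t q powr (p - 1) * H (?t q) * ?D"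
      using FGH[OF pos(1,2)] pos mF(2) mG(2) by (intro mult_right_mono mult_left_mono) auto
    finally show ?thesis using d by (intro exI conjI) auto
  qed
  have le: "?\<gamma> * (b - a) \<le> \<delta>" if ab: "0 < a" "a \<le> b" "b < 1" for a b
  proof -
    have "\<Omega> (?t a) - ?\<gamma> * a \<le> \<Omega> (?t b) - ?\<gamma> * b"
      by (rule DERIV_nonneg_imp_nondecreasing[OF ab(2)]) (use grow ab in auto)
    moreover have "0 \<le> \<Omega> (?t a)" using Q[of a] R[of a] ab bnd\<Omega>[of "?t a"] by simp
    moreover have "\<Omega> (?t b) \<le> \<delta>" using Q[of b] R[of b] ab bnd\<Omega>[of "?t b"] by simp
    ultimately show ?thesis by (simp add: algebra_simps)
  qed
  \<comment> \<open>Quantiles are available only for \<open>q\<close> strictly between 0 and 1, so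
    the growth estimate is used from \<open>e\<close> to \<open>1 - e\<close> and \<open>e\<close>
    tends to 0.\<close>
  have "((\<lambda>e. ?\<gamma> * ((1 - e) - e)) \<longlongrightarrow> ?\<gamma> * ((1 - 0) - 0)) (at_right 0)"
    by (intro tendsto_intros)
  moreover have "?\<gamma> * ((1 - e) - e) \<le> \<delta>" if "0 < e" "e < 1/2" for e
    using that by (intro le) auto
  then have "eventually (\<lambda>e. ?\<gamma> * ((1 - e) - e) \<le> \<delta>) (at_right 0)"
    unfolding eventually_at_right[OF zero_less_one] by (intro exI[of _ "1/2"]) simp
  ultimately have "?\<gamma> * ((1 - 0) - 0) \<le> \<delta>" by (intro tendsto_upperbound) auto
  then show ?thesis by simp
qed

section \<open>Gauges and convex bodies\<close>

text \<open>\<open>N\<close> is a norm: convexity makes it continuous, its positive minimum over the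
  Euclidean unit sphere bounds the unit ball, and the open set \<open>N < 1\<close> puts the origin
  in the interior.\<close>

lemma convex_body_unit_ball:
  fixes N :: "'a::euclidean_space \<Rightarrow> real"
  assumes tri: "\<And>x y. N (x + y) \<le> N x + N y" and hom: "\<And>c x. N (c *\<^sub>R x) = \<bar>c\<bar> * N x"
    and pos: "\<And>x. x \<noteq> 0 \<Longrightarrow> 0 < N x"
  shows "convex_body {x. N x \<le> 1}" "symmetric_set {x. N x \<le> 1}"
proof -
  have neg: "N (- x) = N x" for x using hom[of "- 1" x] by simp
  have N0: "N 0 = 0" using hom[of 0 0] by simp
  have conv: "convex_on UNIV N"
  proof (rule convex_onI)
    fix t :: real and x y assume "0 < t" "t < 1"
    then show "N ((1 - t) *\<^sub>R x + t *\<^sub>R y) \<le> (1 - t) * N x + t * N y"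
      using tri[of "(1 - t) *\<^sub>R x" "t *\<^sub>R y"] by (simp add: hom)
  qed simp
  then have cont: "continuous_on UNIV N" by (intro convex_on_continuous) auto
  have "\<exists>z\<in>sphere 0 1. \<forall>y\<in>sphere (0::'a) 1. N z \<le> N y"
    by (intro continuous_attains_inf) (auto intro: continuous_on_subset[OF cont])
  then obtain z where z: "norm z = 1" and min: "\<And>y. norm y = 1 \<Longrightarrow> N z \<le> N y" by auto
  have Nz: "0 < N z" using z by (intro pos) auto
  have lower: "N z * norm x \<le> N x" for x
  proof (cases "x = 0")
    case False
    then have "N z \<le> N ((1 / norm x) *\<^sub>R x)" by (intro min) simp
    then show ?thesis using False by (simp add: hom field_simps)
  qed (simp add: N0)
  let ?K = "{x. N x \<le> 1}"
  have "closed ?K" by (intro closed_Collect_le cont continuous_on_const)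
  moreover have "bounded ?K"
    unfolding bounded_iff
  proof (intro exI ballI)
    fix x assume "x \<in> ?K"
    then have "N z * norm x \<le> 1" using lower[of x] by simp
    then show "norm x \<le> 1 / N z" using Nz by (simp add: field_simps)
  qed
  moreover have "convex ?K"
    unfolding convex_alt
  proof (intro ballI allI impI, unfold mem_Collect_eq)
    fix x y and u :: real assume "N x \<le> 1" "N y \<le> 1" "0 \<le> u \<and> u \<le> 1"
    moreover from this have "(1 - u) * N x + u * N y \<le> (1 - u) * 1 + u * 1"
      by (intro add_mono mult_left_mono) auto
    ultimately show "N ((1 - u) *\<^sub>R x + u *\<^sub>R y) \<le> 1"
      using tri[of "(1 - u) *\<^sub>R x" "u *\<^sub>R y"] by (simp add: hom)
  qed
  moreover have "{x. N x < 1} \<subseteq> interior ?K"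
    by (rule interior_maximal) (auto intro!: open_Collect_less cont continuous_on_const)
  then have "0 \<in> interior ?K" using N0 by auto
  ultimately show "convex_body ?K" by (auto simp: convex_body_def compact_eq_bounded_closed)
  show "symmetric_set ?K"
    unfolding symmetric_set_def
  proof (intro equalityI subsetI)
    fix x assume "x \<in> ?K"
    then show "x \<in> uminus ` ?K" by (intro image_eqI[of _ _ "- x"]) (auto simp: neg)
  qed (auto simp: neg)
qed

text \<open>The bridge from radial functions to norms. The origin belongs to a radial set only
  through some unit vector with nonnegative radial value, hence its separate treatment.\<close>

lemma radial_set_inverse_gauge:
  fixes N :: "'a::euclidean_space \<Rightarrow> real"
  assumes \<rho>: "\<And>v. norm v = 1 \<Longrightarrow> \<rho> v = 1 / N v" and hom: "\<And>c x. N (c *\<^sub>R x) = \<bar>c\<bar> * N x"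
    and pos: "\<And>x. x \<noteq> 0 \<Longrightarrow> 0 < N x"
  shows "radial_set \<rho> = {x. N x \<le> 1}"
proof (intro equalityI subsetI)
  fix x assume "x \<in> radial_set \<rho>"
  then obtain r v where rv: "x = r *\<^sub>R v" "norm v = 1" "0 \<le> r" "r \<le> \<rho> v"
    by (auto simp: radial_set_def)
  have "0 < N v" using rv by (intro pos) auto
  then show "x \<in> {x. N x \<le> 1}" using rv by (simp add: hom \<rho> field_simps)
next
  fix x assume x: "x \<in> {x. N x \<le> 1}"
  have N0: "N 0 = 0" using hom[of 0 0] by simp
  show "x \<in> radial_set \<rho>"
  proof (cases "x = 0")
    case True
    obtain v :: 'a where v: "norm v = 1" using vector_choose_size[of 1] by auto
    then have "0 < N v" by (intro pos) auto
    then show ?thesis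
      unfolding radial_set_def mem_Collect_eq using True v
      by (intro exI[of _ 0] exI[of _ v]) (simp add: \<rho> less_imp_le)
  next
    case False
    let ?v = "(1 / norm x) *\<^sub>R x"
    have v: "norm ?v = 1" using False by simp
    have Nx: "0 < N x" by (rule pos[OF False])
    have "norm x \<le> \<rho> ?v" using x Nx by (simp add: \<rho>[OF v] hom False field_simps)
    then show ?thesis
      unfolding radial_set_def mem_Collect_eq using v False
      by (intro exI[of _ "norm x"] exI[of _ ?v]) simp
  qed
qed

section \<open>Radial moments as norms\<close>

definition radial_moment :: "real \<Rightarrow> ('a::euclidean_space \<Rightarrow> real) \<Rightarrow> 'a \<Rightarrow> ennreal" where
  "radial_moment p g x = (\<integral>\<^sup>+r. ennreal (indicator {0<..} r * (r powr (p - 1) * g (r *\<^sub>R x))) \<partial>lborel)"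

text \<open>The Minkowski functional of Ball's \<open>p\<close>-th mean body. At the origin the
  moment of a function with \<open>g 0 > 0\<close> diverges for positive \<open>p\<close>; the value
  0 corresponds to a negative power of infinity.\<close>

definition moment_gauge :: "real \<Rightarrow> ('a::euclidean_space \<Rightarrow> real) \<Rightarrow> 'a \<Rightarrow> real" where
  "moment_gauge p g x = (if x = 0 then 0 else enn2real (radial_moment p g x) powr (- 1 / p))"

context even_log_concave
begin

lemma radial_moment_scale:
  assumes "0 < s"
  shows "radial_moment p g (s *\<^sub>R x) = ennreal (s powr (- p)) * radial_moment p g x"
proof -
  have [measurable]: "(\<lambda>r. ennreal (indicator {0<..} r * (r powr (p - 1) * g (r *\<^sub>R x)))) \<in> borel_measurable borel" for x
    by measurable
  have "radial_moment p g (s *\<^sub>R x) = ennreal \<bar>1 / s\<bar> *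
      (\<integral>\<^sup>+r. ennreal (indicator {0<..} (0 + 1 / s * r) * ((0 + 1 / s * r) powr (p - 1) * g ((0 + 1 / s * r) *\<^sub>R s *\<^sub>R x))) \<partial>lborel)"
    unfolding radial_moment_def using assms by (intro nn_integral_real_affine) auto
  also have "(\<lambda>r. ennreal (indicator {0<..} (0 + 1 / s * r) * ((0 + 1 / s * r) powr (p - 1) * g ((0 + 1 / s * r) *\<^sub>R s *\<^sub>R x))))
     = (\<lambda>r. ennreal ((1 / s) powr (p - 1)) * ennreal (indicator {0<..} r * (r powr (p - 1) * g (r *\<^sub>R x))))"
    using assms by (auto simp: fun_eq_iff ennreal_mult[symmetric] g_nonneg indicator_def powr_divide zero_less_divide_iff)
  also have "(\<integral>\<^sup>+r. ennreal ((1 / s) powr (p - 1)) * ennreal (indicator {0<..} r * (r powr (p - 1) * g (r *\<^sub>R x))) \<partial>lborel)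
     = ennreal ((1 / s) powr (p - 1)) * radial_moment p g x"
    unfolding radial_moment_def by (rule nn_integral_cmult) measurable
  also have "ennreal \<bar>1 / s\<bar> * (ennreal ((1 / s) powr (p - 1)) * radial_moment p g x) = ennreal (\<bar>1 / s\<bar> * (1 / s) powr (p - 1)) * radial_moment p g x"
    by (simp only: ennreal_mult' abs_ge_zero mult.assoc)
  also have "\<bar>1 / s\<bar> * (1 / s) powr (p - 1) = s powr (- p)"
    using assms by (simp add: powr_divide powr_minus powr_diff field_simps)
  finally show ?thesis .
qed

lemma radial_moment_uminus: "radial_moment p g (- x) = radial_moment p g x"
  by (simp add: radial_moment_def g_even)

lemma radial_moment_pos: "0 < radial_moment p g x"
proof (rule ccontr)
  assume "\<not> ?thesis"
  then have "radial_moment p g x = 0" by simp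
  then have ae: "AE r in lborel. ennreal (indicator {0<..} r * (r powr (p - 1) * g (r *\<^sub>R x))) = 0"
    unfolding radial_moment_def by (subst (asm) nn_integral_0_iff_AE) auto
  obtain d where d: "0 < d" "\<And>x. norm x < d \<Longrightarrow> g 0 / 2 < g x" using g_ball by blast
  \<comment> \<open>The summand 1 keeps the radius meaningful for \<open>x = 0\<close>.\<close>
  define e where "e = d / (norm x + 1)"
  have e: "0 < e" using d(1) by (simp add: e_def add_nonneg_pos)
  have "AE r in lborel. r \<notin> {0<..<e}"
    using ae
  proof eventually_elim
    case (elim r)
    show ?case
    proof
      assume r: "r \<in> {0<..<e}"
      then have "r * norm x \<le> r * (norm x + 1)" by (intro mult_left_mono) auto
      also have "\<dots> < e * (norm x + 1)" using r by (intro mult_strict_right_mono) (auto simp: add_nonneg_pos)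
      also have "\<dots> = d" using add_nonneg_pos[of "norm x" 1] by (simp add: e_def)
      finally have "0 < g (r *\<^sub>R x)" using d(2)[of "r *\<^sub>R x"] r g_zero by simp
      then show False using elim r by (simp add: mult_le_0_iff)
    qed
  qed
  then have "emeasure lborel {0<..<e} = 0" by (subst (asm) AE_iff_null_sets[symmetric]) (auto simp: null_sets_def)
  then show False using e by simp
qed

text \<open>With weights \<open>s / (r + s)\<close> and \<open>r / (r + s)\<close> the points
  \<open>r x\<close> and \<open>s y\<close> combine to a point on the ray through
  \<open>x + y\<close>, at the harmonic parameter \<open>r s / (r + s)\<close>; this is the
  hypothesis of Ball's inequality. Finiteness is assumed only at the three points, so that marginals
  qualify.\<close>

lemma radial_moment_triangle:
  assumes p: "0 < p" and fin: "radial_moment p g x < top" "radial_moment p g y < top" "radial_moment p g (x + y) < top"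
  shows "enn2real (radial_moment p g (x + y)) powr (- 1 / p) \<le>
    enn2real (radial_moment p g x) powr (- 1 / p) + enn2real (radial_moment p g y) powr (- 1 / p)"
proof -
  let ?J = "\<lambda>x. enn2real (radial_moment p g x)"
  have pos: "0 < ?J x" if "radial_moment p g x < top" for x
    using that radial_moment_pos by (simp add: enn2real_positive_iff)
  have cont: "continuous_on {0<..} (\<lambda>r. g (r *\<^sub>R x))" for x
    by (rule continuous_on_compose2[OF g_cont]) (auto intro!: continuous_intros)
  \<comment> \<open>The set where \<open>g\<close> is positive is convex and contains the origin,
    hence star-shaped about it.\<close>
  have down: "0 < g (s *\<^sub>R x)" if "0 < s" "s \<le> r" "0 < g (r *\<^sub>R x)" for r s and x :: 'a
  proof -
    have "(1 - s / r) *\<^sub>R 0 + (s / r) *\<^sub>R (r *\<^sub>R x) \<in> {x. 0 < g x}"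
      using convex_log_concave_support[OF g_log_concave g_nonneg] that g_zero
      unfolding convex_alt by (auto simp del: scaleR_scaleR)
    then show ?thesis using that by simp
  qed
  have "(?J x powr (- 1 / p) + ?J y powr (- 1 / p)) powr (- p) \<le> ?J (x + y)"
  proof (rule ball_moment_inequality[OF p cont[of x] cont[of y] cont[of "x + y"]])
    fix r s :: real assume rs: "0 < r" "0 < s"
    let ?\<theta> = "s / (r + s)"
    have \<theta>: "?\<theta> \<in> {0..1}" using rs by simp
    have c1: "?\<theta> * r = r * s / (r + s)" by simp
    have c2: "(1 - ?\<theta>) * s = r * s / (r + s)" using rs by (simp add: field_simps)
    have "g (r *\<^sub>R x) powr ?\<theta> * g (s *\<^sub>R y) powr (1 - ?\<theta>) \<le> g (?\<theta> *\<^sub>R r *\<^sub>R x + (1 - ?\<theta>) *\<^sub>R s *\<^sub>R y)"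
      using g_log_concave \<theta> unfolding log_concave_def by blast
    also have "?\<theta> *\<^sub>R r *\<^sub>R x + (1 - ?\<theta>) *\<^sub>R s *\<^sub>R y = (r * s / (r + s)) *\<^sub>R (x + y)"
      by (simp only: scaleR_scaleR c1 c2 scaleR_add_right)
    finally show "g (r *\<^sub>R x) powr ?\<theta> * g (s *\<^sub>R y) powr (1 - ?\<theta>) \<le> g ((r * s / (r + s)) *\<^sub>R (x + y))" .
  qed (use fin pos down in \<open>auto simp: g_nonneg radial_moment_def[symmetric]\<close>)
  moreover have "0 < ?J x powr (- 1 / p) + ?J y powr (- 1 / p)"
    using pos[OF fin(1)] pos[OF fin(2)] by (intro add_pos_pos) auto
  ultimately have "?J (x + y) powr (- 1 / p) \<le> ((?J x powr (- 1 / p) + ?J y powr (- 1 / p)) powr (- p)) powr (- 1 / p)"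
    using p by (intro powr_mono2') auto
  also have "\<dots> = ?J x powr (- 1 / p) + ?J y powr (- 1 / p)"
    using p by (simp add: powr_powr)
  finally show ?thesis .
qed

lemma moment_gauge_pos:
  assumes "x \<noteq> 0" "radial_moment p g x < top"
  shows "0 < moment_gauge p g x"
proof -
  have "0 < enn2real (radial_moment p g x)" using assms radial_moment_pos[of p x] by (simp add: enn2real_positive_iff)
  then show ?thesis using assms by (simp add: moment_gauge_def)
qed

lemma moment_gauge_scale:
  assumes "0 < p"
  shows "moment_gauge p g (c *\<^sub>R x) = \<bar>c\<bar> * moment_gauge p g x"
proof (cases "c = 0 \<or> x = 0")
  case False
  have "radial_moment p g (c *\<^sub>R x) = radial_moment p g (\<bar>c\<bar> *\<^sub>R x)"
    using radial_moment_uminus[of p "c *\<^sub>R x"] by (cases "0 \<le> c") auto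
  also have "\<dots> = ennreal (\<bar>c\<bar> powr (- p)) * radial_moment p g x"
    using False by (intro radial_moment_scale) auto
  finally show ?thesis
    using False assms by (simp add: moment_gauge_def enn2real_mult powr_mult powr_powr)
qed (auto simp: moment_gauge_def)

lemma moment_gauge_triangle:
  assumes "0 < p" "\<And>x. x \<noteq> 0 \<Longrightarrow> radial_moment p g x < top"
  shows "moment_gauge p g (x + y) \<le> moment_gauge p g x + moment_gauge p g y"
proof (cases "x = 0 \<or> y = 0 \<or> x + y = 0")
  case True
  then show ?thesis by (auto simp: moment_gauge_def)
next
  case False
  then show ?thesis using radial_moment_triangle[OF assms(1), of x y] assms(2) by (simp add: moment_gauge_def)
qed

end

locale integrable_even_log_concave = even_log_concave +
  assumes g_finite: "(\<integral>\<^sup>+x. g x \<partial>lborel) < \<infinity>"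
begin

lemma radial_moment_finite:
  assumes p: "0 < p" and x: "x \<noteq> 0"
  shows "radial_moment p g x < top"
proof -
  obtain C c where C: "0 < C" "0 < c" "\<And>x. g x \<le> C * exp (- c * norm x)"
    using g_exponential_decay[OF g_finite] by blast
  \<comment> \<open>Rescaled so that the exponential bound along the ray reads
    \<open>C * exp (- r)\<close> and the moment is dominated by a Gamma integral.\<close>
  define y where "y = (1 / (c * norm x)) *\<^sub>R x"
  have y: "c * norm y = 1" using C(2) x by (simp add: y_def)
  have "radial_moment p g y \<le> (\<integral>\<^sup>+t. ennreal C * ennreal (indicator {0..} t * t powr (p - 1) / exp t) \<partial>lborel)"
    unfolding radial_moment_def
  proof (rule nn_integral_mono)
    fix r :: real
    have "g (r *\<^sub>R y) \<le> C * exp (- r)" if "0 < r"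
    proof -
      have "c * norm (r *\<^sub>R y) = r" using y that by (simp add: mult.left_commute)
      then show ?thesis using C(3)[of "r *\<^sub>R y"] by simp
    qed
    then have "indicator {0<..} r * (r powr (p - 1) * g (r *\<^sub>R y)) \<le> C * (indicator {0..} r * r powr (p - 1) / exp r)"
      using mult_left_mono[of "g (r *\<^sub>R y)" "C * exp (- r)" "r powr (p - 1)"]
      by (auto simp: indicator_def exp_minus field_simps)
    then show "ennreal (indicator {0<..} r * (r powr (p - 1) * g (r *\<^sub>R y))) \<le> ennreal C * ennreal (indicator {0..} r * r powr (p - 1) / exp r)"
      using C(1) by (simp add: ennreal_mult'[symmetric] ennreal_leI)
  qed
  also have "\<dots> = ennreal C * ennreal (Gamma p)"
    by (subst nn_integral_cmult) (auto simp: Gamma_conv_nn_integral_real[OF p])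
  finally have "radial_moment p g y < top" by (auto intro: le_less_trans simp: ennreal_mult_less_top)
  moreover have "x = (c * norm x) *\<^sub>R y" using C(2) x by (simp add: y_def)
  then have "radial_moment p g x = ennreal ((c * norm x) powr (- p)) * radial_moment p g y"
    using radial_moment_scale[of "c * norm x" p y] C(2) x by simp
  ultimately show ?thesis by (simp add: ennreal_mult_less_top)
qed

lemma moment_body:
  assumes "0 < p"
  shows "convex_body {x. moment_gauge p g x \<le> 1}" "symmetric_set {x. moment_gauge p g x \<le> 1}"
  using convex_body_unit_ball[of "moment_gauge p g"] moment_gauge_triangle[OF assms] moment_gauge_scale[OF assms]
    moment_gauge_pos radial_moment_finite[OF assms] by auto

end

section \<open>Hyperplane sections\<close>

lemma sum_abs_inner_le:
  assumes "orthonormal B"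
  shows "(\<Sum>b\<in>B. \<bar>x \<bullet> b\<bar>) \<le> real (card B) * norm x"
proof -
  have "(\<Sum>b\<in>B. \<bar>x \<bullet> b\<bar>) \<le> (\<Sum>b\<in>B. norm x)"
    using assms by (intro sum_mono) (metis Cauchy_Schwarz_ineq2 mult.right_neutral orthonormal_def)
  then show ?thesis by simp
qed

lemma norm_le_sum_abs_inner:
  assumes "orthonormal B" "x \<in> span B"
  shows "norm x \<le> (\<Sum>b\<in>B. \<bar>x \<bullet> b\<bar>)"
proof -
  have "norm x = norm (\<Sum>b\<in>B. (x \<bullet> b) *\<^sub>R b)" using span_orthonormal_expansion[OF assms] by simp
  also have "\<dots> \<le> (\<Sum>b\<in>B. norm ((x \<bullet> b) *\<^sub>R b))" by (rule norm_sum)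
  also have "\<dots> = (\<Sum>b\<in>B. \<bar>x \<bullet> b\<bar>)"
    using assms(1) by (intro sum.cong) (auto simp: orthonormal_def)
  finally show ?thesis .
qed

lemma nn_integral_exp_norm_finite:
  assumes B: "orthonormal B" and c: "0 < c"
  shows "(\<integral>\<^sup>+x. ennreal (exp (- c * norm x)) \<partial>coord_measure B) < \<infinity>"
proof -
  \<comment> \<open>The norm is at least the sum of the absolute coordinates divided by their
    number; adding 1 keeps \<open>k\<close> positive when \<open>B\<close> is empty.\<close>
  define k where "k = c / (real (card B) + 1)"
  have k: "0 < k" using c by (simp add: k_def add_nonneg_pos)
  have "ennreal (exp (- c * norm x)) \<le> (\<Prod>b\<in>B. ennreal (exp (- k * \<bar>x \<bullet> b\<bar>)))" for x
  proof -
    have "k * (\<Sum>b\<in>B. \<bar>x \<bullet> b\<bar>) \<le> k * (real (card B) * norm x)"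
      using k by (intro mult_left_mono sum_abs_inner_le[OF B]) auto
    also have "\<dots> \<le> k * ((real (card B) + 1) * norm x)" using k by (intro mult_left_mono mult_right_mono) auto
    also have "\<dots> = c * norm x" by (simp add: k_def)
    finally have "exp (- c * norm x) \<le> exp (\<Sum>b\<in>B. - k * \<bar>x \<bullet> b\<bar>)"
      by (simp add: sum_distrib_left sum_negf)
    also have "\<dots> = (\<Prod>b\<in>B. exp (- k * \<bar>x \<bullet> b\<bar>))" by (rule exp_sum[OF orthonormal_finite[OF B]])
    finally show ?thesis by (simp add: prod_ennreal ennreal_leI)
  qed
  then have "(\<integral>\<^sup>+x. ennreal (exp (- c * norm x)) \<partial>coord_measure B)
      \<le> (\<integral>\<^sup>+x. (\<Prod>b\<in>B. ennreal (exp (- k * \<bar>x \<bullet> b\<bar>))) \<partial>coord_measure B)"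
    by (intro nn_integral_mono)
  also have "\<dots> = (\<integral>\<^sup>+t. ennreal (exp (- k * \<bar>t\<bar>)) \<partial>lborel) ^ card B"
    by (rule nn_integral_coord_measure_prod[OF B]) measurable
  also have "\<dots> < \<infinity>" using nn_integral_exp_abs_finite[OF k] by (simp add: power_less_top_ennreal)
  finally show ?thesis .
qed

lemma (in even_log_concave) nn_integral_coord_measure_pos:
  assumes B: "orthonormal B"
  shows "0 < (\<integral>\<^sup>+x. g x \<partial>coord_measure B)"
proof -
  obtain d where d: "0 < d" "\<And>x. norm x < d \<Longrightarrow> g 0 / 2 < g x" using g_ball by blast
  \<comment> \<open>A cube of half side \<open>e\<close> lies inside the ball of radius
    \<open>d\<close>, because the norm is at most the sum of the absolute coordinates; adding 1
    makes the inclusion strict and covers empty \<open>B\<close>.\<close>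
  define e where "e = d / (real (card B) + 1)"
  have e: "0 < e" using d(1) by (simp add: e_def add_nonneg_pos)
  let ?P = "\<lambda>x. \<Prod>b\<in>B. indicator {- e..e} (x \<bullet> b) :: ennreal"
  have "0 < ennreal (g 0 / 2) * ennreal (2 * e) ^ card B"
    using g_zero e by (simp add: ennreal_zero_less_mult_iff ennreal_power)
  also have "ennreal (2 * e) ^ card B = (\<integral>\<^sup>+x. ?P x \<partial>coord_measure B)"
    using e by (subst nn_integral_coord_measure_prod[OF B]) auto
  also have "ennreal (g 0 / 2) * \<dots> = (\<integral>\<^sup>+x. ennreal (g 0 / 2) * ?P x \<partial>coord_measure B)"
    by (rule nn_integral_cmult[symmetric]) measurable
  also have "\<dots> \<le> (\<integral>\<^sup>+x. g x \<partial>coord_measure B)"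
  proof (rule nn_integral_mono_AE, use AE_coord_measure_span[of B] in eventually_elim)
    case (elim x)
    show "ennreal (g 0 / 2) * ?P x \<le> ennreal (g x)"
    proof (cases "\<forall>b\<in>B. x \<bullet> b \<in> {- e..e}")
      case True
      have "norm x \<le> (\<Sum>b\<in>B. \<bar>x \<bullet> b\<bar>)" by (rule norm_le_sum_abs_inner[OF B elim])
      also have "\<dots> \<le> (\<Sum>b\<in>B. e)" using True by (intro sum_mono) (auto simp: abs_le_iff minus_le_iff)
      also have "\<dots> < e * (real (card B) + 1)" using e by (simp add: algebra_simps)
      also have "\<dots> = d" by (simp add: e_def add_nonneg_pos)
      finally have "g 0 / 2 < g x" by (rule d(2))
      then show ?thesis using True by (simp add: ennreal_leI)
    next
      case False
      then have P0: "?P x = 0" using orthonormal_finite[OF B] by (auto simp: prod_zero_iff indicator_def)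
      show ?thesis unfolding P0 by simp
    qed
  qed
  finally show ?thesis .
qed

lemma (in integrable_even_log_concave) nn_integral_coord_measure_finite:
  assumes B: "orthonormal B"
  shows "(\<integral>\<^sup>+x. g x \<partial>coord_measure B) < \<infinity>"
proof -
  obtain C c where C: "0 < C" "0 < c" "\<And>x. g x \<le> C * exp (- c * norm x)"
    using g_exponential_decay[OF g_finite] by blast
  have "(\<integral>\<^sup>+x. g x \<partial>coord_measure B) \<le> (\<integral>\<^sup>+x. ennreal C * ennreal (exp (- c * norm x)) \<partial>coord_measure B)"
    using C by (intro nn_integral_mono) (simp add: ennreal_mult'[symmetric] ennreal_leI)
  also have "\<dots> = ennreal C * (\<integral>\<^sup>+x. ennreal (exp (- c * norm x)) \<partial>coord_measure B)"
    by (rule nn_integral_cmult) measurable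
  also have "\<dots> < \<infinity>" using nn_integral_exp_norm_finite[OF B C(2)] by (simp add: ennreal_mult_less_top)
  finally show ?thesis .
qed

section \<open>Marginals\<close>

text \<open>Kept as a function on the ambient space, constant along \<open>span D\<close>, so that
  the locale for even log-concave functions applies without coordinates on the complement.\<close>

definition marginal :: "('a::euclidean_space \<Rightarrow> real) \<Rightarrow> 'a set \<Rightarrow> 'a \<Rightarrow> real" where
  "marginal g D z = (LINT d|coord_measure D. g (z + d))"

context integrable_even_log_concave
begin

text \<open>Exponential decay and the triangle inequality: a shift of norm at most \<open>Z\<close>
  costs a factor \<open>exp (c * Z)\<close>. The majorant common to all bounded shifts is what
  dominated convergence needs for continuity of the marginal.\<close>

lemma integrable_translate:
  assumes D: "orthonormal D"
  shows "integrable (coord_measure D) (\<lambda>d. g (z + d))"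
    and "\<exists>w. integrable (coord_measure D) w \<and> (\<forall>z d. norm z \<le> Z \<longrightarrow> norm (g (z + d)) \<le> w d)"
proof -
  obtain C c where C: "0 < C" "0 < c" "\<And>x. g x \<le> C * exp (- c * norm x)"
    using g_exponential_decay[OF g_finite] by blast
  have int: "integrable (coord_measure D) (\<lambda>d. C * exp (c * Z) * exp (- c * norm d))" for Z
    using nn_integral_exp_norm_finite[OF D C(2)]
    by (intro integrable_mult_right integrableI_nonneg) auto
  have bound: "norm (g (z + d)) \<le> C * exp (c * Z) * exp (- c * norm d)" if "norm z \<le> Z" for z d Z
  proof -
    have "norm d \<le> norm (z + d) + norm z" using norm_triangle_sub[of d "- z"] by (simp add: add.commute)
    then have "norm d - Z \<le> norm (z + d)" using that by simp
    then have "c * (norm d - Z) \<le> c * norm (z + d)" using C(2) by (intro mult_left_mono) auto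
    then have "exp (- c * norm (z + d)) \<le> exp (c * Z + - c * norm d)" by (simp add: algebra_simps)
    then have "C * exp (- c * norm (z + d)) \<le> C * exp (c * Z + - c * norm d)" using C(1) by simp
    then have "g (z + d) \<le> C * exp (c * Z + - c * norm d)" using C(3)[of "z + d"] by simp
    then show ?thesis by (simp only: exp_add mult.assoc) (simp add: g_nonneg)
  qed
  show "\<exists>w. integrable (coord_measure D) w \<and> (\<forall>z d. norm z \<le> Z \<longrightarrow> norm (g (z + d)) \<le> w d)"
    using int bound by blast
  show "integrable (coord_measure D) (\<lambda>d. g (z + d))"
    by (rule Bochner_Integration.integrable_bound[OF int[of "norm z"]])
       (use bound[of z "norm z"] in \<open>auto intro!: AE_I2 order_trans[OF _ abs_ge_self]\<close>)
qed

lemma ennreal_marginal: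
  assumes D: "orthonormal D"
  shows "ennreal (marginal g D z) = (\<integral>\<^sup>+d. g (z + d) \<partial>coord_measure D)"
  unfolding marginal_def
  by (rule nn_integral_eq_integral[symmetric]) (auto intro: integrable_translate[OF D] simp: g_nonneg)

text \<open>Prekopa-Leindler along \<open>span D\<close>, since \<open>g (z + d)\<close> satisfies
  the midpoint inequality jointly in \<open>z\<close> and \<open>d\<close>.\<close>

lemma even_log_concave_marginal:
  assumes D: "orthonormal D"
  shows "even_log_concave (marginal g D)"
proof
  show nonneg: "0 \<le> marginal g D z" for z
    unfolding marginal_def by (intro integral_nonneg_AE) (simp add: g_nonneg)
  show cont: "continuous_on UNIV (marginal g D)"
    unfolding continuous_on_sequentially
  proof (intro allI ballI impI, elim conjE)
    fix u :: "nat \<Rightarrow> 'a" and x assume u: "u \<longlonglongrightarrow> x"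
    then obtain Z where Z: "\<And>k. norm (u k) \<le> Z"
      using convergent_imp_bounded[OF u] by (auto simp: bounded_iff)
    obtain w where w: "integrable (coord_measure D) w" "\<And>z d. norm z \<le> Z \<Longrightarrow> norm (g (z + d)) \<le> w d"
      using integrable_translate(2)[OF D, of Z] by blast
    have "(\<lambda>k. LINT d|coord_measure D. g (u k + d)) \<longlonglongrightarrow> (LINT d|coord_measure D. g (x + d))"
    proof (rule integral_dominated_convergence[OF _ _ w(1)])
      show "AE d in coord_measure D. norm (g (u k + d)) \<le> w d" for k
        using w(2)[OF Z] by simp
      show "AE d in coord_measure D. (\<lambda>k. g (u k + d)) \<longlonglongrightarrow> g (x + d)"
        using g_cont u
        by (intro AE_I2 isCont_tendsto_compose[where g=g]) (auto simp: continuous_on_eq_continuous_at intro!: tendsto_intros)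
    qed measurable
    then show "(marginal g D \<circ> u) \<longlonglongrightarrow> marginal g D x" by (simp add: marginal_def o_def)
  qed
  show "marginal g D (- z) = marginal g D z" for z
  proof -
    have "ennreal (marginal g D (- z)) = (\<integral>\<^sup>+d. g (- z + d) \<partial>coord_measure D)" by (rule ennreal_marginal[OF D])
    also have "\<dots> = (\<integral>\<^sup>+d. g (- z - d) \<partial>coord_measure D)"
      using nn_integral_coord_measure_affine[OF D, of 0 "- 1" "\<lambda>d. ennreal (g (- z + d))"] by (simp add: span_zero)
    also have "\<dots> = (\<integral>\<^sup>+d. g (z + d) \<partial>coord_measure D)"
      by (intro nn_integral_cong) (metis g_even minus_add_distrib add_uminus_conv_diff)
    also have "\<dots> = ennreal (marginal g D z)" by (rule ennreal_marginal[OF D, symmetric])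
    finally show ?thesis by (simp add: nonneg)
  qed
  have "marginal g D x * marginal g D y \<le> (marginal g D ((1/2) *\<^sub>R (x + y)))\<^sup>2" for x y
  proof -
    let ?n = "(1/2) *\<^sub>R (x + y)"
    have "ennreal (marginal g D x) * ennreal (marginal g D y) \<le> ennreal (marginal g D ?n) * ennreal (marginal g D ?n)"
      unfolding ennreal_marginal[OF D]
    proof (rule prekopa_leindler_coord_measure[OF D])
      fix u v :: 'a
      have "g (x + u) * g (y + v) \<le> (g ((1/2) *\<^sub>R ((x + u) + (y + v))))\<^sup>2"
        by (rule log_concave_midpoint[OF g_log_concave g_nonneg])
      also have "(1/2) *\<^sub>R ((x + u) + (y + v)) = ?n + (1/2) *\<^sub>R (u + v)" by (simp add: algebra_simps)
      finally show "ennreal (g (x + u)) * ennreal (g (y + v)) \<le> ennreal (g (?n + (1/2) *\<^sub>R (u + v))) * ennreal (g (?n + (1/2) *\<^sub>R (u + v)))"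
        by (simp add: ennreal_mult[symmetric] g_nonneg ennreal_leI power2_eq_square)
    qed measurable
    then show ?thesis by (simp add: ennreal_mult[symmetric] nonneg power2_eq_square)
  qed
  then show "log_concave (marginal g D)" by (rule continuous_midpoint_log_concave[OF cont nonneg])
  have "0 < ennreal (marginal g D 0)"
    unfolding ennreal_marginal[OF D] using nn_integral_coord_measure_pos[OF D] by simp
  then show "0 < marginal g D 0" by simp
qed

end

section \<open>Hyperplane integrals and Busemann's theorem\<close>

text \<open>Takes the very basis that \<open>flat_lebesgue\<close> takes, so that the two are
  related by unfolding.\<close>

definition hyperplane_measure :: "'a::euclidean_space \<Rightarrow> 'a measure" where
  "hyperplane_measure v = coord_measure (SOME B. orthonormal_basis_of ({v}\<^sup>\<bottom>) B)"

lemma orthonormal_basis_of_iff: "orthonormal_basis_of S B \<longleftrightarrow> orthonormal B \<and> span B = S"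
  by (auto simp: orthonormal_basis_of_def orthonormal_def)

lemma hyperplane_basis:
  obtains B where "orthonormal B" "span B = {v}\<^sup>\<bottom>" "hyperplane_measure v = coord_measure B"
proof -
  let ?B = "SOME B. orthonormal_basis_of ({v}\<^sup>\<bottom>) B"
  have "orthonormal_basis_of ({v}\<^sup>\<bottom>) ?B"
    by (rule someI_ex) (intro ex_orthonormal_basis_of subspace_orthogonal_comp)
  then show thesis by (intro that[of ?B]) (auto simp: orthonormal_basis_of_iff hyperplane_measure_def)
qed

text \<open>Frees the measure from the chosen basis; Busemann's argument inserts a basis that
  contains a rotated vector.\<close>

lemma hyperplane_measure_eq:
  assumes "orthonormal B" "span B = {v}\<^sup>\<bottom>"
  shows "hyperplane_measure v = coord_measure B"
proof -
  obtain C where "orthonormal C" "span C = {v}\<^sup>\<bottom>" "hyperplane_measure v = coord_measure C"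
    by (rule hyperplane_basis)
  then show ?thesis using coord_measure_eq[of C B] assms by simp
qed

lemma hyperplane_measure_scale:
  assumes "c \<noteq> 0"
  shows "hyperplane_measure (c *\<^sub>R v) = hyperplane_measure v"
proof -
  have "{c *\<^sub>R v}\<^sup>\<bottom> = {v}\<^sup>\<bottom>" using assms by (auto simp: orthogonal_comp_def orthogonal_def)
  then show ?thesis by (simp add: hyperplane_measure_def)
qed

text \<open>The Minkowski functional of the intersection body of \<open>g\<close>: the hyperplane
  depends only on the direction of \<open>v\<close>, and the factor \<open>norm v\<close> supplies
  homogeneity.\<close>

definition section_gauge :: "('a::euclidean_space \<Rightarrow> real) \<Rightarrow> 'a \<Rightarrow> real" where
  "section_gauge g v = norm v / enn2real (\<integral>\<^sup>+x. g x \<partial>hyperplane_measure v)"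

context integrable_even_log_concave
begin

lemma hyperplane_integral_pos_finite:
  "0 < (\<integral>\<^sup>+x. g x \<partial>hyperplane_measure v)" "(\<integral>\<^sup>+x. g x \<partial>hyperplane_measure v) < top"
  by (rule hyperplane_basis[of v]; use nn_integral_coord_measure_pos nn_integral_coord_measure_finite in simp)+

lemma section_gauge_pos:
  assumes "v \<noteq> 0"
  shows "0 < section_gauge g v"
  unfolding section_gauge_def using assms hyperplane_integral_pos_finite[of v]
  by (intro divide_pos_pos) (simp_all add: enn2real_positive_iff)

lemma section_gauge_scale: "section_gauge g (c *\<^sub>R v) = \<bar>c\<bar> * section_gauge g v"
  by (cases "c = 0") (auto simp: section_gauge_def hyperplane_measure_scale)

text \<open>Busemann: split \<open>{x}\<^sup>\<bottom>\<close> as the line through the rotation of \<open>x\<close> by a right angle in the plane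
  plus the orthogonal complement of the plane, and apply Ball's inequality with exponent 1 to the
  marginal on the plane.\<close>
lemma hyperplane_integral_eq_moment:
  fixes u1 u2 :: 'a
  assumes D: "orthonormal D" "span D = {u1, u2}\<^sup>\<bottom>"
    and u: "u1 \<bullet> u1 = 1" "u2 \<bullet> u2 = 1" "u1 \<bullet> u2 = 0" and ab: "a \<noteq> 0 \<or> b \<noteq> 0"
  defines "x \<equiv> a *\<^sub>R u1 + b *\<^sub>R u2" and "y \<equiv> (- b) *\<^sub>R u1 + a *\<^sub>R u2"
  shows "(\<integral>\<^sup>+z. g z \<partial>hyperplane_measure x) = 2 * ennreal (norm x) * radial_moment 1 (marginal g D) y"
proof -
  interpret m: even_log_concave "marginal g D" by (rule even_log_concave_marginal[OF D(1)])
  have u': "u2 \<bullet> u1 = 0" using u by (simp add: inner_commute)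
  have xx: "x \<bullet> x = a\<^sup>2 + b\<^sup>2" and yy: "y \<bullet> y = a\<^sup>2 + b\<^sup>2" and xy: "x \<bullet> y = 0"
    using u u' by (simp_all add: x_def y_def inner_add_left inner_add_right inner_diff_left inner_diff_right power2_eq_square)
  define n where "n = norm x"
  have n2: "n * n = a\<^sup>2 + b\<^sup>2" using xx by (simp add: n_def power2_norm_eq_inner[symmetric] power2_eq_square)
  have "a\<^sup>2 + b\<^sup>2 > 0" using ab by (simp add: sum_power2_gt_zero_iff)
  then have n: "n > 0" using n2 by (cases "n = 0") (auto simp: n_def)
  have ny: "norm y = n" using xx yy by (simp add: n_def norm_eq_sqrt_inner)
  define e where "e = (1 / n) *\<^sub>R y"
  have ne: "norm e = 1" using n ny by (simp add: e_def)
  have D_orth: "d \<bullet> u1 = 0" "d \<bullet> u2 = 0" if "d \<in> span D" for d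
    using that unfolding D(2) by (auto simp: orthogonal_comp_def orthogonal_def inner_commute)
  have D_y: "d \<bullet> y = 0" "d \<bullet> x = 0" if "d \<in> span D" for d
    using D_orth[OF that] by (simp_all add: x_def y_def inner_add_right inner_diff_right)
  have D_e: "d \<bullet> e = 0" if "d \<in> span D" for d using D_y[OF that] by (simp add: e_def)
  have e_notin: "e \<notin> D"
    using D_e[OF span_base, of e] ne by (auto simp: norm_eq_1)
  have ON: "orthonormal (insert e D)"
    using D(1) ne D_e[OF span_base] unfolding orthonormal_def
    by (auto simp: pairwise_insert orthogonal_def inner_commute)
  have "span (insert e D) = {x}\<^sup>\<bottom>"
  proof (intro equalityI span_minimal subspace_orthogonal_comp subsetI)
    fix d assume "d \<in> insert e D"
    then show "d \<in> {x}\<^sup>\<bottom>"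
      using xy D_y(2)[OF span_base, of d] by (auto simp: orthogonal_comp_def orthogonal_def e_def inner_commute)
  next
    fix z assume "z \<in> {x}\<^sup>\<bottom>"
    then have zx: "z \<bullet> x = 0" by (auto simp: orthogonal_comp_def orthogonal_def inner_commute)
    define w where "w = z - (z \<bullet> e) *\<^sub>R e"
    have "e \<bullet> x = 0" using xy by (simp add: e_def inner_commute)
    then have wx: "w \<bullet> x = 0" using zx by (simp add: w_def inner_diff_left)
    have "w \<bullet> e = 0" using ne by (simp add: w_def inner_diff_left norm_eq_1)
    then have wy: "w \<bullet> y = 0" using n by (simp add: e_def)
    \<comment> \<open>Inverting the rotation: orthogonality to \<open>x\<close> and \<open>y\<close>
      is orthogonality to \<open>u1\<close> and \<open>u2\<close>.\<close>
    have "(a\<^sup>2 + b\<^sup>2) *\<^sub>R u1 = a *\<^sub>R x - b *\<^sub>R y" "(a\<^sup>2 + b\<^sup>2) *\<^sub>R u2 = b *\<^sub>R x + a *\<^sub>R y"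
      by (simp_all add: x_def y_def algebra_simps power2_eq_square)
    then have "w \<bullet> ((a\<^sup>2 + b\<^sup>2) *\<^sub>R u1) = 0" "w \<bullet> ((a\<^sup>2 + b\<^sup>2) *\<^sub>R u2) = 0"
      using wx wy by (simp_all add: inner_diff_right inner_add_right)
    then have "w \<bullet> u1 = 0" "w \<bullet> u2 = 0" using ab by auto
    then have "w \<in> span D" unfolding D(2) by (auto simp: orthogonal_comp_def orthogonal_def inner_commute)
    then have "w \<in> span (insert e D)" using span_mono[of D "insert e D"] by auto
    moreover have "(z \<bullet> e) *\<^sub>R e \<in> span (insert e D)" by (intro span_scale span_base) auto
    ultimately have "w + (z \<bullet> e) *\<^sub>R e \<in> span (insert e D)" by (rule span_add)
    then show "z \<in> span (insert e D)" by (simp add: w_def)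
  qed
  then have "(\<integral>\<^sup>+z. g z \<partial>hyperplane_measure x) = (\<integral>\<^sup>+z. g z \<partial>coord_measure (insert e D))"
    using hyperplane_measure_eq[OF ON] by simp
  also have "\<dots> = (\<integral>\<^sup>+t. \<integral>\<^sup>+z. g (t *\<^sub>R e + z) \<partial>coord_measure D \<partial>lborel)"
    by (rule nn_integral_coord_measure_insert[OF ON e_notin]) measurable
  also have "\<dots> = (\<integral>\<^sup>+t. marginal g D (t *\<^sub>R e) \<partial>lborel)"
    by (simp only: ennreal_marginal[OF D(1)])
  also have "\<dots> = 2 * radial_moment 1 (marginal g D) e"
  proof -
    let ?h = "\<lambda>t. ennreal (indicator {0<..} t * marginal g D (t *\<^sub>R e))"
    \<comment> \<open>Evenness folds the line onto a half line, which gives the factor 2; the point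
      \<open>t = 0\<close>, missed by both halves, is null.\<close>
    have "(\<integral>\<^sup>+t. marginal g D (t *\<^sub>R e) \<partial>lborel) = (\<integral>\<^sup>+t. ?h t + ?h (0 + - 1 * t) \<partial>lborel)"
    proof (rule nn_integral_cong_AE, use AE_lborel_singleton[of 0] in eventually_elim)
      case (elim t)
      then show ?case using m.g_even[of "t *\<^sub>R e"] by (cases "0 < t") (auto simp: indicator_def)
    qed
    also have "\<dots> = (\<integral>\<^sup>+t. ?h t \<partial>lborel) + (\<integral>\<^sup>+t. ?h (0 + - 1 * t) \<partial>lborel)"
      by (rule nn_integral_add) measurable
    also have "(\<integral>\<^sup>+t. ?h (0 + - 1 * t) \<partial>lborel) = (\<integral>\<^sup>+t. ?h t \<partial>lborel)"
      by (subst nn_integral_real_affine[of ?h "- 1" 0]) auto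
    also have "(\<integral>\<^sup>+t. ?h t \<partial>lborel) = radial_moment 1 (marginal g D) e"
      unfolding radial_moment_def by (intro nn_integral_cong) (auto simp: indicator_def)
    finally show ?thesis by (simp add: mult_2)
  qed
  also have "radial_moment 1 (marginal g D) e = ennreal ((1 / n) powr (- 1)) * radial_moment 1 (marginal g D) y"
    unfolding e_def by (rule m.radial_moment_scale) (use n in simp)
  also have "(1 / n) powr (- 1) = norm x" using n by (simp add: powr_minus n_def)
  finally show ?thesis by (simp only: mult.assoc)
qed

text \<open>In the plane of \<open>v\<close> and \<open>w\<close> the gauge is half the first-moment
  gauge of the marginal composed with a rotation by a right angle. The rotation is linear, so the
  triangle inequality carries over. Parallel vectors span no plane and are settled by
  homogeneity.\<close>

lemma section_gauge_triangle: "section_gauge g (v + w) \<le> section_gauge g v + section_gauge g w"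
proof (cases "w \<in> span {v}")
  case True
  then obtain c where w: "w = c *\<^sub>R v" by (auto simp: span_singleton)
  have "v + w = (1 + c) *\<^sub>R v" by (simp add: w algebra_simps)
  then have "section_gauge g (v + w) = \<bar>1 + c\<bar> * section_gauge g v" by (simp only: section_gauge_scale)
  moreover have "\<bar>1 + c\<bar> * section_gauge g v \<le> (1 + \<bar>c\<bar>) * section_gauge g v"
    by (intro mult_right_mono) (auto simp: section_gauge_def)
  ultimately show ?thesis by (simp add: section_gauge_scale[of c v, folded w] algebra_simps)
next
  case w: False
  show ?thesis
  proof (cases "v = 0")
    case True
    then show ?thesis by (simp add: section_gauge_def)
  next
    case v: False
    \<comment> \<open>Gram-Schmidt, so that \<open>v\<close> has coordinates \<open>norm v\<close>
      and 0, and \<open>w\<close> has coordinates \<open>w \<bullet> u1\<close> and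
      \<open>norm w'\<close>.\<close>
    define u1 where "u1 = (1 / norm v) *\<^sub>R v"
    define w' where "w' = w - (w \<bullet> u1) *\<^sub>R u1"
    define u2 where "u2 = (1 / norm w') *\<^sub>R w'"
    have "norm u1 = 1" using v by (simp add: u1_def)
    then have u1: "u1 \<bullet> u1 = 1" by (simp add: norm_eq_1)
    have "w' \<noteq> 0"
    proof
      assume "w' = 0"
      then have "w = (w \<bullet> u1 / norm v) *\<^sub>R v" by (simp add: w'_def u1_def)
      then have "w \<in> span {v}" by (metis span_base span_scale singletonI)
      then show False using w by simp
    qed
    then have "norm u2 = 1" by (simp add: u2_def)
    then have u2: "u2 \<bullet> u2 = 1" by (simp add: norm_eq_1)
    have u12: "u1 \<bullet> u2 = 0" using u1 by (simp add: u2_def w'_def inner_diff_right inner_commute[of u1 w])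
    obtain D where D: "orthonormal D" "span D = {u1, u2}\<^sup>\<bottom>"
      using ex_orthonormal_basis_of[OF subspace_orthogonal_comp] by (auto simp: orthonormal_basis_of_iff)
    interpret m: even_log_concave "marginal g D" by (rule even_log_concave_marginal[OF D(1)])
    let ?J = "radial_moment 1 (marginal g D)"
    let ?x = "\<lambda>a b. a *\<^sub>R u1 + b *\<^sub>R u2" and ?y = "\<lambda>a b. (- b) *\<^sub>R u1 + a *\<^sub>R u2"
    have key: "?J (?y a b) < top \<and> section_gauge g (?x a b) = (1 / 2) * enn2real (?J (?y a b)) powr (- 1)"
      if ab: "a \<noteq> 0 \<or> b \<noteq> 0" for a b
    proof -
      have eq: "(\<integral>\<^sup>+z. g z \<partial>hyperplane_measure (?x a b)) = 2 * ennreal (norm (?x a b)) * ?J (?y a b)"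
        by (rule hyperplane_integral_eq_moment[OF D u1 u2 u12 ab])
      have nz: "norm (?x a b) \<noteq> 0"
      proof
        assume "norm (?x a b) = 0"
        then have "?x a b \<bullet> u1 = 0" "?x a b \<bullet> u2 = 0" by auto
        then show False using ab u1 u2 u12 by (auto simp: inner_add_left inner_commute[of u2 u1])
      qed
      have "2 * ennreal (norm (?x a b)) * ?J (?y a b) < top"
        unfolding eq[symmetric] by (rule hyperplane_integral_pos_finite)
      then have fin: "?J (?y a b) < top"
        using nz by (auto simp: ennreal_mult_less_top)
      have "enn2real (2 * ennreal (norm (?x a b)) * ?J (?y a b)) = 2 * norm (?x a b) * enn2real (?J (?y a b))"
        by (simp add: enn2real_mult)
      then have "section_gauge g (?x a b) = 1 / (2 * enn2real (?J (?y a b)))"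
        unfolding section_gauge_def eq using nz by simp
      then show ?thesis using fin by (simp add: powr_minus divide_simps)
    qed
    have ve: "v = ?x (norm v) 0" using v by (simp add: u1_def)
    have we: "w = ?x (w \<bullet> u1) (norm w')" using \<open>w' \<noteq> 0\<close> by (simp add: u2_def w'_def)
    have vwe: "v + w = ?x (norm v + w \<bullet> u1) (norm w')"
      using ve we by (simp add: scaleR_add_left add.assoc)
    note kv = key[of "norm v" 0] and kw = key[of "w \<bullet> u1" "norm w'"] and kvw = key[of "norm v + w \<bullet> u1" "norm w'"]
    have ysum: "?y (norm v) 0 + ?y (w \<bullet> u1) (norm w') = ?y (norm v + w \<bullet> u1) (norm w')"
      by (simp add: algebra_simps)
    have "enn2real (?J (?y (norm v) 0 + ?y (w \<bullet> u1) (norm w'))) powr (- 1 / 1) \<le>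
        enn2real (?J (?y (norm v) 0)) powr (- 1 / 1) + enn2real (?J (?y (w \<bullet> u1) (norm w'))) powr (- 1 / 1)"
    proof (rule m.radial_moment_triangle)
      show "?J (?y (norm v) 0) < top" using kv v by auto
      show "?J (?y (w \<bullet> u1) (norm w')) < top" using kw \<open>w' \<noteq> 0\<close> by auto
      show "?J (?y (norm v) 0 + ?y (w \<bullet> u1) (norm w')) < top" unfolding ysum using kvw \<open>w' \<noteq> 0\<close> by auto
    qed simp
    then show ?thesis
      unfolding ysum using kv kw kvw v \<open>w' \<noteq> 0\<close> ve[symmetric] we[symmetric] vwe[symmetric] by simp
  qed
qed

lemma section_body:
  "convex_body {x. section_gauge g x \<le> 1}" "symmetric_set {x. section_gauge g x \<le> 1}"
  using convex_body_unit_ball[of "section_gauge g"] section_gauge_triangle section_gauge_scale section_gauge_pos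
  by auto

end

section \<open>Radial functions of the bodies\<close>

text \<open>Origin of the constant \<open>ln 2\<close>: the \<open>s\<close> for which
  \<open>y / s\<close> has norm between 1 and 2 fill the interval from \<open>norm y / 2\<close> to
  \<open>norm y\<close>, on which \<open>1 / s\<close> is integrated.\<close>

lemma nn_integral_inverse_Icc:
  fixes a :: real
  assumes "0 < a"
  shows "(\<integral>\<^sup>+s. ennreal (inverse s) * indicator {a / 2..a} s \<partial>lborel) = ennreal (ln 2)"
  by (subst nn_integral_FTC_Icc[where F=ln])
     (use assms in \<open>auto intro!: derivative_eq_intros simp: ln_div divide_simps\<close>)

lemma nn_integral_power_Icc:
  fixes a :: real
  assumes "0 \<le> a" "0 < k"
  shows "(\<integral>\<^sup>+s. ennreal (s ^ (k - 1)) * indicator {0..a} s \<partial>lborel) = ennreal (a ^ k / k)"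
  by (subst nn_integral_FTC_Icc[where F="\<lambda>s. s ^ k / k"])
     (use assms in \<open>auto intro!: derivative_eq_intros simp: zero_power\<close>)

text \<open>Doubling fixes the origin but multiplies measure by \<open>2 ^ card B > 1\<close>; a
  finite measure invariant under that factor is 0.\<close>

lemma emeasure_coord_measure_zero:
  assumes B: "orthonormal B" and "0 < card B"
  shows "emeasure (coord_measure B) {0} = 0"
proof -
  let ?e = "emeasure (coord_measure B) {0}"
  have "?e = (\<integral>\<^sup>+x. indicator {0} x \<partial>coord_measure B)" by simp
  also have "\<dots> \<le> (\<integral>\<^sup>+x. ennreal (exp (- 1 * norm x)) \<partial>coord_measure B)"
    by (intro nn_integral_mono) (auto simp: indicator_def)
  also have "\<dots> < \<infinity>" by (rule nn_integral_exp_norm_finite[OF B]) simp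
  finally have fin: "?e < top" by simp
  have "?e = ennreal (\<bar>2\<bar> ^ card B) * (\<integral>\<^sup>+x. indicator {0} (0 + 2 *\<^sub>R x) \<partial>coord_measure B)"
    using nn_integral_coord_measure_affine[OF B span_zero, of 2 "indicator {0}"] by simp
  also have "(\<lambda>x. indicator {0} (0 + 2 *\<^sub>R x)) = (indicator {0} :: 'a \<Rightarrow> ennreal)"
    by (auto simp: fun_eq_iff indicator_def)
  finally have eq: "?e = ennreal (2 ^ card B) * ?e" by simp
  obtain r where r: "?e = ennreal r" "0 \<le> r" using fin by (cases ?e) auto
  have "r = 2 ^ card B * r" using eq r by (simp add: ennreal_mult[symmetric])
  moreover have "(2::real) ^ card B > 1" using assms(2) by simp
  ultimately have "r = 0" by simp
  then show ?thesis using r by simp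
qed

text \<open>A substitute for polar coordinates: integrating the radial integrals over the shell
  \<open>1 \<le> norm x \<le> 2\<close> instead of the sphere turns them into the full integral by Tonelli and
  the scaling of the measure.\<close>
lemma nn_integral_shell:
  fixes \<phi> :: "'a::euclidean_space \<Rightarrow> ennreal"
  assumes B: "orthonormal B" "0 < card B" and [measurable]: "\<phi> \<in> borel_measurable borel"
  shows "(\<integral>\<^sup>+x. indicator {x. 1 \<le> norm x \<and> norm x \<le> 2} x *
      (\<integral>\<^sup>+s. ennreal (indicator {0<..} s * s powr (real (card B) - 1)) * \<phi> (s *\<^sub>R x) \<partial>lborel) \<partial>coord_measure B)
    = ennreal (ln 2) * (\<integral>\<^sup>+x. \<phi> x \<partial>coord_measure B)"
proof -
  interpret B: sigma_finite_measure "coord_measure B" by (rule sigma_finite_coord_measure[OF B(1)])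
  interpret P: pair_sigma_finite "coord_measure B" lborel ..
  let ?\<mu> = "coord_measure B" and ?k = "card B"
  let ?w = "\<lambda>s::real. ennreal (indicator {0<..} s * s powr (real ?k - 1))"
  let ?S = "\<lambda>x::'a. indicator {x. 1 \<le> norm x \<and> norm x \<le> 2} x :: ennreal"
  \<comment> \<open>The substitution \<open>y = s x\<close> multiplies volume by
    \<open>s ^ card B\<close>, so the weight \<open>s powr (card B - 1)\<close> becomes
    \<open>1 / s\<close>.\<close>
  have inner: "?w s * (\<integral>\<^sup>+x. ?S x * \<phi> (s *\<^sub>R x) \<partial>?\<mu>) =
      (\<integral>\<^sup>+y. ennreal (indicator {0<..} s * inverse s) * (indicator {y. s \<le> norm y \<and> norm y \<le> 2 * s} y * \<phi> y) \<partial>?\<mu>)" for s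
  proof (cases "0 < s")
    case True
    let ?\<Phi> = "\<lambda>y. indicator {y. s \<le> norm y \<and> norm y \<le> 2 * s} y * \<phi> y"
    have "(\<integral>\<^sup>+y. ?\<Phi> y \<partial>?\<mu>) = ennreal (\<bar>s\<bar> ^ ?k) * (\<integral>\<^sup>+x. ?\<Phi> (0 + s *\<^sub>R x) \<partial>?\<mu>)"
      by (rule nn_integral_coord_measure_affine[OF B(1) span_zero]) (use True in auto)
    also have "(\<lambda>x. ?\<Phi> (0 + s *\<^sub>R x)) = (\<lambda>x. ?S x * \<phi> (s *\<^sub>R x))"
      using True by (auto simp: fun_eq_iff indicator_def)
    finally have "ennreal (inverse s) * (\<integral>\<^sup>+y. ?\<Phi> y \<partial>?\<mu>) =
        (ennreal (inverse s) * ennreal (\<bar>s\<bar> ^ ?k)) * (\<integral>\<^sup>+x. ?S x * \<phi> (s *\<^sub>R x) \<partial>?\<mu>)"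
      by (simp only: mult.assoc)
    also have "ennreal (inverse s) * ennreal (\<bar>s\<bar> ^ ?k) = ?w s"
      using True by (simp add: ennreal_mult[symmetric] powr_diff powr_realpow field_simps)
    finally show ?thesis using True by (subst nn_integral_cmult) auto
  qed simp
  have "(\<integral>\<^sup>+x. ?S x * (\<integral>\<^sup>+s. ?w s * \<phi> (s *\<^sub>R x) \<partial>lborel) \<partial>?\<mu>) = (\<integral>\<^sup>+x. \<integral>\<^sup>+s. ?w s * (?S x * \<phi> (s *\<^sub>R x)) \<partial>lborel \<partial>?\<mu>)"
    by (intro nn_integral_cong, subst nn_integral_cmult[symmetric]) (auto simp: ac_simps)
  also have "\<dots> = (\<integral>\<^sup>+s. \<integral>\<^sup>+x. ?w s * (?S x * \<phi> (s *\<^sub>R x)) \<partial>?\<mu> \<partial>lborel)"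
    by (rule P.Fubini'[symmetric]) measurable
  also have "\<dots> = (\<integral>\<^sup>+s. \<integral>\<^sup>+y. ennreal (indicator {0<..} s * inverse s) * (indicator {y. s \<le> norm y \<and> norm y \<le> 2 * s} y * \<phi> y) \<partial>?\<mu> \<partial>lborel)"
    unfolding inner[symmetric] by (intro nn_integral_cong nn_integral_cmult) measurable
  also have "\<dots> = (\<integral>\<^sup>+y. \<integral>\<^sup>+s. ennreal (indicator {0<..} s * inverse s) * (indicator {z. snd z \<le> norm (fst z) \<and> norm (fst z) \<le> 2 * snd z} (y, s) * \<phi> y) \<partial>lborel \<partial>?\<mu>)"
    by (subst P.Fubini'[symmetric]) (auto simp: indicator_def intro!: nn_integral_cong)
  also have "\<dots> = (\<integral>\<^sup>+y. ennreal (ln 2) * \<phi> y \<partial>?\<mu>)"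
  proof (rule nn_integral_cong_AE)
    have "AE y in ?\<mu>. y \<noteq> 0"
      by (rule AE_I[of _ _ "{0}"]) (use emeasure_coord_measure_zero[OF B] in auto)
    then show "AE y in ?\<mu>. (\<integral>\<^sup>+s. ennreal (indicator {0<..} s * inverse s) * (indicator {z. snd z \<le> norm (fst z) \<and> norm (fst z) \<le> 2 * snd z} (y, s) * \<phi> y) \<partial>lborel) = ennreal (ln 2) * \<phi> y"
    proof eventually_elim
      case (elim y)
      have "(\<integral>\<^sup>+s. ennreal (indicator {0<..} s * inverse s) * (indicator {z. snd z \<le> norm (fst z) \<and> norm (fst z) \<le> 2 * snd z} (y, s) * \<phi> y) \<partial>lborel)
         = (\<integral>\<^sup>+s. (ennreal (inverse s) * indicator {norm y / 2..norm y} s) * \<phi> y \<partial>lborel)"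
        using elim by (intro nn_integral_cong) (auto simp: indicator_def)
      also have "\<dots> = ennreal (ln 2) * \<phi> y"
        using elim by (subst nn_integral_multc) (auto simp: nn_integral_inverse_Icc)
      finally show ?case .
    qed
  qed
  also have "\<dots> = ennreal (ln 2) * (\<integral>\<^sup>+x. \<phi> x \<partial>?\<mu>)" by (rule nn_integral_cmult) measurable
  finally show ?thesis .
qed

lemma radial_set_scale:
  assumes "0 < c"
  shows "(\<lambda>x. c *\<^sub>R x) ` radial_set \<rho> = radial_set (\<lambda>v. c * \<rho> v)"
proof (intro equalityI subsetI)
  fix x assume "x \<in> (\<lambda>x. c *\<^sub>R x) ` radial_set \<rho>"
  then obtain r v where "x = (c * r) *\<^sub>R v" "v \<in> sphere 0 1" "0 \<le> r" "r \<le> \<rho> v"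
    by (auto simp: radial_set_def)
  then show "x \<in> radial_set (\<lambda>v. c * \<rho> v)"
    unfolding radial_set_def mem_Collect_eq using assms
    by (intro exI[of _ "c * r"] exI[of _ v]) auto
next
  fix x assume "x \<in> radial_set (\<lambda>v. c * \<rho> v)"
  then obtain r v where rv: "x = r *\<^sub>R v" "v \<in> sphere 0 1" "0 \<le> r" "r \<le> c * \<rho> v"
    by (auto simp: radial_set_def)
  then have "(r / c) *\<^sub>R v \<in> radial_set \<rho>"
    unfolding radial_set_def mem_Collect_eq using assms
    by (intro exI[of _ "r / c"] exI[of _ v]) (auto simp: field_simps)
  then show "x \<in> (\<lambda>x. c *\<^sub>R x) ` radial_set \<rho>"
    using rv assms by (intro image_eqI[of _ _ "(r / c) *\<^sub>R v"]) auto
qed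

lemma flat_lebesgue_hyperplane:
  "flat_lebesgue x ({v}\<^sup>\<bottom>) = completion (distr (hyperplane_measure v) borel (\<lambda>w. x + w))"
  unfolding flat_lebesgue_def hyperplane_measure_def coord_measure_def Let_def
  by (subst distr_distr) (auto simp: o_def)

lemma sigma_finite_hyperplane_measure: "sigma_finite_measure (hyperplane_measure v)"
  by (rule hyperplane_basis[of v]) (simp add: sigma_finite_coord_measure)

lemma sets_hyperplane_measure [simp, measurable_cong]: "sets (hyperplane_measure v) = sets borel"
  by (simp add: hyperplane_measure_def)

lemma space_hyperplane_measure [simp]: "space (hyperplane_measure v) = UNIV"
  by (simp add: hyperplane_measure_def)

lemma AE_hyperplane_measure: "AE x in hyperplane_measure v. x \<in> {v}\<^sup>\<bottom>"
  by (rule hyperplane_basis[of v]) (use AE_coord_measure_span in metis)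

section \<open>Bodies of an even log-concave function\<close>

context integrable_even_log_concave
begin

lemma radial_moment_conv_gauge:
  assumes "0 < p" "x \<noteq> 0"
  shows "radial_moment p g x = ennreal (moment_gauge p g x powr (- p))"
  using assms radial_moment_finite[OF assms] by (simp add: moment_gauge_def powr_powr)

lemma closed_moment_body:
  assumes "0 < p"
  shows "closed {x. moment_gauge p g x \<le> 1}"
  using moment_body(1)[OF assms] by (auto simp: convex_body_def compact_imp_closed)

text \<open>Here \<open>p\<close> is the dimension of the hyperplane. Along every ray the
  \<open>p\<close>-th moment of the indicator of the body is \<open>1 / p\<close> times that of
  \<open>g\<close>, by definition of the gauge; integrating both over the shell gives proportional
  hyperplane integrals.\<close>

lemma hyperplane_measure_moment_body:
  assumes v: "v \<noteq> 0" and dim: "2 \<le> DIM('a)"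
  defines "p \<equiv> real DIM('a) - 1"
  shows "ennreal p * emeasure (hyperplane_measure v) {x. moment_gauge p g x \<le> 1} = (\<integral>\<^sup>+x. g x \<partial>hyperplane_measure v)"
proof -
  obtain B where B: "orthonormal B" "span B = {v}\<^sup>\<bottom>" "hyperplane_measure v = coord_measure B"
    by (rule hyperplane_basis)
  have "{v}\<^sup>\<bottom> = {x. v \<bullet> x = 0}" by (auto simp: orthogonal_comp_def orthogonal_def)
  then have "card B = DIM('a) - 1"
    using dim_span_eq_card_independent[OF orthonormal_independent[OF B(1)]] B(2) dim_hyperplane[OF v] by simp
  then have cB: "0 < card B" "real (card B) = p" using dim by (auto simp: p_def of_nat_diff)
  have p: "0 < p" using dim by (simp add: p_def)
  let ?\<mu> = "coord_measure B" and ?K = "{x. moment_gauge p g x \<le> 1}"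
  let ?S = "\<lambda>x::'a. indicator {x. 1 \<le> norm x \<and> norm x \<le> 2} x :: ennreal"
  let ?w = "\<lambda>s::real. ennreal (indicator {0<..} s * s powr (p - 1))"
  have [measurable]: "?K \<in> sets borel" by (intro borel_closed closed_moment_body p)
  have K: "(\<integral>\<^sup>+s. ?w s * indicator ?K (s *\<^sub>R x) \<partial>lborel) = ennreal (1 / p) * radial_moment p g x" if "x \<noteq> 0" for x
  proof -
    let ?N = "moment_gauge p g x"
    have N: "0 < ?N" by (intro moment_gauge_pos radial_moment_finite that p)
    have "(\<integral>\<^sup>+s. ?w s * indicator ?K (s *\<^sub>R x) \<partial>lborel) =
        (\<integral>\<^sup>+s. ennreal (s ^ (card B - 1)) * indicator {0..1 / ?N} s \<partial>lborel)"
    proof (rule nn_integral_cong_AE, use AE_lborel_singleton[of 0] in eventually_elim)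
      case (elim s)
      have "s powr (p - 1) = s ^ (card B - 1)" if "0 < s"
        using cB that by (simp flip: powr_realpow add: of_nat_diff)
      moreover have "s *\<^sub>R x \<in> ?K \<longleftrightarrow> s \<le> 1 / ?N" if "0 < s"
        using N that by (simp add: moment_gauge_scale[OF p] field_simps)
      ultimately show ?case using elim by (cases "0 < s") (auto simp: indicator_def)
    qed
    also have "\<dots> = ennreal ((1 / ?N) ^ card B / real (card B))"
      by (rule nn_integral_power_Icc) (use N cB in auto)
    also have "(1 / ?N) ^ card B / real (card B) = (1 / p) * ?N powr (- p)"
      using N cB by (simp add: powr_minus powr_realpow[symmetric] power_one_over divide_simps)
    also have "ennreal \<dots> = ennreal (1 / p) * radial_moment p g x"
      unfolding radial_moment_conv_gauge[OF p that] using p by (intro ennreal_mult) auto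
    finally show ?thesis .
  qed
  have "ennreal (ln 2) * emeasure ?\<mu> ?K = ennreal (ln 2) * (\<integral>\<^sup>+x. indicator ?K x \<partial>?\<mu>)" by simp
  also have "\<dots> = (\<integral>\<^sup>+x. ?S x * (\<integral>\<^sup>+s. ?w s * indicator ?K (s *\<^sub>R x) \<partial>lborel) \<partial>?\<mu>)"
    by (subst nn_integral_shell[OF B(1) cB(1), symmetric]) (auto simp: cB)
  also have "\<dots> = (\<integral>\<^sup>+x. ennreal (1 / p) * (?S x * radial_moment p g x) \<partial>?\<mu>)"
  proof (rule nn_integral_cong)
    fix x :: 'a
    show "?S x * (\<integral>\<^sup>+s. ?w s * indicator ?K (s *\<^sub>R x) \<partial>lborel) = ennreal (1 / p) * (?S x * radial_moment p g x)"
      by (cases "x = 0") (auto simp: K ac_simps)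
  qed
  also have "\<dots> = ennreal (1 / p) * (\<integral>\<^sup>+x. ?S x * (\<integral>\<^sup>+s. ?w s * ennreal (g (s *\<^sub>R x)) \<partial>lborel) \<partial>?\<mu>)"
  proof -
    have "radial_moment p g x = (\<integral>\<^sup>+s. ?w s * ennreal (g (s *\<^sub>R x)) \<partial>lborel)" for x
      unfolding radial_moment_def by (intro nn_integral_cong) (simp add: ennreal_mult[symmetric] g_nonneg mult.assoc)
    then show ?thesis by (simp only:) (rule nn_integral_cmult, measurable)
  qed
  also have "\<dots> = ennreal (1 / p) * (ennreal (ln 2) * (\<integral>\<^sup>+x. g x \<partial>?\<mu>))"
    by (subst nn_integral_shell[OF B(1) cB(1), symmetric]) (auto simp: cB)
  finally have "ennreal (ln 2) * emeasure ?\<mu> ?K = ennreal (ln 2) * (ennreal (1 / p) * (\<integral>\<^sup>+x. g x \<partial>?\<mu>))"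
    by (simp only: ac_simps)
  then have "emeasure ?\<mu> ?K = ennreal (1 / p) * (\<integral>\<^sup>+x. g x \<partial>?\<mu>)"
    by (simp add: ennreal_mult_cancel_left)
  then have "ennreal p * emeasure ?\<mu> ?K = (ennreal p * ennreal (1 / p)) * (\<integral>\<^sup>+x. g x \<partial>?\<mu>)"
    by (simp only: mult.assoc)
  also have "ennreal p * ennreal (1 / p) = 1" using p by (simp add: ennreal_mult[symmetric])
  finally show ?thesis by (simp add: B(3))
qed

lemma intersection_body_moment_body:
  assumes dim: "2 \<le> DIM('a)"
  defines "p \<equiv> real DIM('a) - 1"
  shows "(\<lambda>x. p *\<^sub>R x) ` intersection_body_set {x. moment_gauge p g x \<le> 1} = {x. section_gauge g x \<le> 1}"
proof -
  have p: "0 < p" using dim by (simp add: p_def)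
  let ?K = "{x. moment_gauge p g x \<le> 1}"
  have [measurable]: "?K \<in> sets borel" by (intro borel_closed closed_moment_body p)
  have "p * measure (flat_lebesgue 0 ({v}\<^sup>\<bottom>)) (?K \<inter> {v}\<^sup>\<bottom>) = 1 / section_gauge g v" if v: "norm v = 1" for v
  proof -
    have "closed ({v}\<^sup>\<bottom>)" by (intro closed_subspace subspace_orthogonal_comp)
    then have [measurable]: "{v}\<^sup>\<bottom> \<in> sets borel" by (rule borel_closed)
    have "measure (flat_lebesgue 0 ({v}\<^sup>\<bottom>)) (?K \<inter> {v}\<^sup>\<bottom>) = measure (hyperplane_measure v) (?K \<inter> {v}\<^sup>\<bottom>)"
      by (simp add: flat_lebesgue_hyperplane distr_id2 measure_completion)
    \<comment> \<open>The measure lives on the hyperplane, so intersecting with it changes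
      nothing.\<close>
    also have "\<dots> = measure (hyperplane_measure v) ?K"
      by (rule measure_eq_AE) (use AE_hyperplane_measure[of v] in \<open>auto\<close>)
    finally have "p * measure (flat_lebesgue 0 ({v}\<^sup>\<bottom>)) (?K \<inter> {v}\<^sup>\<bottom>) =
        enn2real (ennreal p * emeasure (hyperplane_measure v) ?K)"
      using p by (simp add: enn2real_mult measure_def)
    also have "\<dots> = enn2real (\<integral>\<^sup>+x. g x \<partial>hyperplane_measure v)"
      using hyperplane_measure_moment_body[of v] v dim unfolding p_def by force
    finally show ?thesis using v by (simp add: section_gauge_def)
  qed
  then show ?thesis
    unfolding intersection_body_set_def radial_set_scale[OF p]
    by (intro radial_set_inverse_gauge section_gauge_scale section_gauge_pos)
qed

lemma intersection_body_fun_eq: "intersection_body_fun g = {x. section_gauge g x \<le> 1}"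
  unfolding intersection_body_fun_def
proof (rule radial_set_inverse_gauge[OF _ section_gauge_scale section_gauge_pos])
  fix v :: 'a assume v: "norm v = 1"
  have "(LINT x|flat_lebesgue 0 ({v}\<^sup>\<bottom>). g x) = (LINT x|hyperplane_measure v. g x)"
    by (simp add: flat_lebesgue_hyperplane distr_id2 integral_completion)
  also have "\<dots> = enn2real (\<integral>\<^sup>+x. g x \<partial>hyperplane_measure v)"
    by (rule integral_eq_nn_integral) (auto simp: g_nonneg)
  finally show "(LINT x|flat_lebesgue 0 ({v}\<^sup>\<bottom>). g x) = 1 / section_gauge g v"
    using v by (simp add: section_gauge_def)
qed

lemma inverse_moment_gauge:
  assumes "0 < p" "v \<noteq> 0"
  shows "enn2real (radial_moment p g v) powr (1 / p) = 1 / moment_gauge p g v"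
  using assms by (simp add: moment_gauge_def powr_minus divide_simps)

lemma ball_mean_body_eq:
  assumes p: "0 < p"
  shows "ball_mean_body p g = {x. moment_gauge p g x \<le> 1}"
  unfolding ball_mean_body_def
proof (rule radial_set_inverse_gauge[OF _ moment_gauge_scale[OF p]])
  show "0 < moment_gauge p g x" if "x \<noteq> 0" for x
    by (intro moment_gauge_pos radial_moment_finite that p)
  fix v :: 'a assume "norm v = 1"
  then have v: "v \<noteq> 0" by force
  \<comment> \<open>Open and closed half lines give the same integrand even at \<open>r = 0\<close>,
    because \<open>0 powr (p - 1) = 0\<close>.\<close>
  have "(LINT r:{0..}|lebesgue. r powr (p - 1) * g (r *\<^sub>R v)) =
      (LINT r|lborel. indicator {0<..} r * (r powr (p - 1) * g (r *\<^sub>R v)))"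
    unfolding set_lebesgue_integral_def
    by (subst integral_completion) (auto intro!: Bochner_Integration.integral_cong simp: indicator_def)
  also have "\<dots> = enn2real (radial_moment p g v)"
    unfolding radial_moment_def by (rule integral_eq_nn_integral) (auto simp: g_nonneg)
  finally show "(LINT r:{0..}|lebesgue. r powr (p - 1) * g (r *\<^sub>R v)) powr (1 / p) = 1 / moment_gauge p g v"
    using inverse_moment_gauge[OF p v] by simp
qed

end

lemma (in log_concave_density) integrable_even_log_concave_autocorrelation:
  "integrable_even_log_concave (autocorrelation f0)"
  unfolding integrable_even_log_concave_def integrable_even_log_concave_axioms_def
  using even_log_concave_autocorrelation nn_integral_autocorrelation_lborel by simp

section \<open>Transfer to the given density\<close>

text \<open>Couples the given \<open>f\<close> with its Borel representative: the bodies are formed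
  from \<open>f\<close>, all estimates come from \<open>f0\<close>.\<close>

locale log_concave_representative = log_concave_density f0 U
  for f0 :: "'a::euclidean_space \<Rightarrow> real" and U +
  fixes f :: "'a \<Rightarrow> real" and N :: "'a set"
  assumes N: "N \<in> null_sets lborel" and f_eq: "\<And>x. x \<notin> N \<Longrightarrow> f x = f0 x"
begin

sublocale g: integrable_even_log_concave "autocorrelation f0"
  by (rule integrable_even_log_concave_autocorrelation)

lemma N_borel [measurable]: "N \<in> sets borel"
  using N by auto

lemma autocorrelation_eq: "autocorrelation f = autocorrelation f0"
proof
  fix x
  have "autocorrelation f x = (LINT y|lborel. f0 y * f0 (x + y))"
    unfolding autocorrelation_def
  proof (rule integral_completion_AE_eq)
    show "AE y in lborel. f y * f (x + y) = f0 y * f0 (x + y)"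
      using AE_not_in[OF N] AE_lborel_shift_not_in_null_set[OF N, of x]
      by eventually_elim (simp add: f_eq)
  qed measurable
  then show "autocorrelation f x = autocorrelation f0 x" by (simp add: autocorrelation_lborel)
qed

text \<open>The common computation behind both radial functions. The factor \<open>K\<close> is the
  inner integral of the statement, known only for almost every \<open>x\<close>. A divergent Bochner
  integral is read as 0; finiteness of the total shows that this can occur only where
  \<open>f0\<close> vanishes or on a null set.\<close>

lemma integral_correlation:
  assumes M: "sigma_finite_measure M" and [measurable]: "T \<in> M \<rightarrow>\<^sub>M borel" "w \<in> borel_measurable M"
    and w: "\<And>s. 0 \<le> w s"
    and fin: "(\<integral>\<^sup>+s. ennreal (w s) * ennreal (autocorrelation f0 (T s)) \<partial>M) < top"
    and K: "AE x in lborel. K x = (LINT s|M. w s * f0 (x + T s))"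
  shows "(LINT x|lebesgue. f x * K x) = enn2real (\<integral>\<^sup>+s. ennreal (w s) * ennreal (autocorrelation f0 (T s)) \<partial>M)"
proof -
  interpret M: sigma_finite_measure M by fact
  let ?I = "\<lambda>x. \<integral>\<^sup>+s. ennreal (w s) * ennreal (f0 (x + T s)) \<partial>M"
  let ?K = "\<lambda>x. LINT s|M. w s * f0 (x + T s)"
  have KI: "?K x = enn2real (?I x)" for x
    by (subst integral_eq_nn_integral) (auto simp: w nonneg ennreal_mult)
  have total: "(\<integral>\<^sup>+x. ennreal (f0 x) * ?I x \<partial>lborel) = (\<integral>\<^sup>+s. ennreal (w s) * ennreal (autocorrelation f0 (T s)) \<partial>M)"
    by (rule nn_integral_autocorrelation[OF M]) measurable
  have "(LINT x|lebesgue. f x * K x) = (LINT x|lborel. f0 x * ?K x)"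
  proof (rule integral_completion_AE_eq)
    show "AE x in lborel. f x * K x = f0 x * ?K x"
      using AE_not_in[OF N] K by eventually_elim (simp add: f_eq)
  qed measurable
  also have "\<dots> = enn2real (\<integral>\<^sup>+x. ennreal (f0 x * ?K x) \<partial>lborel)"
    by (rule integral_eq_nn_integral) (auto simp: nonneg KI)
  also have "(\<integral>\<^sup>+x. ennreal (f0 x * ?K x) \<partial>lborel) = (\<integral>\<^sup>+x. ennreal (f0 x) * ?I x \<partial>lborel)"
  proof (rule nn_integral_cong_AE)
    have "AE x in lborel. ennreal (f0 x) * ?I x \<noteq> \<infinity>"
      by (rule nn_integral_noteq_infinite) (use fin total in auto)
    then show "AE x in lborel. ennreal (f0 x * ?K x) = ennreal (f0 x) * ?I x"
    proof eventually_elim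
      case (elim x)
      show ?case
      proof (cases "f0 x = 0")
        case False
        then have "?I x < top" using elim nonneg[of x] by (auto simp: ennreal_mult_eq_top_iff less_top)
        then show ?thesis by (simp add: KI ennreal_mult nonneg)
      qed simp
    qed
  qed
  finally show ?thesis unfolding total .
qed

lemma cross_section_body_eq: "cross_section_body f = {x. section_gauge (autocorrelation f0) x \<le> 1}"
  unfolding cross_section_body_def
proof (rule radial_set_inverse_gauge[OF _ g.section_gauge_scale g.section_gauge_pos])
  fix v :: 'a assume v: "norm v = 1"
  let ?H = "hyperplane_measure v"
  \<comment> \<open>For an exceptional \<open>x\<close> the hyperplane through it may meet
    \<open>N\<close> in positive measure, for instance along a facet of the support.\<close>
  have "AE x in lborel. AE s in ?H. x + s \<notin> N"
    by (rule AE_AE_shift_not_in_null_set[OF N sigma_finite_hyperplane_measure]) measurable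
  then have "AE x in lborel. (LINT y|flat_lebesgue x ({v}\<^sup>\<bottom>). f y) = (LINT s|?H. 1 * f0 (x + s))"
  proof eventually_elim
    case (elim x)
    have "(LINT y|flat_lebesgue x ({v}\<^sup>\<bottom>). f y) = (LINT y|distr ?H borel (\<lambda>w. x + w). f0 y)"
      unfolding flat_lebesgue_hyperplane
    proof (rule integral_completion_AE_eq)
      have "AE y in distr ?H borel (\<lambda>w. x + w). y \<notin> N"
        using elim by (subst AE_distr_iff) auto
      then show "AE y in distr ?H borel (\<lambda>w. x + w). f y = f0 y"
        by eventually_elim (simp add: f_eq)
    qed measurable
    then show ?case by (simp add: integral_distr)
  qed
  then have "(LINT x|lebesgue. f x * (LINT y|flat_lebesgue x ({v}\<^sup>\<bottom>). f y)) =
      enn2real (\<integral>\<^sup>+s. ennreal 1 * ennreal (autocorrelation f0 s) \<partial>?H)"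
    by (intro integral_correlation[OF sigma_finite_hyperplane_measure])
       (auto simp: g.hyperplane_integral_pos_finite)
  then show "(LINT x|lebesgue. (LINT y|flat_lebesgue x ({v}\<^sup>\<bottom>). f y) * f x) = 1 / section_gauge (autocorrelation f0) v"
    using v by (simp add: section_gauge_def mult.commute)
qed

lemma radial_mean_body_eq:
  assumes p: "0 < p"
  shows "radial_mean_body p f = {x. moment_gauge p (autocorrelation f0) x \<le> 1}"
  unfolding radial_mean_body_def
proof (rule radial_set_inverse_gauge[OF _ g.moment_gauge_scale[OF p]])
  show "0 < moment_gauge p (autocorrelation f0) x" if "x \<noteq> 0" for x
    by (intro g.moment_gauge_pos g.radial_moment_finite that p)
  fix v :: 'a assume "norm v = 1"
  then have v: "v \<noteq> 0" by force
  let ?w = "\<lambda>r. indicator {0<..} r * r powr (p - 1)"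
  have J: "(\<integral>\<^sup>+r. ennreal (?w r) * ennreal (autocorrelation f0 (r *\<^sub>R v)) \<partial>lborel) = radial_moment p (autocorrelation f0) v"
    unfolding radial_moment_def
    by (intro nn_integral_cong) (simp add: ennreal_mult[symmetric] g.g_nonneg mult.assoc)
  have "AE x in lborel. AE r in lborel. x + r *\<^sub>R v \<notin> N"
    by (rule AE_AE_shift_not_in_null_set[OF N sigma_finite_lborel]) measurable
  then have "AE x in lborel. (LINT r:{0..}|lebesgue. r powr (p - 1) * f (x + r *\<^sub>R v)) = (LINT r|lborel. ?w r * f0 (x + r *\<^sub>R v))"
  proof eventually_elim
    case (elim x)
    show ?case
      unfolding set_lebesgue_integral_def
    proof (rule integral_completion_AE_eq)
      show "AE r in lborel. indicator {0..} r *\<^sub>R (r powr (p - 1) * f (x + r *\<^sub>R v)) = ?w r * f0 (x + r *\<^sub>R v)"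
        using elim by eventually_elim (auto simp: f_eq indicator_def)
    qed measurable
  qed
  then have "(LINT x|lebesgue. f x * (LINT r:{0..}|lebesgue. r powr (p - 1) * f (x + r *\<^sub>R v))) =
      enn2real (radial_moment p (autocorrelation f0) v)"
    unfolding J[symmetric] using g.radial_moment_finite[OF p v]
    by (intro integral_correlation[OF sigma_finite_lborel]) (auto simp: J)
  then show "(LINT x|lebesgue. f x * (LINT r:{0..}|lebesgue. r powr (p - 1) * f (x + r *\<^sub>R v))) powr (1 / p) =
      1 / moment_gauge p (autocorrelation f0) v"
    using g.inverse_moment_gauge[OF p v] by simp
qed

end

theorem theorem3p3:
  fixes f :: "real ^ 'n \<Rightarrow> real" and p :: real
  assumes "p > 0"
    and "probability_density f"
    and "log_concave f"
  shows "symmetric_set (cross_section_body f) \<and> convex_body (cross_section_body f)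
    \<and> symmetric_set (radial_mean_body p f) \<and> convex_body (radial_mean_body p f)
    \<and> cross_section_body f = intersection_body_fun (autocorrelation f)
    \<and> (CARD('n) \<ge> 2 \<longrightarrow>
         cross_section_body f =
           (\<lambda>x. (real CARD('n) - 1) *\<^sub>R x) `
             intersection_body_set (radial_mean_body (real CARD('n) - 1) f))
    \<and> radial_mean_body p f = ball_mean_body p (autocorrelation f)"
proof -
  obtain f0 U N where "log_concave_density f0 U" "N \<in> null_sets lborel" "\<And>x. x \<notin> N \<Longrightarrow> f x = f0 x"
    using log_concave_density_representative[OF assms(2,3)] by metis
  then interpret log_concave_representative f0 U f N
    by (intro log_concave_representative.intro log_concave_representative_axioms.intro)
  \<comment> \<open>In dimension one the exponent \<open>CARD('n) - 1\<close> would be 0, outside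
    the range of the radial moments.\<close>
  have "cross_section_body f = (\<lambda>x. (real CARD('n) - 1) *\<^sub>R x) `
      intersection_body_set (radial_mean_body (real CARD('n) - 1) f)" if "2 \<le> CARD('n)"
    using g.intersection_body_moment_body that
    by (simp add: cross_section_body_eq radial_mean_body_eq)
  then show ?thesis
    using assms(1) g.section_body g.moment_body
    by (simp add: cross_section_body_eq radial_mean_body_eq autocorrelation_eq
        g.intersection_body_fun_eq g.ball_mean_body_eq)
qed

end
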